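(* Let $a\in(0,1/2)$ and let $G\colon[0,1)\to[0,1)$ be the Gauss map, defined by $G(y)=1/y \bmod 1$ if $y\ne 0$, and $G(0)=0$. For any $b>1$ and for Lebesgue-almost every $y\in[0,1)$, the sequence (the elements listed in increasing order) $$\{n\in\mathbb{N}:\ G^ny\in(0,\,b^{n^{-a}}-1)\}$$ is pointwise universally $L^2$-good and ergodic.
   Context: $\mathbb{N}=\{1,2,3,\dots\}$. $G^n$ is the $n$-fold iterate of $G$. A measure-preserving system $(X,\mathcal{X},\mu,T)$ is a probability space $(X,\mathcal{X},\mu)$ with a measurable map $T\colon X\to X$ (not assumed invertible) such that $\mu(T^{-1}A)=\mu(A)$ for all $A\in\mathcal{X}$. $\mathcal{I}(T)=\{A\in\mathcal{X}: T^{-1}A=A \bmod \mu\}$ is the $\sigma$-algebra of invariant sets and $\mathbb{E}_\mu(f|\mathcal{I}(T))$ is the conditional expectation. A sequence of integers $(a_n)_{n\in\mathbb{N}}$ is pointwise universally $L^p$-good if for every measure-preserving system $(X,\mathcal{X},\mu,T)$ and $f\in L^p(\mu)$ the averages $\frac1N\sum_{n=1}^N f(T^{a_n}x)$ converge for $\mu$-almost every $x\in X$. It is ergodic if for every measure-preserving system and every $f\in L^2(\mu)$ the $L^2(\mu)$-limit of these averages exists and equals $\mathbb{E}_\mu(f|\mathcal{I}(T))$. An infinite subset of $\mathbb{N}$ is identified with the sequence enumerating it in increasing order; the claim includes that the set in question is infinite for almost every $y$. The exceptional null set of $y$ does not depend on the system $(X,\mathcal{X},\mu,T)$ or on $f$.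 *)

theory Defs
  imports "HOL-Probability.Probability"
begin

definition measure_preserving_system :: "'x measure \<Rightarrow> ('x \<Rightarrow> 'x) \<Rightarrow> bool" where
  "measure_preserving_system M T \<longleftrightarrow>
     prob_space M \<and> T \<in> M \<rightarrow>\<^sub>M M \<and>
     (\<forall>A\<in>sets M. emeasure M (T -` A \<inter> space M) = emeasure M A)"

definition invariant_sets :: "'x measure \<Rightarrow> ('x \<Rightarrow> 'x) \<Rightarrow> 'x set set" where
  "invariant_sets M T =
     {A \<in> sets M. sym_diff (T -` A \<inter> space M) A \<in> null_sets M}"

definition invariant_algebra :: "'x measure \<Rightarrow> ('x \<Rightarrow> 'x) \<Rightarrow> 'x measure" where
  "invariant_algebra M T = sigma (space M) (invariant_sets M T)"

text \<open>The invariant sets already form a \<open>\<sigma>\<close>-algebra, so passing to the generated one adds nothing.\<close>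

lemma sigma_algebra_invariant_sets:
  assumes "T \<in> M \<rightarrow>\<^sub>M M"
  shows "sigma_algebra (space M) (invariant_sets M T)"
  unfolding sigma_algebra_iff2
proof (intro conjI ballI allI impI)
  show "invariant_sets M T \<subseteq> Pow (space M)"
    using sets.sets_into_space by (auto simp: invariant_sets_def)
  show "{} \<in> invariant_sets M T" by (auto simp: invariant_sets_def)
next
  fix A assume A: "A \<in> invariant_sets M T"
  have "sym_diff (T -` (space M - A) \<inter> space M) (space M - A) = sym_diff (T -` A \<inter> space M) A"
    using A sets.sets_into_space[of A M] measurable_space[OF assms]
    by (auto simp: invariant_sets_def)
  with A show "space M - A \<in> invariant_sets M T" by (auto simp: invariant_sets_def)
next
  fix A :: "nat \<Rightarrow> _" assume "range A \<subseteq> invariant_sets M T"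
  then have A: "A i \<in> sets M" "sym_diff (T -` A i \<inter> space M) (A i) \<in> null_sets M" for i
    by (auto simp: invariant_sets_def)
  have *: "(\<Union>i. sym_diff (T -` A i \<inter> space M) (A i)) \<in> null_sets M"
    using A(2) by blast
  have "sym_diff (T -` (\<Union>i. A i) \<inter> space M) (\<Union>i. A i) \<in> null_sets M"
  proof (rule null_sets_subset[OF *])
    show "sym_diff (T -` (\<Union>i. A i) \<inter> space M) (\<Union>i. A i) \<in> sets M"
      using A(1) assms by (intro sets.Un sets.Diff measurable_sets[OF assms] sets.countable_UN) auto
  qed auto
  with A(1) show "(\<Union>i. A i) \<in> invariant_sets M T" by (auto simp: invariant_sets_def)
qed

lemma space_invariant_algebra: "space (invariant_algebra M T) = space M"
  by (simp add: invariant_algebra_def space_measure_of_conv)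

lemma sets_invariant_algebra:
  assumes "T \<in> M \<rightarrow>\<^sub>M M"
  shows "sets (invariant_algebra M T) = invariant_sets M T"
  unfolding invariant_algebra_def
  using sigma_algebra.sets_measure_of_eq[OF sigma_algebra_invariant_sets[OF assms]] .

lemma subalgebra_invariant_algebra:
  assumes "T \<in> M \<rightarrow>\<^sub>M M"
  shows "subalgebra M (invariant_algebra M T)"
  using sets_invariant_algebra[OF assms]
  by (auto simp: subalgebra_def space_invariant_algebra invariant_sets_def)

definition complex_cond_exp :: "'x measure \<Rightarrow> 'x measure \<Rightarrow> ('x \<Rightarrow> complex) \<Rightarrow> 'x \<Rightarrow> complex" where
  "complex_cond_exp M F f x =
     Complex (real_cond_exp M F (\<lambda>x. Re (f x)) x) (real_cond_exp M F (\<lambda>x. Im (f x)) x)"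

definition Lp_functions :: "real \<Rightarrow> 'x measure \<Rightarrow> ('x \<Rightarrow> complex) set" where
  "Lp_functions p M =
     {f \<in> borel_measurable M. integrable M (\<lambda>x. norm (f x) powr p)}"

definition ergodic_average ::
  "(nat \<Rightarrow> nat) \<Rightarrow> ('x \<Rightarrow> 'x) \<Rightarrow> ('x \<Rightarrow> complex) \<Rightarrow> nat \<Rightarrow> 'x \<Rightarrow> complex" where
  "ergodic_average s T f N x = (\<Sum>n = 1..N. f ((T ^^ s n) x)) / of_nat N"

text \<open>
  The next two notions range over all systems whose underlying set is a subset of the type
  \<^typ>\<open>'x\<close>; HOL cannot quantify over \<^typ>\<open>'x\<close> inside a formula, so it is a parameter.
  Only the values \<open>s 1, s 2, \<dots>\<close> of the sequence are used.
\<close>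

definition pointwise_universally_good :: "'x itself \<Rightarrow> real \<Rightarrow> (nat \<Rightarrow> nat) \<Rightarrow> bool" where
  "pointwise_universally_good _ p s \<longleftrightarrow>
     (\<forall>(M :: 'x measure) T f. measure_preserving_system M T \<longrightarrow> f \<in> Lp_functions p M \<longrightarrow>
        (AE x in M. convergent (\<lambda>N. ergodic_average s T f N x)))"

definition ergodic_sequence :: "'x itself \<Rightarrow> (nat \<Rightarrow> nat) \<Rightarrow> bool" where
  "ergodic_sequence _ s \<longleftrightarrow>
     (\<forall>(M :: 'x measure) T f. measure_preserving_system M T \<longrightarrow> f \<in> Lp_functions 2 M \<longrightarrow>
        ((\<lambda>N. \<integral>\<^sup>+ x. ennreal ((norm (ergodic_average s T f N x
                 - complex_cond_exp M (invariant_algebra M T) f x))\<^sup>2) \<partial>M)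
          \<longlonglongrightarrow> 0))"

text \<open>The constant \<^const>\<open>enumerate\<close> counts from 0, the sequences here from 1.\<close>

definition increasing_sequence :: "nat set \<Rightarrow> nat \<Rightarrow> nat" where
  "increasing_sequence S n = enumerate S (n - 1)"

definition gauss_map :: "real \<Rightarrow> real" where
  "gauss_map y = (if y = 0 then 0 else frac (1 / y))"

definition gauss_hits :: "real \<Rightarrow> real \<Rightarrow> real \<Rightarrow> nat set" where
  "gauss_hits a b y =
     {n. 1 \<le> n \<and> (gauss_map ^^ n) y \<in> {0 <..< b powr (real n powr (- a)) - 1}}"

text \<open>
  A set of \<open>y\<close> that does not mention any type variable. Using it as the exceptional set for
  systems on every type expresses that the exceptional null set does not depend on the system,
  not even through its type. The type \<^typ>\<open>nat \<Rightarrow> complex\<close> is large enough for this purpose: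
  it carries the process \<open>(f (T\<^sup>n x))\<^sub>n\<close>, with the shift map, of every system and every
  \<open>f\<close>.
\<close>

definition exceptional_set :: "real \<Rightarrow> real \<Rightarrow> real set" where
  "exceptional_set a b = {y \<in> {0..<1}.
     \<not> (infinite (gauss_hits a b y) \<and>
        pointwise_universally_good TYPE(nat \<Rightarrow> complex) 2 (increasing_sequence (gauss_hits a b y)) \<and>
        ergodic_sequence TYPE(nat \<Rightarrow> complex) (increasing_sequence (gauss_hits a b y)))}"

end

theory Submission
  imports Defs
begin

text \<open>
  Let \<open>p\<^sub>n\<close> be the Gauss measure of the target interval at time \<open>n\<close>,
  let \<open>X\<^sub>n(y)\<close> be the indicator of a hit at time \<open>n\<close>,
  \<open>Y\<^sub>n = X\<^sub>n - p\<^sub>n\<close> and \<open>W\<^sub>N = p\<^sub>1 + \<dots> +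
  p\<^sub>N\<close>. Since \<open>T\<close> acts by isometries, expanding the square gives
  \<open>\<parallel>\<Sum>n\<le>N. Y\<^sub>n f \<circ> T\<^sup>n\<parallel>\<^sup>2 \<le>
  \<parallel>f\<parallel>\<^sup>2 R\<^sub>N\<close>, where \<open>R\<^sub>N\<close> is the sum of
  the absolute values of the autocorrelations of \<open>Y\<^sub>1, \<dots>, Y\<^sub>N\<close> and
  does not depend on the system. The Gauss map mixes exponentially on monotone functions, because
  its transfer operator exchanges nondecreasing and nonincreasing functions and halves their
  oscillation. This bounds the fourth moments \<open>E(Y\<^sub>n Y\<^bsub>n+h\<^esub> Y\<^sub>m
  Y\<^bsub>m+h\<^esub>)\<close>, and for \<open>a < 1/2\<close> the sum of \<open>R\<^sub>N /
  W\<^sub>N\<^sup>2\<close> over \<open>N = k\<^sup>P\<close> is finite for almost every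
  \<open>y\<close> when \<open>P\<close> is large. For such \<open>y\<close> the averages along the
  hits have the same limit as the averages with weights \<open>p\<^sub>n\<close>, which converge by
  Birkhoff's theorem; the times between \<open>k\<^sup>P\<close> and \<open>(k + 1)\<^sup>P\<close>
  are filled in by monotonicity for \<open>f \<ge> 0\<close>.
\<close>

section \<open>Measure-preserving systems and Birkhoff's theorem\<close>

text \<open>The bound a < 1/2 is the price of the absolute values. The correlations of an unknown
  system can have either sign at each lag, so no cancellation between lags is available. By mixing,
  the squares of the N autocorrelations have total mean of order K W_N^2, where K is a gap beyond
  which correlations are negligible. Cauchy-Schwarz over the N lags then bounds the mean of R_N by
  about W_N + W_N sqrt(K N). This is small against W_N^2 once W_N outgrows sqrt(K N), and W_N is at
  least a constant times N^(1 - a). Along N = k^P a gap K proportional to k is enough, which leaves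
  room for every a < 1/2 when P is large. The subsequence is polynomial so that the ratio of
  consecutive times tends to 1.

  Mixing is used in a one-sided form: a monotone function stands at the earliest of the four times,
  and the product of the other three factors is treated as an arbitrary bounded function of a later
  point of the orbit.\<close>

locale mps = prob_space M for M :: "'x measure" +
  fixes T :: "'x \<Rightarrow> 'x"
  assumes measurable_T [measurable]: "T \<in> M \<rightarrow>\<^sub>M M"
    and emeasure_vimage: "A \<in> sets M \<Longrightarrow> emeasure M (T -` A \<inter> space M) = emeasure M A"

lemma mps_iff: "measure_preserving_system M T \<longleftrightarrow> mps M T"
  by (auto simp: measure_preserving_system_def mps_def mps_axioms_def)

context mps
begin

lemma measurable_funpow [measurable]: "T ^^ n \<in> M \<rightarrow>\<^sub>M M"
  by (induction n) (auto simp: id_def)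

lemma distr_T: "distr M M T = M"
  by (rule measure_eqI) (auto simp: emeasure_distr emeasure_vimage)

lemma distr_funpow: "distr M M (T ^^ n) = M"
proof (induction n)
  case 0
  then show ?case using distr_id[of M] by (simp add: id_def)
next
  case (Suc n)
  have "distr M M (T ^^ Suc n) = distr (distr M M (T ^^ n)) M T"
    by (subst distr_distr) (auto simp: comp_def)
  then show ?case by (simp only: Suc distr_T)
qed

lemma AE_funpow: "AE x in M. P x \<Longrightarrow> AE x in M. P ((T ^^ n) x)"
  using AE_distrD[OF measurable_funpow, of P n] by (simp only: distr_funpow)

lemma nn_integral_funpow:
  assumes [measurable]: "f \<in> borel_measurable M"
  shows "(\<integral>\<^sup>+x. f ((T ^^ n) x) \<partial>M) = (\<integral>\<^sup>+x. f x \<partial>M)"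
  using nn_integral_distr[of "T ^^ n" M M f] by (simp add: distr_funpow)

lemma integrable_funpow:
  fixes f :: "'x \<Rightarrow> 'b :: {banach, second_countable_topology}"
  assumes "integrable M f"
  shows "integrable M (\<lambda>x. f ((T ^^ n) x))"
  using integrable_distr_eq[of "T ^^ n" M M f] assms by (simp add: distr_funpow)

lemma integral_funpow:
  fixes f :: "'x \<Rightarrow> 'b :: {banach, second_countable_topology}"
  assumes "f \<in> borel_measurable M"
  shows "(\<integral>x. f ((T ^^ n) x) \<partial>M) = (\<integral>x. f x \<partial>M)"
  using integral_distr[of "T ^^ n" M M f] assms by (simp add: distr_funpow)

abbreviation "Inv \<equiv> invariant_algebra M T"

lemma finite_measure_subalgebra_Inv: "finite_measure_subalgebra M Inv"
  by unfold_locales (rule subalgebra_invariant_algebra[OF measurable_T])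

lemma AE_invariant_set:
  assumes "A \<in> invariant_sets M T"
  shows "AE x in M. T x \<in> A \<longleftrightarrow> x \<in> A"
proof -
  have "AE x in M. x \<notin> sym_diff (T -` A \<inter> space M) A"
    using assms by (intro AE_not_in) (auto simp: invariant_sets_def)
  then show ?thesis using AE_space by eventually_elim auto
qed

text \<open>Sublevel sets of \<open>h\<close> are invariant sets. Rational thresholds need only
  countably many null sets, and two different real values are separated by a rational.\<close>

lemma AE_invariant_measurable:
  fixes h :: "'x \<Rightarrow> real"
  assumes [measurable]: "h \<in> borel_measurable Inv"
  shows "AE x in M. h (T x) = h x"
proof -
  have "AE x in M. h (T x) < real_of_rat q \<longleftrightarrow> h x < real_of_rat q" for q
  proof -
    have "{x \<in> space Inv. h x < real_of_rat q} \<in> sets Inv" by measurable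
    then have "{x \<in> space M. h x < real_of_rat q} \<in> invariant_sets M T"
      by (simp add: sets_invariant_algebra space_invariant_algebra)
    from AE_invariant_set[OF this] show ?thesis
      using AE_space by eventually_elim (use measurable_space[OF measurable_T] in auto)
  qed
  then have "AE x in M. \<forall>q. h (T x) < real_of_rat q \<longleftrightarrow> h x < real_of_rat q"
    by (simp add: AE_all_countable)
  then show ?thesis
  proof eventually_elim
    case (elim x)
    show ?case
    proof (rule ccontr)
      assume "h (T x) \<noteq> h x"
      then consider "h (T x) < h x" | "h x < h (T x)" by linarith
      then show False
        by cases (use elim of_rat_dense less_asym in metis)+
    qed
  qed
qed

lemma AE_invariant_measurable_funpow:
  fixes h :: "'x \<Rightarrow> real"
  assumes "h \<in> borel_measurable Inv"
  shows "AE x in M. \<forall>n. h ((T ^^ n) x) = h x"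
proof -
  have "AE x in M. \<forall>n. h ((T ^^ Suc n) x) = h ((T ^^ n) x)"
    using AE_funpow[OF AE_invariant_measurable[OF assms]] by (simp add: AE_all_countable)
  then show ?thesis
  proof eventually_elim
    case (elim x)
    have "h ((T ^^ n) x) = h x" for n
      by (induction n) (use elim in simp_all)
    then show ?case by simp
  qed
qed

lemma integral_invariant_funpow:
  fixes f :: "'x \<Rightarrow> real"
  assumes A: "A \<in> invariant_sets M T" and [measurable]: "f \<in> borel_measurable M"
  shows "(\<integral>x. indicator A x * f ((T ^^ n) x) \<partial>M) = (\<integral>x. indicator A x * f x \<partial>M)"
proof -
  have [measurable]: "A \<in> sets M" using A by (simp add: invariant_sets_def)
  have "A \<in> sets Inv" by (simp add: A sets_invariant_algebra)
  then have "AE x in M. \<forall>n. indicator A ((T ^^ n) x) = (indicator A x :: real)"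
    by (intro AE_invariant_measurable_funpow) auto
  then have "(\<integral>x. indicator A x * f ((T ^^ n) x) \<partial>M) =
      (\<integral>x. indicator A ((T ^^ n) x) * f ((T ^^ n) x) \<partial>M)"
    by (intro integral_cong_AE) auto
  also have "\<dots> = (\<integral>x. indicator A x * f x \<partial>M)"
    by (rule integral_funpow) auto
  finally show ?thesis .
qed

text \<open>This is the maximum of the orbit sums of \<open>g\<close> of lengths 1 to n + 1. The
  recursive form makes \<open>run_max g (Suc n) x - run_max g n (T x)\<close> equal to
  \<open>g x\<close> as soon as \<open>run_max g n (T x)\<close> is nonnegative.\<close>

primrec run_max :: "('x \<Rightarrow> real) \<Rightarrow> nat \<Rightarrow> 'x \<Rightarrow> real" where
  "run_max g 0 x = g x"
| "run_max g (Suc n) x = g x + max 0 (run_max g n (T x))"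

lemma run_max_integrable: "integrable M g \<Longrightarrow> integrable M (run_max g n)"
proof (induction n)
  case 0
  then show ?case by (simp cong: integrable_cong)
next
  case (Suc n)
  then have "integrable M (\<lambda>x. run_max g n ((T ^^ 1) x))"
    by (intro integrable_funpow) auto
  with Suc have "integrable M (\<lambda>x. g x + max 0 (run_max g n (T x)))" by auto
  then show ?case by (simp cong: integrable_cong)
qed

lemma run_max_mono: "run_max g n x \<le> run_max g (Suc n) x"
  by (induction n arbitrary: x) (auto simp: max.coboundedI2 intro: max.mono)

lemma sum_le_run_max: "(\<Sum>i\<le>n. g ((T ^^ i) x)) \<le> run_max g n x"
proof (induction n arbitrary: x)
  case (Suc n)
  have "(\<Sum>i\<le>Suc n. g ((T ^^ i) x)) = g x + (\<Sum>i\<le>n. g ((T ^^ i) (T x)))"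
    by (subst sum.atMost_Suc_shift) (simp add: funpow_swap1)
  with Suc[of "T x"] show ?case by simp
qed simp

text \<open>On the invariant set where the running maxima are unbounded,
  \<open>run_max g (Suc n) - run_max g n \<circ> T\<close> decreases to \<open>g\<close>, while its integral is nonnegative.\<close>

lemma null_run_max_unbounded:
  assumes g: "integrable M g" and e: "e > 0"
    and neg: "\<And>A. A \<in> invariant_sets M T \<Longrightarrow> (\<integral>x. indicator A x * g x \<partial>M) = - e * measure M A"
  shows "AE x in M. \<exists>B. \<forall>n. run_max g n x \<le> B"
proof -
  define A where "A = {x \<in> space M. \<forall>B::nat. \<exists>n. run_max g n x > real B}"
  note [measurable] = borel_measurable_integrable[OF run_max_integrable[OF g]]
    borel_measurable_integrable[OF g]
  have [measurable]: "A \<in> sets M" unfolding A_def by measurable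
  have "T x \<in> A \<longleftrightarrow> x \<in> A" if x: "x \<in> space M" for x
  proof -
    have Tx: "T x \<in> space M" using x measurable_space[OF measurable_T] by auto
    show ?thesis
    proof
      assume H: "T x \<in> A"
      have "\<exists>n. run_max g n x > real B" for B
      proof -
        obtain n where "run_max g n (T x) > real (nat \<lceil>real B + \<bar>g x\<bar>\<rceil>)"
          using H unfolding A_def by blast
        then have "run_max g n (T x) > real B + \<bar>g x\<bar>" by linarith
        then have "run_max g (Suc n) x > real B" by simp
        then show ?thesis by blast
      qed
      then show "x \<in> A" using x by (simp add: A_def)
    next
      assume H: "x \<in> A"
      have "\<exists>n. run_max g n (T x) > real B" for B
      proof -
        obtain n where n: "run_max g n x > real (nat \<lceil>real B + \<bar>g x\<bar>\<rceil>)"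
          using H unfolding A_def by blast
        then have n: "run_max g n x > real B + \<bar>g x\<bar>" by linarith
        \<comment> \<open>At index 0 the value is \<open>g x\<close>, which is too small, so the
          recursion applies to \<open>n\<close>.\<close>
        then obtain k where "n = Suc k" by (cases n) auto
        then show ?thesis using n by (intro exI[of _ k]) (auto simp: max_def split: if_splits)
      qed
      then show "T x \<in> A" using Tx by (simp add: A_def)
    qed
  qed
  then have sd: "sym_diff (T -` A \<inter> space M) A = {}"
    using sets.sets_into_space[OF \<open>A \<in> sets M\<close>] by blast
  have A: "A \<in> invariant_sets M T"
    unfolding invariant_sets_def mem_Collect_eq sd using \<open>A \<in> sets M\<close> by auto
  define d where "d n x = indicator A x * (run_max g (Suc n) x - run_max g n (T x))" for n x
  have rT: "integrable M (\<lambda>x. run_max g n (T x))" for n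
    using integrable_funpow[OF run_max_integrable[OF g], of n 1] by simp
  have "(\<lambda>n. \<integral>x. d n x \<partial>M) \<longlonglongrightarrow> (\<integral>x. indicator A x * g x \<partial>M)"
  proof (rule integral_dominated_convergence[where w = "\<lambda>x. \<bar>g x\<bar> + \<bar>g (T x)\<bar>"])
    show "integrable M (\<lambda>x. \<bar>g x\<bar> + \<bar>g (T x)\<bar>)" using g rT[of 0] by auto
    show "AE x in M. (\<lambda>n. d n x) \<longlonglongrightarrow> indicator A x * g x"
    proof (rule AE_I2)
      fix x assume x: "x \<in> space M"
      show "(\<lambda>n. d n x) \<longlonglongrightarrow> indicator A x * g x"
      proof (cases "x \<in> A")
        case True
        then have "T x \<in> A" using x \<open>x \<in> space M \<Longrightarrow> (T x \<in> A) = (x \<in> A)\<close> by simp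
        then obtain n0 where "run_max g n0 (T x) > real 0" unfolding A_def by blast
        then have "run_max g n (T x) \<ge> 0" if "n \<ge> n0" for n
          using lift_Suc_mono_le[of "\<lambda>n. run_max g n (T x)", OF run_max_mono that] by simp
        then have "\<forall>\<^sub>F n in sequentially. d n x = indicator A x * g x"
          using True by (intro eventually_sequentiallyI[of n0]) (auto simp: d_def)
        then show ?thesis by (rule tendsto_eventually)
      qed (simp add: d_def)
    qed
    show "AE x in M. norm (d n x) \<le> \<bar>g x\<bar> + \<bar>g (T x)\<bar>" for n
    proof (rule AE_I2)
      fix x
      \<comment> \<open>The difference exceeds \<open>g x\<close> only by the negative part of
        \<open>run_max g n (T x)\<close>, and that is at most the absolute value of
        \<open>g (T x)\<close>.\<close>
      have "run_max g n (T x) \<ge> g (T x)"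
        using lift_Suc_mono_le[of "\<lambda>n. run_max g n (T x)" 0 n, OF run_max_mono] by simp
      then show "norm (d n x) \<le> \<bar>g x\<bar> + \<bar>g (T x)\<bar>"
        by (auto simp: d_def indicator_def)
    qed
  qed (auto simp: d_def)
  moreover have "(\<integral>x. d n x \<partial>M) \<ge> 0" for n
  proof -
    have i1: "integrable M (\<lambda>x. indicator A x * run_max g k x)" for k
      using integrable_mult_indicator[OF \<open>A \<in> sets M\<close> run_max_integrable[OF g]] by simp
    have i2: "integrable M (\<lambda>x. indicator A x * run_max g n (T x))"
      using integrable_mult_indicator[OF \<open>A \<in> sets M\<close> rT] by simp
    have "(\<integral>x. d n x \<partial>M) =
        (\<integral>x. indicator A x * run_max g (Suc n) x \<partial>M) - (\<integral>x. indicator A x * run_max g n (T x) \<partial>M)"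
      using Bochner_Integration.integral_diff[OF i1[of "Suc n"] i2]
      unfolding d_def right_diff_distrib .
    moreover have "(\<integral>x. indicator A x * run_max g n (T x) \<partial>M) = (\<integral>x. indicator A x * run_max g n x \<partial>M)"
      using integral_invariant_funpow[OF A, of "run_max g n" 1] by simp
    moreover have "(\<integral>x. indicator A x * run_max g n x \<partial>M) \<le> (\<integral>x. indicator A x * run_max g (Suc n) x \<partial>M)"
      by (rule integral_mono[OF i1 i1]) (intro mult_left_mono run_max_mono, simp)
    ultimately show ?thesis by linarith
  qed
  ultimately have "0 \<le> (\<integral>x. indicator A x * g x \<partial>M)"
    by (intro LIMSEQ_le_const) auto
  then have "measure M A = 0" using neg[OF A] e
    by (simp add: mult_le_0_iff zero_less_measure_iff not_less measure_le_0_iff)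
  then have "AE x in M. x \<notin> A"
    by (intro AE_not_in) (auto simp: null_sets_def emeasure_eq_measure)
  then show ?thesis using AE_space
  proof eventually_elim
    case (elim x)
    then obtain B :: nat where "\<forall>n. run_max g n x \<le> real B" unfolding A_def by (auto simp: not_less)
    then show ?case by blast
  qed
qed

text \<open>Subtracting the conditional expectation and \<open>e\<close> from \<open>f\<close>
  leaves a function with integral \<open>- e * measure M A\<close> over every invariant
  \<open>A\<close>, so its running maxima are bounded almost everywhere. The conditional expectation
  is constant along orbits, hence contributes \<open>n\<close> times its value at
  \<open>x\<close>.\<close>

lemma birkhoff_upper:
  fixes f :: "'x \<Rightarrow> real"
  assumes f: "integrable M f" and e: "e > 0"
  shows "AE x in M. \<exists>B. \<forall>n. (\<Sum>i<n. f ((T ^^ i) x)) \<le> B + real n * (real_cond_exp M Inv f x + e)"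
proof -
  interpret Inv: finite_measure_subalgebra M Inv by (rule finite_measure_subalgebra_Inv)
  define h where "h = real_cond_exp M Inv f"
  have hi: "integrable M h" unfolding h_def by (rule Inv.real_cond_exp_int[OF f])
  have hm: "h \<in> borel_measurable Inv" unfolding h_def by simp
  note [measurable] = borel_measurable_integrable[OF f] borel_measurable_integrable[OF hi]
  define g where "g x = f x - h x - e" for x
  have gi: "integrable M g" unfolding g_def using f hi by auto
  have neg: "(\<integral>x. indicator A x * g x \<partial>M) = - e * measure M A" if A: "A \<in> invariant_sets M T" for A
  proof -
    have AI: "A \<in> sets Inv" by (simp add: A sets_invariant_algebra)
    have [measurable]: "A \<in> sets M" using A by (simp add: invariant_sets_def)
    have "(\<integral>x\<in>A. f x \<partial>M) = (\<integral>x\<in>A. h x \<partial>M)"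
      unfolding h_def by (rule Inv.real_cond_exp_intA[OF f AI])
    then have eq: "(\<integral>x. indicator A x * f x \<partial>M) = (\<integral>x. indicator A x * h x \<partial>M)"
      by (simp add: set_lebesgue_integral_def)
    have i: "integrable M (\<lambda>x. indicator A x * f x)" "integrable M (\<lambda>x. indicator A x * h x)"
      using integrable_mult_indicator[OF \<open>A \<in> sets M\<close> f] integrable_mult_indicator[OF \<open>A \<in> sets M\<close> hi]
      by simp_all
    have ie: "integrable M (\<lambda>x. indicator A x * e)"
      by (intro integrable_mult_left) (auto simp: integrable_indicator_iff emeasure_eq_measure)
    have "(\<integral>x. indicator A x * g x \<partial>M) =
        (\<integral>x. (indicator A x * f x - indicator A x * h x) - indicator A x * e \<partial>M)"
      by (simp add: g_def algebra_simps)
    also have "\<dots> = - (\<integral>x. indicator A x * e \<partial>M)"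
      using i ie eq by simp
    finally show ?thesis by simp
  qed
  have "AE x in M. \<forall>n. h ((T ^^ n) x) = h x"
    by (rule AE_invariant_measurable_funpow[OF hm])
  moreover have "AE x in M. \<exists>B. \<forall>n. run_max g n x \<le> B"
    using null_run_max_unbounded[OF gi e] neg by blast
  ultimately show ?thesis
  proof eventually_elim
    case (elim x)
    then obtain B where B: "\<And>n. run_max g n x \<le> B" by auto
    \<comment> \<open>\<open>run_max\<close> only sees sums of length at least 1; the maximum with 0
      serves the empty sum.\<close>
    have "(\<Sum>i<n. f ((T ^^ i) x)) \<le> max 0 B + real n * (h x + e)" for n
    proof (cases n)
      case (Suc k)
      have "(\<Sum>i\<le>k. g ((T ^^ i) x)) = (\<Sum>i\<le>k. f ((T ^^ i) x)) - real (Suc k) * (h x + e)"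
        using elim by (simp add: g_def sum_subtractf algebra_simps)
      then show ?thesis
        using sum_le_run_max[of g x k] B[of k] Suc by (simp add: lessThan_Suc_atMost)
    qed simp
    then show ?case unfolding h_def by blast
  qed
qed

text \<open>The values 1 / (j + 1) of \<open>e\<close> suffice, so one null set works for all
  \<open>e\<close>; the constant \<open>B\<close> disappears after division by
  \<open>n\<close>.\<close>

lemma birkhoff_limsup:
  fixes f :: "'x \<Rightarrow> real"
  assumes f: "integrable M f"
  shows "AE x in M. \<forall>e>0. \<forall>\<^sub>F n in sequentially.
           (\<Sum>i<n. f ((T ^^ i) x)) / real n < real_cond_exp M Inv f x + e"
proof -
  have "AE x in M. \<forall>j. \<exists>B. \<forall>n. (\<Sum>i<n. f ((T ^^ i) x)) \<le>
      B + real n * (real_cond_exp M Inv f x + 1 / real (Suc j))"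
    by (subst AE_all_countable) (use birkhoff_upper[OF f] in auto)
  then show ?thesis
  proof eventually_elim
    case (elim x)
    let ?h = "real_cond_exp M Inv f x"
    show ?case
    proof (intro allI impI)
      fix e :: real assume "e > 0"
      then obtain j where j: "1 / real (Suc j) < e / 2"
        using nat_approx_posE[of "e/2"] by (auto simp: inverse_eq_divide)
      from elim obtain B where
        B: "\<And>n. (\<Sum>i<n. f ((T ^^ i) x)) \<le> B + real n * (?h + 1 / real (Suc j))" by blast
      have "(\<lambda>n. B / real n) \<longlonglongrightarrow> 0" by real_asymp
      then have "\<forall>\<^sub>F n in sequentially. B / real n < e / 2"
        using \<open>e > 0\<close> by (intro order_tendstoD(2)[of _ 0]) auto
      then show "\<forall>\<^sub>F n in sequentially. (\<Sum>i<n. f ((T ^^ i) x)) / real n < ?h + e"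
        using eventually_gt_at_top[of 0]
      proof eventually_elim
        case (elim n)
        have "(\<Sum>i<n. f ((T ^^ i) x)) / real n \<le> (B + real n * (?h + 1 / real (Suc j))) / real n"
          using B[of n] by (intro divide_right_mono) auto
        also have "\<dots> = B / real n + ?h + 1 / real (Suc j)" using elim by (simp add: field_simps)
        finally show ?case using elim j by linarith
      qed
    qed
  qed
qed

text \<open>The one-sided estimate for \<open>f\<close> and for \<open>- f\<close> bounds the
  averages from above and from below.\<close>

lemma birkhoff:
  fixes f :: "'x \<Rightarrow> real"
  assumes f: "integrable M f"
  shows "AE x in M. (\<lambda>n. (\<Sum>i=1..n. f ((T ^^ i) x)) / real n) \<longlonglongrightarrow> real_cond_exp M Inv f x"
proof -
  interpret Inv: finite_measure_subalgebra M Inv by (rule finite_measure_subalgebra_Inv)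
  let ?h = "real_cond_exp M Inv f"
  have *: "AE x in M. (\<lambda>n. (\<Sum>i<n. f ((T ^^ i) x)) / real n) \<longlonglongrightarrow> ?h x"
    using birkhoff_limsup[OF f] birkhoff_limsup[OF integrable_mult_right[OF f, of "-1"]]
      Inv.real_cond_exp_cmult[OF f, of "-1"]
  proof eventually_elim
    case (elim x)
    show ?case
    proof (rule order_tendstoI)
      fix c assume c: "c < ?h x"
      have "?h x - c > 0" using c by simp
      then have "\<forall>\<^sub>F n in sequentially. (\<Sum>i<n. (-1) * f ((T ^^ i) x)) / real n
          < real_cond_exp M Inv (\<lambda>x. (-1) * f x) x + (?h x - c)"
        using elim(2) by blast
      then show "\<forall>\<^sub>F n in sequentially. c < (\<Sum>i<n. f ((T ^^ i) x)) / real n"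
        by (rule eventually_mono) (use elim(3) in \<open>simp add: sum_negf\<close>)
    next
      fix c assume c: "c > ?h x"
      then have "c - ?h x > 0" by simp
      then have "\<forall>\<^sub>F n in sequentially. (\<Sum>i<n. f ((T ^^ i) x)) / real n < ?h x + (c - ?h x)"
        using elim(1) by blast
      then show "\<forall>\<^sub>F n in sequentially. (\<Sum>i<n. f ((T ^^ i) x)) / real n < c" by simp
    qed
  qed
  \<comment> \<open>The averages in the statement start at time 1: they are those of the point
    \<open>T x\<close>, where the conditional expectation has the same value as at
    \<open>x\<close>.\<close>
  from AE_funpow[OF this, of 1] AE_invariant_measurable[OF borel_measurable_cond_exp, of M f]
  show ?thesis
  proof eventually_elim
    case (elim x)
    have "(\<Sum>i<n. f ((T ^^ i) (T x))) = (\<Sum>i=1..n. f ((T ^^ i) x))" for n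
      by (rule sum.reindex_bij_witness[of _ "\<lambda>i. i - 1" Suc])
        (auto simp: funpow_Suc_right simp del: funpow.simps(2))
    with elim show ?case by simp
  qed
qed

end

section \<open>Weighted averages and autocorrelations\<close>

text \<open>Tonelli for series. It is applied to the orbit parameter \<open>y\<close> and again to
  the point \<open>x\<close> of a system, where it yields convergence to 0 along the times
  k^P.\<close>

lemma AE_summable:
  fixes F :: "nat \<Rightarrow> 'a \<Rightarrow> real"
  assumes [measurable]: "\<And>k. F k \<in> borel_measurable M" and nonneg: "\<And>k x. F k x \<ge> 0"
    and le: "\<And>k. (\<integral>\<^sup>+x. ennreal (F k x) \<partial>M) \<le> ennreal (a k)"
    and a: "summable a" "\<And>k. a k \<ge> 0"
  shows "AE x in M. summable (\<lambda>k. F k x)"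
proof -
  have "(\<integral>\<^sup>+x. (\<Sum>k. ennreal (F k x)) \<partial>M) = (\<Sum>k. \<integral>\<^sup>+x. ennreal (F k x) \<partial>M)"
    by (rule nn_integral_suminf) auto
  also have "\<dots> \<le> (\<Sum>k. ennreal (a k))" by (intro suminf_le le) auto
  also have "\<dots> < \<infinity>" using a by (simp add: suminf_ennreal2)
  finally have "AE x in M. (\<Sum>k. ennreal (F k x)) \<noteq> \<infinity>"
    by (intro nn_integral_PInf_AE) auto
  then show ?thesis
    by eventually_elim (auto intro!: summable_suminf_not_top nonneg)
qed

text \<open>Summation by parts: the increments \<open>p n - p (Suc n)\<close> are nonnegative, so
  the bound on the partial sums can be inserted termwise. The induction handles everything except
  the boundary term with factor \<open>p N\<close>.\<close>

lemma weighted_cesaro_bound: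
  fixes p v :: "nat \<Rightarrow> real"
  assumes anti: "\<And>n. n \<ge> 1 \<Longrightarrow> p (Suc n) \<le> p n" and pos: "\<And>n. p n \<ge> 0"
    and S: "\<And>n. \<bar>\<Sum>i=1..n. v i\<bar> \<le> B + e * real n"
  shows "\<bar>\<Sum>i=1..N. p i * v i\<bar> \<le> B * p 1 + e * (\<Sum>i=1..N. p i)"
proof (cases "N \<ge> 1")
  case True
  let ?S = "\<lambda>n. \<Sum>i=1..n. v i"
  have "\<bar>(\<Sum>i=1..N. p i * v i) - p N * ?S N\<bar> \<le> B * (p 1 - p N) + e * ((\<Sum>i=1..N. p i) - real N * p N)"
    using True
  proof (induction N rule: dec_induct)
    case (step n)
    have "(\<Sum>i=1..Suc n. p i * v i) - p (Suc n) * ?S (Suc n) =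
        ((\<Sum>i=1..n. p i * v i) - p n * ?S n) + (p n - p (Suc n)) * ?S n"
      by (simp add: algebra_simps)
    also have "\<bar>\<dots>\<bar> \<le> (B * (p 1 - p n) + e * ((\<Sum>i=1..n. p i) - real n * p n)) +
        (p n - p (Suc n)) * (B + e * real n)"
      using step anti[of n] S[of n]
      by (intro order_trans[OF abs_triangle_ineq] add_mono) (auto simp: abs_mult intro!: mult_left_mono)
    also have "\<dots> = B * (p 1 - p (Suc n)) + e * ((\<Sum>i=1..Suc n. p i) - real (Suc n) * p (Suc n))"
      by (simp add: algebra_simps)
    finally show ?case .
  qed simp
  moreover have "\<bar>p N * ?S N\<bar> \<le> p N * (B + e * real N)"
    using S[of N] pos[of N] by (simp add: abs_mult mult_left_mono)
  ultimately show ?thesis by (simp add: algebra_simps)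
next
  case False
  then show ?thesis using S[of 0] pos[of 1] by simp
qed

text \<open>For nonincreasing weights the partial sums of \<open>u - l\<close> enter through
  summation by parts with nonnegative coefficients; the early ones contribute a constant, which the
  divergence of the total weight makes negligible.\<close>

lemma weighted_cesaro:
  fixes p u :: "nat \<Rightarrow> real"
  assumes anti: "\<And>n. n \<ge> 1 \<Longrightarrow> p (Suc n) \<le> p n" and pos: "\<And>n. p n \<ge> 0"
    and W: "filterlim (\<lambda>N. \<Sum>i=1..N. p i) at_top sequentially"
    and lim: "(\<lambda>N. (\<Sum>i=1..N. u i) / real N) \<longlonglongrightarrow> l"
  shows "(\<lambda>N. (\<Sum>i=1..N. p i * u i) / (\<Sum>i=1..N. p i)) \<longlonglongrightarrow> l"
proof -
  let ?W = "\<lambda>N. \<Sum>i=1..N. p i"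
  define v where "v i = u i - l" for i
  have lim0: "(\<lambda>N. (\<Sum>i=1..N. p i * v i) / ?W N) \<longlonglongrightarrow> 0"
  proof (rule LIMSEQ_I)
    fix r :: real assume r: "r > 0"
    define e where "e = r / 2"
    have e: "e > 0" using r by (simp add: e_def)
    from LIMSEQ_D[OF lim e] obtain n0 where
      n0: "\<And>n. n \<ge> n0 \<Longrightarrow> \<bar>(\<Sum>i=1..n. u i) / real n - l\<bar> < e" by auto
    \<comment> \<open>\<open>B\<close> absorbs the finitely many partial sums for which the averages
      of \<open>u\<close> are not yet within \<open>e\<close> of \<open>l\<close>.\<close>
    define B where "B = (\<Sum>n\<le>n0. \<bar>\<Sum>i=1..n. v i\<bar>)"
    have B: "B \<ge> 0" unfolding B_def by (intro sum_nonneg) auto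
    have S: "\<bar>\<Sum>i=1..n. v i\<bar> \<le> B + e * real n" for n
    proof (cases "n \<le> n0")
      case True
      then have "\<bar>\<Sum>i=1..n. v i\<bar> \<le> B" unfolding B_def by (intro member_le_sum) auto
      moreover have "e * real n \<ge> 0" using e by simp
      ultimately show ?thesis by linarith
    next
      case False
      then have "n > 0" by simp
      then have "(\<Sum>i=1..n. v i) = real n * ((\<Sum>i=1..n. u i) / real n - l)"
        by (simp add: v_def sum_subtractf algebra_simps)
      then have "\<bar>\<Sum>i=1..n. v i\<bar> = real n * \<bar>(\<Sum>i=1..n. u i) / real n - l\<bar>"
        by (simp add: abs_mult)
      also have "\<dots> \<le> real n * e" using n0[of n] False by (intro mult_left_mono) auto
      finally show ?thesis using B by (simp add: mult.commute)
    qed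
    have "\<forall>\<^sub>F N in sequentially. ?W N > 2 * (B * p 1 + 1) / r"
      using W by (simp add: filterlim_at_top_dense)
    then have "\<forall>\<^sub>F N in sequentially. norm ((\<Sum>i=1..N. p i * v i) / ?W N - 0) < r"
    proof eventually_elim
      case (elim N)
      have "2 * (B * p 1 + 1) / r > 0" using B pos[of 1] r by (simp add: add_nonneg_pos)
      then have W0: "?W N > 0" using elim by linarith
      have "2 * (B * p 1 + 1) < r * ?W N" using elim r by (simp add: field_simps)
      then have "B * p 1 + e * ?W N < r * ?W N" unfolding e_def by simp
      with weighted_cesaro_bound[of p v B e N, OF anti pos S]
      have "\<bar>\<Sum>i=1..N. p i * v i\<bar> < r * ?W N" by linarith
      then show ?case using W0 by (simp add: abs_divide divide_less_eq)
    qed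
    then show "\<exists>no. \<forall>N\<ge>no. norm ((\<Sum>i=1..N. p i * v i) / ?W N - 0) < r"
      by (simp add: eventually_sequentially)
  qed
  have "\<forall>\<^sub>F N in sequentially. (\<Sum>i=1..N. p i * v i) / ?W N + l = (\<Sum>i=1..N. p i * u i) / ?W N"
  proof -
    have "\<forall>\<^sub>F N in sequentially. ?W N > 0" using W by (simp add: filterlim_at_top_dense)
    then show ?thesis
      by eventually_elim
        (simp add: v_def right_diff_distrib sum_subtractf field_simps sum_distrib_left)
  qed
  with tendsto_add[OF lim0 tendsto_const[of l]] show ?thesis
    by (simp add: tendsto_cong)
qed

text \<open>Averages of a nonincreasing sequence do not increase; the cross-multiplied form bounds
  the ratio of two partial sums by the ratio of their lengths.\<close>

lemma partial_sum_growth: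
  fixes p :: "nat \<Rightarrow> real"
  assumes anti: "\<And>n. n \<ge> 1 \<Longrightarrow> p (Suc n) \<le> p n" and N: "1 \<le> N" "N \<le> M"
  shows "real N * (\<Sum>i=1..M. p i) \<le> real M * (\<Sum>i=1..N. p i)"
proof -
  have le: "p j \<le> p i" if "1 \<le> i" "i \<le> j" for i j
    using that(2)
  proof (induction j rule: dec_induct)
    case (step n)
    then show ?case using anti[of n] that(1) by simp
  qed simp
  have "real N * p N \<le> (\<Sum>i=1..N. p i)"
    using sum_mono[of "{1..N}" "\<lambda>_. p N" p] le by auto
  from \<open>N \<le> M\<close> show ?thesis
  proof (induction M rule: dec_induct)
    case (step m)
    have "real N * p (Suc m) \<le> real N * p N" using le[of N "Suc m"] step N by (intro mult_left_mono) auto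
    then show ?case using step \<open>real N * p N \<le> _\<close> by (simp add: algebra_simps)
  qed simp
qed

text \<open>Numerator and denominator are both monotone in \<open>N\<close>, so replacing
  \<open>N\<close> by a neighbouring k^P costs at most the factor \<open>q k\<close>. This factor is
  squeezed between 1 and ((k + 1) / k)^P and tends to 1; a geometric subsequence would lose a
  constant factor here.\<close>

lemma nonneg_interpolation:
  fixes p v :: "nat \<Rightarrow> real" and P :: nat
  assumes anti: "\<And>n. n \<ge> 1 \<Longrightarrow> p (Suc n) \<le> p n" and pos: "\<And>n. n \<ge> 1 \<Longrightarrow> p n > 0"
    and v: "\<And>n. v n \<ge> 0" and P: "P > 0"
    and lim: "(\<lambda>k. (\<Sum>i=1..k ^ P. v i) / (\<Sum>i=1..k ^ P. p i)) \<longlonglongrightarrow> l"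
  shows "(\<lambda>N. (\<Sum>i=1..N. v i) / (\<Sum>i=1..N. p i)) \<longlonglongrightarrow> l"
proof -
  define V where "V N = (\<Sum>i=1..N. v i)" for N
  define W where "W N = (\<Sum>i=1..N. p i)" for N
  have W0: "W N > 0" if "N \<ge> 1" for N unfolding W_def using that pos by (intro sum_pos) auto
  have V_mono: "V N \<le> V M" if "N \<le> M" for N M
    unfolding V_def using that v by (intro sum_mono2) auto
  have W_mono: "W N \<le> W M" if "N \<le> M" for N M
    unfolding W_def using that less_imp_le[OF pos] by (intro sum_mono2) auto
  have V0: "V N \<ge> 0" for N unfolding V_def using v by (intro sum_nonneg) auto
  define q where "q k = W (Suc k ^ P) / W (k ^ P)" for k
  have q1: "q \<longlonglongrightarrow> 1"
  proof (rule tendsto_sandwich[of "\<lambda>_. 1" q _ "\<lambda>k. (real (Suc k) / real k) ^ P"])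
    show "\<forall>\<^sub>F k in sequentially. 1 \<le> q k"
      using eventually_ge_at_top[of 1]
    proof eventually_elim
      case (elim k)
      then have "W (k ^ P) > 0" by (intro W0) auto
      moreover have "W (k ^ P) \<le> W (Suc k ^ P)" by (intro W_mono power_mono) auto
      ultimately show ?case unfolding q_def by simp
    qed
    show "\<forall>\<^sub>F k in sequentially. q k \<le> (real (Suc k) / real k) ^ P"
      using eventually_ge_at_top[of 1]
    proof eventually_elim
      case (elim k)
      have "W (k ^ P) > 0" using elim by (intro W0) auto
      moreover have "real (k ^ P) * W (Suc k ^ P) \<le> real (Suc k ^ P) * W (k ^ P)"
        unfolding W_def using elim by (intro partial_sum_growth[where p = p] anti power_mono) auto
      moreover have "real (k ^ P) > 0" using elim by simp
      ultimately have "q k \<le> real (Suc k ^ P) / real (k ^ P)"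
        unfolding q_def by (simp add: divide_le_eq le_divide_eq field_simps del: of_nat_power)
      then show ?case by (simp add: power_divide)
    qed
    have "(\<lambda>k. real (Suc k) / real k) \<longlonglongrightarrow> 1" by real_asymp
    from tendsto_power[OF this, of P] show "(\<lambda>k. (real (Suc k) / real k) ^ P) \<longlonglongrightarrow> 1" by simp
  qed simp
  have lim: "(\<lambda>k. V (k ^ P) / W (k ^ P)) \<longlonglongrightarrow> l" using lim by (simp add: V_def W_def)
  have upper: "(\<lambda>k. V (Suc k ^ P) / W (Suc k ^ P) * q k) \<longlonglongrightarrow> l"
    using tendsto_mult[OF LIMSEQ_Suc[OF lim] q1] by simp
  have lower: "(\<lambda>k. V (k ^ P) / W (k ^ P) / q k) \<longlonglongrightarrow> l"
    using tendsto_divide[OF lim q1] by simp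
  have squeeze: "\<exists>k\<ge>k0. V (k ^ P) / W (k ^ P) / q k \<le> V N / W N \<and>
      V N / W N \<le> V (Suc k ^ P) / W (Suc k ^ P) * q k" if N: "N \<ge> k0 ^ P" "k0 \<ge> 1" for N k0
  proof -
    define K where "K = {k. k ^ P \<le> N}"
    have "k \<le> N" if "k ^ P \<le> N" for k
    proof (cases "k = 0")
      case False
      then have "k \<le> k ^ P" using P by (intro self_le_power) auto
      then show ?thesis using that by linarith
    qed simp
    then have "K \<subseteq> {..N}" unfolding K_def by blast
    then have K: "finite K" by (rule finite_subset) simp
    have "k0 \<in> K" using N by (simp add: K_def)
    define k where "k = Max K"
    have "k \<in> K" unfolding k_def using K \<open>k0 \<in> K\<close> by (intro Max_in) auto
    have "k \<ge> k0" unfolding k_def using K \<open>k0 \<in> K\<close> by (intro Max_ge) auto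
    have "Suc k \<notin> K" using Max_ge[OF K, of "Suc k"] by (auto simp: k_def)
    then have kN: "k ^ P \<le> N" "N \<le> Suc k ^ P" using \<open>k \<in> K\<close> by (auto simp: K_def)
    have "k \<ge> 1" using \<open>k \<ge> k0\<close> N by simp
    then have "k ^ P \<ge> 1" by simp
    note pos = W0[OF this] W0[OF order_trans[OF this kN(1)]]
      W0[OF order_trans[OF order_trans[OF this kN(1)] kN(2)]]
    have "V (k ^ P) / W (k ^ P) / q k = V (k ^ P) / W (Suc k ^ P)"
      using pos by (simp add: q_def)
    also have "\<dots> \<le> V N / W N"
      using V_mono[OF kN(1)] W_mono[OF kN(2)] pos V0 by (intro frac_le) auto
    finally have 1: "V (k ^ P) / W (k ^ P) / q k \<le> V N / W N" .
    have "V N / W N \<le> V (Suc k ^ P) / W (k ^ P)"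
      using V_mono[OF kN(2)] W_mono[OF kN(1)] pos V0 by (intro frac_le) auto
    also have "\<dots> = V (Suc k ^ P) / W (Suc k ^ P) * q k"
      using pos by (simp add: q_def)
    finally show ?thesis using 1 \<open>k \<ge> k0\<close> by blast
  qed
  have "(\<lambda>N. V N / W N) \<longlonglongrightarrow> l"
  proof (rule LIMSEQ_I)
    fix r :: real assume r: "r > 0"
    obtain k1 where k1: "\<And>k. k \<ge> k1 \<Longrightarrow> \<bar>V (Suc k ^ P) / W (Suc k ^ P) * q k - l\<bar> < r"
      using LIMSEQ_D[OF upper r] by auto
    obtain k2 where k2: "\<And>k. k \<ge> k2 \<Longrightarrow> \<bar>V (k ^ P) / W (k ^ P) / q k - l\<bar> < r"
      using LIMSEQ_D[OF lower r] by auto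
    define k0 where "k0 = Suc (max k1 k2)"
    have "norm (V N / W N - l) < r" if N: "N \<ge> k0 ^ P" for N
    proof -
      from squeeze[OF N] obtain k where k: "k \<ge> k0" "V (k ^ P) / W (k ^ P) / q k \<le> V N / W N"
        "V N / W N \<le> V (Suc k ^ P) / W (Suc k ^ P) * q k" by (auto simp: k0_def)
      then show ?thesis using k1[of k] k2[of k] unfolding k0_def real_norm_def by linarith
    qed
    then show "\<exists>no. \<forall>N\<ge>no. norm (V N / W N - l) < r" by blast
  qed
  then show ?thesis by (simp add: V_def W_def)
qed

text \<open>The square is cut along its diagonals. Passing to \<open>Suc N\<close> adds a row and a
  column, whose entries are exactly the new last terms of the diagonals.\<close>

lemma double_sum_by_difference:
  fixes g :: "nat \<Rightarrow> nat \<Rightarrow> real"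
  assumes sym: "\<And>n m. g n m = g m n"
  shows "(\<Sum>n=1..N. \<Sum>m=1..N. g n m) =
    (\<Sum>n=1..N. g n n) + 2 * (\<Sum>h=1..N. \<Sum>n=1..N - h. g n (n + h))"
proof (induction N)
  case (Suc N)
  have "(\<Sum>n=1..Suc N. \<Sum>m=1..Suc N. g n m) =
      (\<Sum>n=1..N. \<Sum>m=1..N. g n m) + (\<Sum>n=1..N. g n (Suc N)) + (\<Sum>m=1..N. g (Suc N) m) + g (Suc N) (Suc N)"
    by (simp add: sum.distrib)
  also have "(\<Sum>m=1..N. g (Suc N) m) = (\<Sum>n=1..N. g n (Suc N))"
    by (simp add: sym)
  finally have 1: "(\<Sum>n=1..Suc N. \<Sum>m=1..Suc N. g n m) =
      (\<Sum>n=1..N. \<Sum>m=1..N. g n m) + 2 * (\<Sum>n=1..N. g n (Suc N)) + g (Suc N) (Suc N)" by simp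
  have "(\<Sum>n=1..Suc N - h. g n (n + h)) = (\<Sum>n=1..N - h. g n (n + h)) + g (Suc N - h) (Suc N)"
    if "h \<in> {1..N}" for h using that by (simp add: Suc_diff_le)
  then have "(\<Sum>h=1..Suc N. \<Sum>n=1..Suc N - h. g n (n + h)) =
      (\<Sum>h=1..N. (\<Sum>n=1..N - h. g n (n + h)) + g (Suc N - h) (Suc N))"
    by simp
  also have "\<dots> = (\<Sum>h=1..N. \<Sum>n=1..N - h. g n (n + h)) + (\<Sum>h=1..N. g (Suc N - h) (Suc N))"
    by (rule sum.distrib)
  also have "(\<Sum>h=1..N. g (Suc N - h) (Suc N)) = (\<Sum>n=1..N. g n (Suc N))"
    by (subst (2) sum.atLeastAtMost_rev) simp
  finally show ?case using 1 Suc by simp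
qed simp

text \<open>Only pairs with both times in \<open>{1..N}\<close> occur; for \<open>h \<ge> N\<close>
  truncated subtraction makes the sum empty.\<close>

definition autocorrelation :: "(nat \<Rightarrow> real) \<Rightarrow> nat \<Rightarrow> nat \<Rightarrow> real" where
  "autocorrelation Y N h = (\<Sum>n=1..N - h. Y n * Y (n + h))"

text \<open>The quantity R_N of the overview. The factor 2 counts each positive lag together with
  its negative.\<close>

definition autocorrelation_norm :: "(nat \<Rightarrow> real) \<Rightarrow> nat \<Rightarrow> real" where
  "autocorrelation_norm Y N = (\<Sum>n=1..N. (Y n)\<^sup>2) + 2 * (\<Sum>h=1..N. \<bar>autocorrelation Y N h\<bar>)"

text \<open>The matrix \<open>g\<close> is symmetric and constant along diagonals, so
  \<open>r h\<close> can be taken out of the sum over the diagonal at lag \<open>h\<close>. What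
  remains there is an autocorrelation, and only then are absolute values taken.\<close>

lemma quadratic_form_le:
  assumes r: "\<And>h. \<bar>r h\<bar> \<le> R" and sym: "\<And>n m. g n m = g m n" and g: "\<And>n h. g n (n + h) = r h"
  shows "(\<Sum>n=1..N. \<Sum>m=1..N. Y n * Y m * g n m) \<le> R * autocorrelation_norm Y N"
proof -
  have "(\<Sum>n=1..N. \<Sum>m=1..N. Y n * Y m * g n m) =
      (\<Sum>n=1..N. Y n * Y n * r 0) + 2 * (\<Sum>h=1..N. \<Sum>n=1..N - h. Y n * Y (n + h) * r h)"
    using double_sum_by_difference[of "\<lambda>n m. Y n * Y m * g n m" N] g[of _ 0] g sym
    by (simp add: mult.commute mult.left_commute)
  also have "\<dots> = r 0 * (\<Sum>n=1..N. (Y n)\<^sup>2) + 2 * (\<Sum>h=1..N. autocorrelation Y N h * r h)"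
    by (simp add: autocorrelation_def sum_distrib_left sum_distrib_right power2_eq_square mult_ac)
  also have "\<dots> \<le> R * (\<Sum>n=1..N. (Y n)\<^sup>2) + 2 * (\<Sum>h=1..N. \<bar>autocorrelation Y N h\<bar> * R)"
  proof (intro add_mono mult_left_mono mult_right_mono sum_mono)
    show "r 0 \<le> R" using r[of 0] by auto
    show "autocorrelation Y N h * r h \<le> \<bar>autocorrelation Y N h\<bar> * R" for h
      using abs_ge_self[of "autocorrelation Y N h * r h"]
        mult_left_mono[OF r[of h] abs_ge_zero[of "autocorrelation Y N h"]] by (simp add: abs_mult)
  qed (auto intro: sum_nonneg)
  also have "\<dots> = R * autocorrelation_norm Y N"
    by (simp add: autocorrelation_norm_def distrib_left mult_ac flip: sum_distrib_left)
  finally show ?thesis .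
qed

text \<open>The matrix with all entries 1, that is, the correlations of a constant function.\<close>

lemma square_sum_le_autocorrelation_norm: "(\<Sum>n=1..N. Y n)\<^sup>2 \<le> autocorrelation_norm Y N"
  using quadratic_form_le[of "\<lambda>_. 1" 1 "\<lambda>_ _. 1" Y N]
  by (simp add: power2_eq_square sum_product)

context mps
begin

text \<open>The integrals of \<open>u ((T ^^ n) x) * u ((T ^^ m) x)\<close> depend only on the lag,
  because the common iterate is removed by invariance of the measure; this works without an inverse
  of \<open>T\<close>. They are bounded by the squared norm of \<open>u\<close> because both factors
  have that norm.\<close>

lemma integral_square_sum_le:
  fixes u :: "'x \<Rightarrow> real" and Y :: "nat \<Rightarrow> real"
  assumes [measurable]: "u \<in> borel_measurable M" and u2: "integrable M (\<lambda>x. (u x)\<^sup>2)"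
  shows "(\<integral>\<^sup>+x. ennreal ((\<Sum>n=1..N. Y n * u ((T ^^ n) x))\<^sup>2) \<partial>M) \<le>
    ennreal ((\<integral>x. (u x)\<^sup>2 \<partial>M) * autocorrelation_norm Y N)"
proof -
  define R where "R = (\<integral>x. (u x)\<^sup>2 \<partial>M)"
  define g where "g n m = (\<integral>x. u ((T ^^ n) x) * u ((T ^^ m) x) \<partial>M)" for n m
  have bound: "\<bar>a * b\<bar> \<le> (a\<^sup>2 + b\<^sup>2) / 2" for a b :: real
    using sum_squares_bound[of "\<bar>a\<bar>" "\<bar>b\<bar>"] by (simp add: abs_mult)
  have u2n: "integrable M (\<lambda>x. (u ((T ^^ n) x))\<^sup>2)" for n
    using integrable_funpow[OF u2] .
  have u2_int: "(\<integral>x. (u ((T ^^ n) x))\<^sup>2 \<partial>M) = R" for n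
    unfolding R_def by (rule integral_funpow) measurable
  have int: "integrable M (\<lambda>x. u ((T ^^ n) x) * u ((T ^^ m) x))" for n m
    by (rule Bochner_Integration.integrable_bound[where
          f = "\<lambda>x. ((u ((T ^^ n) x))\<^sup>2 + (u ((T ^^ m) x))\<^sup>2) / 2"])
      (use bound u2n in auto)
  have g: "\<bar>g n m\<bar> \<le> R" for n m
  proof -
    have "\<bar>g n m\<bar> \<le> (\<integral>x. \<bar>u ((T ^^ n) x) * u ((T ^^ m) x)\<bar> \<partial>M)"
      unfolding g_def by (rule integral_abs_bound)
    also have "\<dots> \<le> (\<integral>x. ((u ((T ^^ n) x))\<^sup>2 + (u ((T ^^ m) x))\<^sup>2) / 2 \<partial>M)"
      using int u2n bound by (intro integral_mono) auto
    also have "\<dots> = R" using u2n by (simp add: u2_int)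
    finally show ?thesis .
  qed
  have shift: "g n (n + h) = g 0 h" for n h
  proof -
    have "g n (n + h) = (\<integral>x. (\<lambda>y. u y * u ((T ^^ h) y)) ((T ^^ n) x) \<partial>M)"
      unfolding g_def by (simp add: funpow_add add.commute[of n])
    also have "\<dots> = g 0 h" unfolding g_def by (subst integral_funpow) auto
    finally show ?thesis .
  qed
  have eq: "(\<Sum>n=1..N. Y n * u ((T ^^ n) x))\<^sup>2 =
      (\<Sum>n=1..N. \<Sum>m=1..N. Y n * Y m * (u ((T ^^ n) x) * u ((T ^^ m) x)))" for x
    by (simp add: power2_eq_square sum_product mult_ac)
  have "(\<integral>x. (\<Sum>n=1..N. Y n * u ((T ^^ n) x))\<^sup>2 \<partial>M) = (\<Sum>n=1..N. \<Sum>m=1..N. Y n * Y m * g n m)"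
    unfolding eq g_def using int by simp
  also have "\<dots> \<le> R * autocorrelation_norm Y N"
  proof (rule quadratic_form_le)
    show "g n m = g m n" for n m by (simp add: g_def mult.commute)
  qed (rule g shift)+
  finally have le: "(\<integral>x. (\<Sum>n=1..N. Y n * u ((T ^^ n) x))\<^sup>2 \<partial>M) \<le> R * autocorrelation_norm Y N" .
  have "integrable M (\<lambda>x. (\<Sum>n=1..N. Y n * u ((T ^^ n) x))\<^sup>2)"
    unfolding eq using int by auto
  then have "(\<integral>\<^sup>+x. ennreal ((\<Sum>n=1..N. Y n * u ((T ^^ n) x))\<^sup>2) \<partial>M) =
      ennreal (\<integral>x. (\<Sum>n=1..N. Y n * u ((T ^^ n) x))\<^sup>2 \<partial>M)"
    by (intro nn_integral_eq_integral) auto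
  with le show ?thesis unfolding R_def by (simp add: ennreal_leI)
qed

end

lemma autocorrelation_norm_nonneg: "autocorrelation_norm Y N \<ge> 0"
  by (simp add: autocorrelation_norm_def sum_nonneg)

text \<open>All that is required of a single \<open>y\<close>, with \<open>X\<close> the indicator
  of its hits. No system appears among the conditions, and this is why the null set of
  \<open>y\<close> is the same for all systems.\<close>

locale good_weights =
  fixes X p :: "nat \<Rightarrow> real" and P :: nat
  assumes X_nonneg: "X n \<ge> 0"
    and p_antimono: "n \<ge> 1 \<Longrightarrow> p (Suc n) \<le> p n"
    and p_pos: "p n > 0"
    and p_diverges: "filterlim (\<lambda>N. \<Sum>n=1..N. p n) at_top sequentially"
    and P_pos: "P > 0"
    and summable_autocorrelation:
      "summable (\<lambda>k. autocorrelation_norm (\<lambda>n. X n - p n) (k ^ P) / (\<Sum>n=1..k ^ P. p n)\<^sup>2)"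
begin

abbreviation W :: "nat \<Rightarrow> real" where "W N \<equiv> (\<Sum>n=1..N. p n)"

lemma W_nonneg: "W N \<ge> 0"
  using less_imp_le[OF p_pos] by (intro sum_nonneg) auto

lemma eventually_W_pos: "\<forall>\<^sub>F N in sequentially. W N > 0"
  using p_diverges by (simp add: filterlim_at_top_dense)

lemma filterlim_power_P: "filterlim (\<lambda>k::nat. k ^ P) at_top at_top"
proof (rule filterlim_at_top_mono[OF filterlim_ident])
  show "\<forall>\<^sub>F k::nat in at_top. k \<le> k ^ P"
    using eventually_ge_at_top[of 1] by eventually_elim (use P_pos in \<open>auto intro: self_le_power\<close>)
qed

text \<open>Writing \<open>X n = p n + (X n - p n)\<close> leaves a weighted Cesaro average and a
  deviation. The deviation is controlled only along k^P, and passing to all times is where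
  \<open>v\<close> has to be nonnegative.\<close>

lemma weighted_limit:
  assumes v: "\<And>n. v n \<ge> 0"
    and lim: "(\<lambda>N. (\<Sum>n=1..N. v n) / real N) \<longlonglongrightarrow> l"
    and dev: "(\<lambda>k. (\<Sum>n=1..k ^ P. (X n - p n) * v n) / W (k ^ P)) \<longlonglongrightarrow> 0"
  shows "(\<lambda>N. (\<Sum>n=1..N. X n * v n) / W N) \<longlonglongrightarrow> l"
proof (rule nonneg_interpolation[where p = p and P = P])
  have "(\<lambda>N. (\<Sum>n=1..N. p n * v n) / W N) \<longlonglongrightarrow> l"
    by (rule weighted_cesaro[OF p_antimono less_imp_le[OF p_pos] p_diverges lim])
  from tendsto_add[OF dev filterlim_compose[OF this filterlim_power_P]]
  show "(\<lambda>k. (\<Sum>n=1..k ^ P. X n * v n) / W (k ^ P)) \<longlonglongrightarrow> l"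
    by (simp add: left_diff_distrib sum_subtractf diff_divide_distrib)
qed (use X_nonneg v p_antimono p_pos P_pos in auto)

text \<open>The case of the constant function 1, which needs no system. It allows normalization by
  the number of hits instead of by \<open>W N\<close>.\<close>

lemma count_limit: "(\<lambda>N. (\<Sum>n=1..N. X n) / W N) \<longlonglongrightarrow> 1"
proof -
  let ?Y = "\<lambda>n. X n - p n"
  have "(\<lambda>N. (\<Sum>n=1..N. X n * 1) / W N) \<longlonglongrightarrow> 1"
  proof (rule weighted_limit)
    show "(\<lambda>N. (\<Sum>n=1..N. 1 :: real) / real N) \<longlonglongrightarrow> 1"
      by (rule tendsto_eventually) (auto intro: eventually_sequentiallyI[of 1])
    have "(\<lambda>k. ((\<Sum>n=1..k ^ P. ?Y n * 1) / W (k ^ P))\<^sup>2) \<longlonglongrightarrow> 0"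
    proof (rule Lim_null_comparison)
      show "\<forall>\<^sub>F k in sequentially. norm (((\<Sum>n=1..k ^ P. ?Y n * 1) / W (k ^ P))\<^sup>2) \<le>
          autocorrelation_norm ?Y (k ^ P) / (W (k ^ P))\<^sup>2"
      proof (intro always_eventually allI)
        show "norm (((\<Sum>n=1..k ^ P. ?Y n * 1) / W (k ^ P))\<^sup>2) \<le>
            autocorrelation_norm ?Y (k ^ P) / (W (k ^ P))\<^sup>2" for k
          using divide_right_mono[OF square_sum_le_autocorrelation_norm[of ?Y "k ^ P"], of "(W (k ^ P))\<^sup>2"]
          by (simp add: power_divide)
      qed
    qed (rule summable_LIMSEQ_zero[OF summable_autocorrelation])
    then show "(\<lambda>k. (\<Sum>n=1..k ^ P. ?Y n * 1) / W (k ^ P)) \<longlonglongrightarrow> 0"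
      by (rule power_tendsto_0_iff[THEN iffD1, rotated]) simp
  qed simp
  then show ?thesis by simp
qed

end

text \<open>The squared deviation \<open>F k\<close> has mean at most a constant times a term of the
  series assumed summable in \<open>good_weights\<close>, so it tends to 0 almost everywhere.
  Birkhoff's theorem supplies the limit for the deterministic weights.\<close>

lemma (in mps) AE_weighted_limit:
  fixes u :: "'x \<Rightarrow> real"
  assumes "good_weights X p P"
    and [measurable]: "u \<in> borel_measurable M" and u2: "integrable M (\<lambda>x. (u x)\<^sup>2)"
    and nonneg: "\<And>x. u x \<ge> 0"
  shows "AE x in M. (\<lambda>N. (\<Sum>n=1..N. X n * u ((T ^^ n) x)) / (\<Sum>n=1..N. X n)) \<longlonglongrightarrow> real_cond_exp M Inv u x"
proof -
  interpret good_weights X p P by fact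
  let ?Y = "\<lambda>n. X n - p n"
  define F where "F k x = ((\<Sum>n=1..k ^ P. ?Y n * u ((T ^^ n) x)) / W (k ^ P))\<^sup>2" for k x
  define R where "R = (\<integral>x. (u x)\<^sup>2 \<partial>M)"
  have R: "R \<ge> 0" unfolding R_def by simp
  have "AE x in M. summable (\<lambda>k. F k x)"
  proof (rule AE_summable)
    show "F k \<in> borel_measurable M" for k unfolding F_def[abs_def] by measurable
    show "F k x \<ge> 0" for k x by (simp add: F_def)
    show "(\<integral>\<^sup>+x. ennreal (F k x) \<partial>M) \<le>
        ennreal (R * (autocorrelation_norm ?Y (k ^ P) / (W (k ^ P))\<^sup>2))" for k
    proof -
      define c where "c = 1 / (W (k ^ P))\<^sup>2"
      have c: "c \<ge> 0" by (simp add: c_def)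
      have "(\<integral>\<^sup>+x. ennreal (F k x) \<partial>M) =
          (\<integral>\<^sup>+x. ennreal c * ennreal ((\<Sum>n=1..k ^ P. ?Y n * u ((T ^^ n) x))\<^sup>2) \<partial>M)"
        unfolding F_def power_divide c_def
        by (intro nn_integral_cong, subst ennreal_mult[symmetric]) (simp_all only: zero_le_power2 divide_nonneg_nonneg zero_le_one times_divide_eq_left mult_1_left)
      also have "\<dots> = ennreal c * (\<integral>\<^sup>+x. ennreal ((\<Sum>n=1..k ^ P. ?Y n * u ((T ^^ n) x))\<^sup>2) \<partial>M)"
        by (rule nn_integral_cmult) measurable
      also have "\<dots> \<le> ennreal c * ennreal (R * autocorrelation_norm ?Y (k ^ P))"
        unfolding R_def by (intro mult_left_mono integral_square_sum_le u2) auto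
      also have "\<dots> = ennreal (c * (R * autocorrelation_norm ?Y (k ^ P)))"
        using c R autocorrelation_norm_nonneg[of ?Y "k ^ P"] by (intro ennreal_mult[symmetric]) auto
      also have "c * (R * autocorrelation_norm ?Y (k ^ P)) =
          R * (autocorrelation_norm ?Y (k ^ P) / (W (k ^ P))\<^sup>2)" by (simp add: c_def)
      finally show ?thesis .
    qed
    show "summable (\<lambda>k. R * (autocorrelation_norm ?Y (k ^ P) / (W (k ^ P))\<^sup>2))"
      by (intro summable_mult summable_autocorrelation)
    show "R * (autocorrelation_norm ?Y (k ^ P) / (W (k ^ P))\<^sup>2) \<ge> 0" for k
      using R autocorrelation_norm_nonneg[of ?Y "k ^ P"] by simp
  qed
  moreover have "integrable M u"
    by (rule square_integrable_imp_integrable) (use u2 in auto)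
  note birkhoff[OF this]
  ultimately show ?thesis
  proof eventually_elim
    case (elim x)
    have "(\<lambda>k. (\<Sum>n=1..k ^ P. ?Y n * u ((T ^^ n) x)) / W (k ^ P)) \<longlonglongrightarrow> 0"
      using summable_LIMSEQ_zero[OF elim(1)] unfolding F_def
      by (rule power_tendsto_0_iff[THEN iffD1, rotated]) simp
    from weighted_limit[of "\<lambda>n. u ((T ^^ n) x)", OF nonneg elim(2) this]
    have "(\<lambda>N. (\<Sum>n=1..N. X n * u ((T ^^ n) x)) / W N) \<longlonglongrightarrow> real_cond_exp M Inv u x" .
    from tendsto_divide[OF this count_limit]
    have "(\<lambda>N. ((\<Sum>n=1..N. X n * u ((T ^^ n) x)) / W N) / ((\<Sum>n=1..N. X n) / W N)) \<longlonglongrightarrow>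
        real_cond_exp M Inv u x" by simp
    moreover have "\<forall>\<^sub>F N in sequentially. ((\<Sum>n=1..N. X n * u ((T ^^ n) x)) / W N) / ((\<Sum>n=1..N. X n) / W N) =
        (\<Sum>n=1..N. X n * u ((T ^^ n) x)) / (\<Sum>n=1..N. X n)"
      using eventually_W_pos by eventually_elim simp
    ultimately show ?case by (rule Lim_transform_eventually)
  qed
qed

section \<open>Averages along increasing sequences\<close>

lemma increasing_sequence_strict_mono:
  assumes "infinite S" "1 \<le> i" "i < j"
  shows "increasing_sequence S i < increasing_sequence S j"
  using assms by (simp add: increasing_sequence_def enumerate_mono)

lemma increasing_sequence_image:
  assumes S: "infinite S" "S \<subseteq> {1..}" and m: "m \<ge> 1"
  shows "increasing_sequence S ` {1..m} = S \<inter> {1..increasing_sequence S m}"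
proof (intro equalityI subsetI)
  fix n assume "n \<in> increasing_sequence S ` {1..m}"
  then obtain j where j: "1 \<le> j" "j \<le> m" "n = increasing_sequence S j" by auto
  then have "n \<le> increasing_sequence S m"
    using increasing_sequence_strict_mono[OF S(1), of j m] by (cases "j = m") auto
  moreover have "n \<in> S" using j S(1) by (simp add: increasing_sequence_def enumerate_in_set)
  ultimately show "n \<in> S \<inter> {1..increasing_sequence S m}" using S by auto
next
  fix n assume n: "n \<in> S \<inter> {1..increasing_sequence S m}"
  then obtain i where i: "enumerate S i = n" using enumerate_Ex[OF S(1)] by auto
  have "i \<le> m - 1"
  proof (rule ccontr)
    assume "\<not> i \<le> m - 1"
    then have "enumerate S (m - 1) < enumerate S i" using S by (intro enumerate_mono) auto
    then show False using n i by (simp add: increasing_sequence_def)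
  qed
  then show "n \<in> increasing_sequence S ` {1..m}"
    using m i by (intro image_eqI[of _ _ "Suc i"]) (auto simp: increasing_sequence_def)
qed

text \<open>Up to the time \<open>increasing_sequence S m\<close> there are exactly \<open>m\<close>
  hits, so the averages along \<open>S\<close> are a subsequence of the averages weighted by the
  indicator.\<close>

lemma increasing_sequence_average:
  fixes v :: "nat \<Rightarrow> real"
  assumes S: "infinite S" "S \<subseteq> {1..}"
    and lim: "(\<lambda>N. (\<Sum>n=1..N. indicator S n * v n) / (\<Sum>n=1..N. indicator S n)) \<longlonglongrightarrow> l"
  shows "(\<lambda>m. (\<Sum>j=1..m. v (increasing_sequence S j)) / real m) \<longlonglongrightarrow> l"
proof -
  let ?s = "increasing_sequence S"
  have sum: "(\<Sum>j=1..m. w (?s j)) = (\<Sum>n=1..?s m. indicator S n * w n)" if "m \<ge> 1" for m and w :: "nat \<Rightarrow> real"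
  proof -
    have inj: "inj_on ?s {1..m}"
      by (rule inj_onI) (metis atLeastAtMost_iff increasing_sequence_strict_mono[OF S(1)]
          less_irrefl linorder_neqE_nat)
    have "(\<Sum>j=1..m. w (?s j)) = sum w (S \<inter> {1..?s m})"
      using sum.reindex[OF inj, of w] increasing_sequence_image[OF S that] by simp
    also have "\<dots> = (\<Sum>n=1..?s m. indicator S n * w n)"
      by (intro sum.mono_neutral_cong_left) (auto simp: indicator_def)
    finally show ?thesis .
  qed
  have "filterlim ?s at_top sequentially"
  proof (rule filterlim_at_top_mono)
    show "filterlim (\<lambda>m. m - 1) at_top sequentially" by (rule filterlim_minus_const_nat_at_top)
    show "\<forall>\<^sub>F m in sequentially. m - 1 \<le> ?s m"
      using S(1) by (simp add: increasing_sequence_def le_enumerate)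
  qed
  from filterlim_compose[OF lim this]
  have "(\<lambda>m. (\<Sum>n=1..?s m. indicator S n * v n) / (\<Sum>n=1..?s m. indicator S n)) \<longlonglongrightarrow> l" .
  moreover have "\<forall>\<^sub>F m in sequentially. (\<Sum>n=1..?s m. indicator S n * v n) / (\<Sum>n=1..?s m. indicator S n) =
      (\<Sum>j=1..m. v (?s j)) / real m"
    using eventually_ge_at_top[of 1]
  proof eventually_elim
    case (elim m)
    then show ?case using sum[OF elim, of v] sum[OF elim, of "\<lambda>_. 1"] by simp
  qed
  ultimately show ?thesis by (rule Lim_transform_eventually)
qed

text \<open>Finitely many hits would be negligible against the diverging \<open>W N\<close>,
  contradicting \<open>count_limit\<close>.\<close>

lemma good_weights_infinite:
  assumes "good_weights (indicator S) p P"
  shows "infinite S"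
proof
  assume fin: "finite S"
  interpret good_weights "indicator S" p P by fact
  have "(\<lambda>N. (\<Sum>n=1..N. indicator S n :: real) / W N) \<longlonglongrightarrow> 0"
  proof (rule Lim_null_comparison)
    show "\<forall>\<^sub>F N in sequentially. norm ((\<Sum>n=1..N. indicator S n :: real) / W N) \<le> real (card S) / W N"
    proof (intro always_eventually allI)
      fix N
      have "(\<Sum>n=1..N. indicator S n :: real) = real (card (S \<inter> {1..N}))"
        by (simp add: indicator_def sum.If_cases Int_commute)
      also have "\<dots> \<le> real (card S)" using fin by (simp add: card_mono)
      finally show "norm ((\<Sum>n=1..N. indicator S n :: real) / W N) \<le> real (card S) / W N"
        using W_nonneg[of N] by (simp add: divide_right_mono sum_nonneg abs_of_nonneg)
    qed
    show "(\<lambda>N. real (card S) / W N) \<longlonglongrightarrow> 0"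
      by (rule real_tendsto_divide_at_top[OF tendsto_const p_diverges])
  qed
  with count_limit show False using LIMSEQ_unique zero_neq_one by blast
qed

section \<open>Pointwise and mean limits along a set of times\<close>

context mps
begin

lemma Lp_functions_2_iff:
  "f \<in> Lp_functions 2 M \<longleftrightarrow> f \<in> borel_measurable M \<and> integrable M (\<lambda>x. (norm (f x))\<^sup>2)"
proof -
  have "norm z powr 2 = (norm z)\<^sup>2" for z :: complex by (cases "z = 0") auto
  then show ?thesis by (simp add: Lp_functions_def)
qed

lemma Lp_functions_Re_Im:
  assumes "f \<in> Lp_functions 2 M"
  shows "(\<lambda>x. Re (f x)) \<in> borel_measurable M" "integrable M (\<lambda>x. (Re (f x))\<^sup>2)"
    "(\<lambda>x. Im (f x)) \<in> borel_measurable M" "integrable M (\<lambda>x. (Im (f x))\<^sup>2)"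
proof -
  have [measurable]: "f \<in> borel_measurable M" and int: "integrable M (\<lambda>x. (norm (f x))\<^sup>2)"
    using assms by (auto simp: Lp_functions_2_iff)
  show "(\<lambda>x. Re (f x)) \<in> borel_measurable M" "(\<lambda>x. Im (f x)) \<in> borel_measurable M" by measurable
  show "integrable M (\<lambda>x. (Re (f x))\<^sup>2)"
    by (rule Bochner_Integration.integrable_bound[OF int]) (auto simp: cmod_power2)
  show "integrable M (\<lambda>x. (Im (f x))\<^sup>2)"
    by (rule Bochner_Integration.integrable_bound[OF int]) (auto simp: cmod_power2)
qed

text \<open>Positive and negative parts are treated separately, since filling in the times between
  k^P and (k + 1)^P requires nonnegative functions.\<close>

lemma AE_sequence_limit:
  fixes u :: "'x \<Rightarrow> real"
  assumes good: "good_weights (indicator S) p P" and S: "S \<subseteq> {1..}"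
    and [measurable]: "u \<in> borel_measurable M" and u2: "integrable M (\<lambda>x. (u x)\<^sup>2)"
  shows "AE x in M. (\<lambda>m. (\<Sum>j=1..m. u ((T ^^ increasing_sequence S j) x)) / real m)
    \<longlonglongrightarrow> real_cond_exp M Inv u x"
proof -
  interpret Inv: finite_measure_subalgebra M Inv by (rule finite_measure_subalgebra_Inv)
  define a where "a x = max 0 (u x)" for x
  define b where "b x = max 0 (- u x)" for x
  have [measurable]: "a \<in> borel_measurable M" "b \<in> borel_measurable M"
    unfolding a_def[abs_def] b_def[abs_def] by measurable
  have ab2: "integrable M (\<lambda>x. (a x)\<^sup>2)" "integrable M (\<lambda>x. (b x)\<^sup>2)"
    by (rule Bochner_Integration.integrable_bound[OF u2]; simp add: a_def b_def max_def)+
  have ab: "integrable M a" "integrable M b"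
    by (rule square_integrable_imp_integrable; use ab2 in simp)+
  have "u = (\<lambda>x. a x - b x)" by (auto simp: a_def b_def)
  with Inv.real_cond_exp_diff[OF ab]
  have "AE x in M. real_cond_exp M Inv u x = real_cond_exp M Inv a x - real_cond_exp M Inv b x" by simp
  moreover have "AE x in M. (\<lambda>N. (\<Sum>n=1..N. indicator S n * a ((T ^^ n) x)) / (\<Sum>n=1..N. indicator S n))
      \<longlonglongrightarrow> real_cond_exp M Inv a x"
    by (rule AE_weighted_limit[OF good]) (use ab2 in \<open>auto simp: a_def\<close>)
  moreover have "AE x in M. (\<lambda>N. (\<Sum>n=1..N. indicator S n * b ((T ^^ n) x)) / (\<Sum>n=1..N. indicator S n))
      \<longlonglongrightarrow> real_cond_exp M Inv b x"
    by (rule AE_weighted_limit[OF good]) (use ab2 in \<open>auto simp: b_def\<close>)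
  ultimately show ?thesis
  proof eventually_elim
    case (elim x)
    note lim = increasing_sequence_average[OF good_weights_infinite[OF good] S]
    from tendsto_diff[OF lim[OF elim(2)] lim[OF elim(3)]]
    show ?case unfolding elim(1)
      by (simp add: a_def b_def max_def diff_divide_distrib[symmetric] sum_subtractf[symmetric]
          if_distrib cong: if_cong)
  qed
qed

lemma AE_ergodic_average_limit:
  assumes good: "good_weights (indicator S) p P" and S: "S \<subseteq> {1..}"
    and f: "f \<in> Lp_functions 2 M"
  shows "AE x in M. (\<lambda>N. ergodic_average (increasing_sequence S) T f N x) \<longlonglongrightarrow> complex_cond_exp M Inv f x"
  using AE_sequence_limit[OF good S Lp_functions_Re_Im(1,2)[OF f]]
    AE_sequence_limit[OF good S Lp_functions_Re_Im(3,4)[OF f]]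
  by eventually_elim (simp add: tendsto_complex_iff ergodic_average_def complex_cond_exp_def)

lemma measurable_complex_cond_exp: "complex_cond_exp M Inv f \<in> borel_measurable M"
  by (subst borel_measurable_complex_iff) (auto simp: complex_cond_exp_def)

lemma measurable_ergodic_average:
  assumes [measurable]: "f \<in> borel_measurable M"
  shows "ergodic_average s T f N \<in> borel_measurable M"
  unfolding ergodic_average_def[abs_def] divide_inverse by measurable

text \<open>Convexity of the square, followed by invariance of the measure under each iterate; hence
  it holds for an arbitrary sequence \<open>s\<close>.\<close>

lemma nn_integral_ergodic_average_le:
  assumes [measurable]: "f \<in> borel_measurable M"
  shows "(\<integral>\<^sup>+x. ennreal ((norm (ergodic_average s T f N x))\<^sup>2) \<partial>M) \<le> (\<integral>\<^sup>+x. ennreal ((norm (f x))\<^sup>2) \<partial>M)"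
proof (cases "N = 0")
  case False
  let ?c = "1 / real N"
  have "(norm (ergodic_average s T f N x))\<^sup>2 \<le> ?c * (\<Sum>n=1..N. (norm (f ((T ^^ s n) x)))\<^sup>2)" for x
  proof -
    have "(norm (\<Sum>n=1..N. f ((T ^^ s n) x)))\<^sup>2 \<le> (\<Sum>n=1..N. norm (f ((T ^^ s n) x)))\<^sup>2"
      by (intro power_mono norm_sum) auto
    also have "\<dots> \<le> (\<Sum>n=1..N. (norm (f ((T ^^ s n) x)))\<^sup>2) * real N"
      using sum_squared_le_sum_of_squares[of "\<lambda>n. norm (f ((T ^^ s n) x))" "{1..N}"] by simp
    finally show ?thesis
      using False by (simp add: ergodic_average_def norm_divide power_divide field_simps power2_eq_square)
  qed
  then have "(\<integral>\<^sup>+x. ennreal ((norm (ergodic_average s T f N x))\<^sup>2) \<partial>M) \<le>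
      (\<integral>\<^sup>+x. ennreal (?c * (\<Sum>n=1..N. (norm (f ((T ^^ s n) x)))\<^sup>2)) \<partial>M)"
    by (intro nn_integral_mono ennreal_leI)
  also have "\<dots> = (\<integral>\<^sup>+x. ennreal ?c * (\<Sum>n=1..N. ennreal ((norm (f ((T ^^ s n) x)))\<^sup>2)) \<partial>M)"
    by (intro nn_integral_cong) (subst ennreal_mult', auto simp: sum_ennreal)
  also have "\<dots> = ennreal ?c * (\<Sum>n=1..N. \<integral>\<^sup>+x. ennreal ((norm (f ((T ^^ s n) x)))\<^sup>2) \<partial>M)"
    by (simp add: nn_integral_cmult nn_integral_sum del: sum_ennreal)
  also have "\<dots> = ennreal ?c * (of_nat N * (\<integral>\<^sup>+x. ennreal ((norm (f x))\<^sup>2) \<partial>M))"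
    using nn_integral_funpow[of "\<lambda>x. ennreal ((norm (f x))\<^sup>2)"] by simp
  also have "\<dots> = (\<integral>\<^sup>+x. ennreal ((norm (f x))\<^sup>2) \<partial>M)"
  proof -
    have "ennreal ?c * of_nat N = 1"
      using False by (simp add: ennreal_of_nat_eq_real_of_nat flip: ennreal_mult')
    then show ?thesis by (simp flip: mult.assoc)
  qed
  finally show ?thesis .
qed (simp add: ergodic_average_def)

lemma ergodic_average_add:
  "ergodic_average s T (\<lambda>x. f x + g x) N x = ergodic_average s T f N x + ergodic_average s T g N x"
  by (simp add: ergodic_average_def sum.distrib add_divide_distrib)

text \<open>Truncation: for bounded functions this is dominated convergence, and the averages are
  contractions of \<open>L\<^sup>2\<close>.\<close>

lemma L2_limit_of_AE_limit:
  fixes s :: "nat \<Rightarrow> nat"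
  assumes lim: "\<And>f. f \<in> Lp_functions 2 M \<Longrightarrow>
      AE x in M. (\<lambda>N. ergodic_average s T f N x) \<longlonglongrightarrow> complex_cond_exp M Inv f x"
    and f: "f \<in> Lp_functions 2 M"
  shows "(\<lambda>N. \<integral>\<^sup>+ x. ennreal ((norm (ergodic_average s T f N x - complex_cond_exp M Inv f x))\<^sup>2) \<partial>M)
    \<longlonglongrightarrow> 0"
proof -
  let ?E = "complex_cond_exp M Inv"
  let ?A = "\<lambda>f N x. ergodic_average s T f N x"
  let ?I = "\<lambda>g. \<integral>\<^sup>+x. ennreal ((norm (g x))\<^sup>2) \<partial>M"
  have [measurable]: "f \<in> borel_measurable M" and f2: "integrable M (\<lambda>x. (norm (f x))\<^sup>2)"
    using f by (auto simp: Lp_functions_2_iff)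
  note [measurable] = measurable_complex_cond_exp measurable_ergodic_average
  define t where "t K x = (if norm (f x) \<le> real K then f x else 0)" for K x
  define g where "g K x = f x - t K x" for K x
  have [measurable]: "t K \<in> borel_measurable M" "g K \<in> borel_measurable M" for K
    unfolding t_def[abs_def] g_def[abs_def] by measurable
  have t_le: "norm (t K x) \<le> norm (f x)" "norm (t K x) \<le> real K" "norm (g K x) \<le> norm (f x)" for K x
    by (auto simp: t_def g_def)
  have tL: "t K \<in> Lp_functions 2 M" and gL: "g K \<in> Lp_functions 2 M" for K
    unfolding Lp_functions_2_iff
    by (auto intro!: Bochner_Integration.integrable_bound[OF f2] power_mono t_le)
  have tail: "(\<lambda>K. ?I (g K)) \<longlonglongrightarrow> 0"
  proof -
    have "(\<lambda>K. ?I (g K)) \<longlonglongrightarrow> (\<integral>\<^sup>+x. 0 \<partial>M)"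
    proof (rule nn_integral_dominated_convergence[where w = "\<lambda>x. ennreal ((norm (f x))\<^sup>2)"])
      show "(\<integral>\<^sup>+x. ennreal ((norm (f x))\<^sup>2) \<partial>M) < \<infinity>"
        using f2 by (simp add: integrable_iff_bounded)
      show "AE x in M. (\<lambda>K. ennreal ((norm (g K x))\<^sup>2)) \<longlonglongrightarrow> 0"
      proof (rule AE_I2)
        fix x
        have "\<forall>\<^sub>F K in sequentially. ennreal ((norm (g K x))\<^sup>2) = 0"
          by (rule eventually_sequentiallyI[of "nat \<lceil>norm (f x)\<rceil>"])
            (auto simp: g_def t_def le_nat_iff nat_le_iff ceiling_le_iff)
        then show "(\<lambda>K. ennreal ((norm (g K x))\<^sup>2)) \<longlonglongrightarrow> 0" by (rule tendsto_eventually)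
      qed
    qed (auto intro!: ennreal_leI power_mono t_le)
    then show ?thesis by simp
  qed
  have bounded_part: "(\<lambda>N. ?I (\<lambda>x. ?A (t K) N x - ?E (t K) x)) \<longlonglongrightarrow> 0" for K
  proof -
    have avg: "norm (?A (t K) N x) \<le> real K" for N x
    proof (cases "N = 0")
      case False
      have "norm (\<Sum>n=1..N. t K ((T ^^ s n) x)) \<le> (\<Sum>n=1..N. real K)"
        by (intro sum_norm_le t_le)
      then show ?thesis using False by (simp add: ergodic_average_def norm_divide field_simps)
    qed (simp add: ergodic_average_def)
    have "(\<lambda>N. ?I (\<lambda>x. ?A (t K) N x - ?E (t K) x)) \<longlonglongrightarrow> (\<integral>\<^sup>+x. 0 \<partial>M)"
    proof (rule nn_integral_dominated_convergence[where w = "\<lambda>x. ennreal ((2 * real K)\<^sup>2)"])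
      show "AE x in M. (\<lambda>N. ennreal ((norm (?A (t K) N x - ?E (t K) x))\<^sup>2)) \<longlonglongrightarrow> 0"
        using lim[OF tL[of K]]
      proof eventually_elim
        case (elim x)
        from LIM_zero[OF elim] have "(\<lambda>N. (norm (?A (t K) N x - ?E (t K) x))\<^sup>2) \<longlonglongrightarrow> 0"
          by (intro tendsto_null_power tendsto_norm_zero) auto
        from tendsto_ennrealI[OF this] show ?case by simp
      qed
      show "AE x in M. ennreal ((norm (?A (t K) N x - ?E (t K) x))\<^sup>2) \<le> ennreal ((2 * real K)\<^sup>2)" for N
        using lim[OF tL[of K]]
      proof eventually_elim
        case (elim x)
        \<comment> \<open>The bound is read off from the averages, whose limit is the conditional
          expectation.\<close>
        have "norm (?E (t K) x) \<le> real K"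
          by (rule Lim_bounded[OF tendsto_norm[OF elim], of 0]) (use avg in simp)
        then have "norm (?A (t K) N x - ?E (t K) x) \<le> 2 * real K"
          using norm_triangle_ineq4[of "?A (t K) N x" "?E (t K) x"] avg[of N x] by linarith
        then show ?case by (intro ennreal_leI power_mono) auto
      qed
    qed (auto simp: emeasure_space_1)
    then show ?thesis by simp
  qed
  \<comment> \<open>Fatou's lemma: the contraction property of the averages passes to their
    pointwise limit.\<close>
  have E_le: "?I (?E (g K)) \<le> ?I (g K)" for K
  proof -
    have "?I (?E (g K)) = (\<integral>\<^sup>+x. liminf (\<lambda>N. ennreal ((norm (?A (g K) N x))\<^sup>2)) \<partial>M)"
    proof (rule nn_integral_cong_AE)
      show "AE x in M. ennreal ((norm (?E (g K) x))\<^sup>2) = liminf (\<lambda>N. ennreal ((norm (?A (g K) N x))\<^sup>2))"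
        using lim[OF gL[of K]]
      proof eventually_elim
        case (elim x)
        from lim_imp_Liminf[OF _ tendsto_ennrealI[OF tendsto_power[OF tendsto_norm[OF elim], of 2]]]
        show ?case by simp
      qed
    qed
    also have "\<dots> \<le> liminf (\<lambda>N. ?I (?A (g K) N))"
      by (rule nn_integral_liminf) measurable
    also have "\<dots> \<le> ?I (g K)"
      by (intro Liminf_le always_eventually allI nn_integral_ergodic_average_le) auto
    finally show ?thesis .
  qed
  have split: "?I (\<lambda>x. ?A f N x - ?E f x) \<le> 3 * ?I (\<lambda>x. ?A (t K) N x - ?E (t K) x) + 6 * ?I (g K)" for N K
  proof -
    have ineq: "(norm (a + b - (c + d)))\<^sup>2 \<le> 3 * (norm (a - c))\<^sup>2 + (3 * (norm b)\<^sup>2 + 3 * (norm d)\<^sup>2)"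
      for a b c d :: complex
    proof -
      have "norm (a + b - (c + d)) \<le> norm (a - c) + norm b + norm d"
        using norm_triangle_ineq[of "a - c" "b - d"] norm_triangle_ineq4[of b d] by (simp add: algebra_simps)
      then have "(norm (a + b - (c + d)))\<^sup>2 \<le> (norm (a - c) + norm b + norm d)\<^sup>2"
        by (intro power_mono) auto
      also have "(x + y + z)\<^sup>2 \<le> 3 * x\<^sup>2 + (3 * y\<^sup>2 + 3 * z\<^sup>2)" for x y z :: real
        using zero_le_power2[of "x - y"] zero_le_power2[of "x - z"] zero_le_power2[of "y - z"]
        by (simp add: power2_eq_square algebra_simps)
      finally show ?thesis .
    qed
    have feq: "(\<lambda>x. t K x + g K x) = f" by (simp add: g_def)
    \<comment> \<open>Additivity of the conditional expectation also follows from the averages, by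
      uniqueness of limits.\<close>
    have "AE x in M. ?E f x = ?E (t K) x + ?E (g K) x"
      using lim[OF f] lim[OF tL[of K]] lim[OF gL[of K]]
    proof eventually_elim
      case (elim x)
      have "(\<lambda>N. ?A f N x) \<longlonglongrightarrow> ?E (t K) x + ?E (g K) x"
        using tendsto_add[OF elim(2,3)] by (simp only: feq flip: ergodic_average_add)
      with elim(1) show ?case by (rule LIMSEQ_unique)
    qed
    then have "?I (\<lambda>x. ?A f N x - ?E f x) \<le> (\<integral>\<^sup>+x. 3 * ennreal ((norm (?A (t K) N x - ?E (t K) x))\<^sup>2) +
        (3 * ennreal ((norm (?A (g K) N x))\<^sup>2) + 3 * ennreal ((norm (?E (g K) x))\<^sup>2)) \<partial>M)"
    proof (intro nn_integral_mono_AE, eventually_elim)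
      case (elim x)
      have "?A f N x = ?A (t K) N x + ?A (g K) N x"
        by (simp only: feq flip: ergodic_average_add)
      with elim ineq[of "?A (t K) N x" "?A (g K) N x" "?E (t K) x" "?E (g K) x"]
      show ?case
        by (simp add: ennreal_leI flip: ennreal_plus ennreal_mult' ennreal_numeral)
    qed
    also have "\<dots> = 3 * ?I (\<lambda>x. ?A (t K) N x - ?E (t K) x) + (3 * ?I (?A (g K) N) + 3 * ?I (?E (g K)))"
      by (simp add: nn_integral_add nn_integral_cmult)
    also have "\<dots> \<le> 3 * ?I (\<lambda>x. ?A (t K) N x - ?E (t K) x) + (3 * ?I (g K) + 3 * ?I (g K))"
      by (intro add_mono mult_left_mono E_le nn_integral_ergodic_average_le order_refl) auto
    also have "3 * ?I (g K) + 3 * ?I (g K) = 6 * ?I (g K)"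
      by (simp flip: distrib_right)
    finally show ?thesis .
  qed
  show ?thesis
  proof (rule order_tendstoI)
    fix e :: ennreal assume e: "0 < e"
    then obtain y where y: "0 < y" "y < e" using dense by blast
    then obtain r where r: "y = ennreal r" "r > 0" by (cases y) auto
    \<comment> \<open>The coefficients 3 and 6 of the splitting add up to 9.\<close>
    have r9: "0 < ennreal (r / 9)" using r by simp
    from order_tendstoD(2)[OF tail r9] obtain K where K: "?I (g K) < ennreal (r / 9)"
      by (auto dest: eventually_happens)
    show "\<forall>\<^sub>F N in sequentially. ?I (\<lambda>x. ?A f N x - ?E f x) < e"
      using order_tendstoD(2)[OF bounded_part[of K] r9]
    proof eventually_elim
      case (elim N)
      have "?I (\<lambda>x. ?A f N x - ?E f x) \<le> 3 * ennreal (r / 9) + 6 * ennreal (r / 9)"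
        by (rule order_trans[OF split[of N K]]) (intro add_mono mult_left_mono less_imp_le K elim; simp)
      also have "\<dots> = ennreal r"
        using r by (simp flip: ennreal_plus ennreal_mult' ennreal_numeral)
      finally show ?case using r y by simp
    qed
  qed simp
qed

end

section \<open>Reduction of arbitrary systems to shifts on path space\<close>

lemma funpow_shift: "((\<lambda>w n. w (Suc n)) ^^ k) w = (\<lambda>n. w (n + k))"
  by (induction k arbitrary: w) auto

lemma mps_distr:
  assumes "mps M T" and [measurable]: "\<Phi> \<in> M \<rightarrow>\<^sub>M N" "S \<in> N \<rightarrow>\<^sub>M N"
    and comm: "\<And>x. x \<in> space M \<Longrightarrow> S (\<Phi> x) = \<Phi> (T x)"
  shows "mps (distr M N \<Phi>) S"
proof -
  interpret mps M T by fact
  show ?thesis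
  proof (intro mps.intro mps_axioms.intro prob_space_distr)
    fix A assume "A \<in> sets (distr M N \<Phi>)"
    then have [measurable]: "A \<in> sets N" by simp
    have "emeasure (distr M N \<Phi>) (S -` A \<inter> space N) = emeasure M (\<Phi> -` (S -` A \<inter> space N) \<inter> space M)"
      by (subst emeasure_distr) auto
    also have "\<Phi> -` (S -` A \<inter> space N) \<inter> space M = T -` (\<Phi> -` A \<inter> space M) \<inter> space M"
      using comm measurable_space[OF measurable_T] measurable_space[OF \<open>\<Phi> \<in> M \<rightarrow>\<^sub>M N\<close>] by auto
    also have "emeasure M \<dots> = emeasure M (\<Phi> -` A \<inter> space M)"
      by (rule emeasure_vimage) measurable
    also have "\<dots> = emeasure (distr M N \<Phi>) A" by (subst emeasure_distr) auto
    finally show "emeasure (distr M N \<Phi>) (S -` A \<inter> space (distr M N \<Phi>)) = emeasure (distr M N \<Phi>) A"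
      by simp
  qed auto
qed

text \<open>The process \<open>(f (T\<^sup>n x))\<^sub>n\<close> with the shift is a factor of the system, and both
  conditional expectations are Birkhoff limits of the same averages.\<close>

lemma (in mps) path_space_factor:
  assumes f: "f \<in> Lp_functions 2 M"
  obtains N :: "(nat \<Rightarrow> complex) measure" and S \<Phi> \<pi>
  where "mps N S" "\<pi> \<in> Lp_functions 2 N" "\<Phi> \<in> M \<rightarrow>\<^sub>M N" "N = distr M N \<Phi>"
    "\<And>s n x. ergodic_average s S \<pi> n (\<Phi> x) = ergodic_average s T f n x"
    "AE x in M. complex_cond_exp N (invariant_algebra N S) \<pi> (\<Phi> x) = complex_cond_exp M Inv f x"
proof -
  have [measurable]: "f \<in> borel_measurable M" and f2: "integrable M (\<lambda>x. (norm (f x))\<^sup>2)"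
    using f by (auto simp: Lp_functions_2_iff)
  let ?B = "\<Pi>\<^sub>M (i::nat)\<in>UNIV. (borel :: complex measure)"
  define \<Phi> where "\<Phi> x = (\<lambda>n. f ((T ^^ n) x))" for x
  define S where "S = (\<lambda>(w :: nat \<Rightarrow> complex) n. w (Suc n))"
  define \<pi> where "\<pi> = (\<lambda>w :: nat \<Rightarrow> complex. w 0)"
  define N where "N = distr M ?B \<Phi>"
  have \<Phi>B [measurable]: "\<Phi> \<in> M \<rightarrow>\<^sub>M ?B"
    unfolding \<Phi>_def by (rule measurable_PiM_single') auto
  have SB [measurable]: "S \<in> ?B \<rightarrow>\<^sub>M ?B"
    unfolding S_def by (rule measurable_PiM_single'[where f = "\<lambda>n w. w (Suc n)"]) auto
  have \<pi>B [measurable]: "\<pi> \<in> ?B \<rightarrow>\<^sub>M borel"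
    unfolding \<pi>_def by (rule measurable_component_singleton) auto
  have setsN [measurable_cong]: "sets N = sets ?B" by (simp add: N_def)
  have N_eq: "N = distr M N \<Phi>" unfolding N_def by (rule distr_cong) auto
  have \<Phi>N: "\<Phi> \<in> M \<rightarrow>\<^sub>M N" by measurable
  have mpsN: "mps N S"
    unfolding N_def
    by (rule mps_distr[OF mps_axioms \<Phi>B SB]) (simp add: \<Phi>_def S_def funpow_swap1)
  interpret N: mps N S by fact
  have S_pow: "\<pi> ((S ^^ n) (\<Phi> x)) = f ((T ^^ n) x)" for n x
    unfolding S_def funpow_shift by (simp add: \<pi>_def \<Phi>_def)
  have avg: "ergodic_average s S \<pi> n (\<Phi> x) = ergodic_average s T f n x" for s n x
    by (simp add: ergodic_average_def S_pow)
  have \<pi>L: "\<pi> \<in> Lp_functions 2 N"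
    unfolding N.Lp_functions_2_iff
  proof
    show "\<pi> \<in> borel_measurable N" by measurable
    show "integrable N (\<lambda>x. (norm (\<pi> x))\<^sup>2)"
      unfolding N_def by (subst integrable_distr_eq) (use f2 in \<open>auto simp: \<pi>_def \<Phi>_def\<close>)
  qed
  have real_part: "AE x in M. real_cond_exp N N.Inv (\<lambda>w. r (\<pi> w)) (\<Phi> x) = real_cond_exp M Inv (\<lambda>x. r (f x)) x"
    if "integrable M (\<lambda>x. r (f x))" "integrable N (\<lambda>w. r (\<pi> w))" for r :: "complex \<Rightarrow> real"
  proof -
    have "AE w in distr M N \<Phi>. (\<lambda>n. (\<Sum>i=1..n. r (\<pi> ((S ^^ i) w))) / real n) \<longlonglongrightarrow>
        real_cond_exp N N.Inv (\<lambda>w. r (\<pi> w)) w"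
      by (rule subst[OF N_eq]) (rule N.birkhoff[OF that(2)])
    from AE_distrD[OF \<Phi>N this] birkhoff[OF that(1)] show ?thesis
    proof eventually_elim
      case (elim x)
      then show ?case unfolding S_pow by (rule LIMSEQ_unique)
    qed
  qed
  have "AE x in M. complex_cond_exp N N.Inv \<pi> (\<Phi> x) = complex_cond_exp M Inv f x"
    using real_part[OF square_integrable_imp_integrable[OF Lp_functions_Re_Im(1,2)[OF f]]
        N.square_integrable_imp_integrable[OF N.Lp_functions_Re_Im(1,2)[OF \<pi>L]]]
      real_part[OF square_integrable_imp_integrable[OF Lp_functions_Re_Im(3,4)[OF f]]
        N.square_integrable_imp_integrable[OF N.Lp_functions_Re_Im(3,4)[OF \<pi>L]]]
    by eventually_elim (simp add: complex_cond_exp_def)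
  from that[OF mpsN \<pi>L \<Phi>N N_eq avg this] show thesis .
qed

text \<open>The averages at \<open>x\<close> coincide with those at the path
  \<open>\<Phi> x\<close>, so an almost sure property of paths pulls back to the system.\<close>

lemma pointwise_universally_good_transfer:
  assumes "pointwise_universally_good TYPE(nat \<Rightarrow> complex) 2 s"
  shows "pointwise_universally_good TYPE('x) 2 s"
  unfolding pointwise_universally_good_def
proof (intro allI impI)
  fix M :: "'x measure" and T f
  assume "measure_preserving_system M T" and f: "f \<in> Lp_functions 2 M"
  then interpret mps M T by (simp add: mps_iff)
  obtain N :: "(nat \<Rightarrow> complex) measure" and S \<Phi> \<pi>
    where N: "mps N S" "\<pi> \<in> Lp_functions 2 N" "\<Phi> \<in> M \<rightarrow>\<^sub>M N" "N = distr M N \<Phi>"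
      and avg: "\<And>s n x. ergodic_average s S \<pi> n (\<Phi> x) = ergodic_average s T f n x"
      and ce: "AE x in M. complex_cond_exp N (invariant_algebra N S) \<pi> (\<Phi> x) = complex_cond_exp M Inv f x"
    by (rule path_space_factor[OF f]) (rule that; assumption)
  have "AE w in N. convergent (\<lambda>n. ergodic_average s S \<pi> n w)"
    using assms N(1,2) by (simp add: pointwise_universally_good_def mps_iff)
  then have "AE w in distr M N \<Phi>. convergent (\<lambda>n. ergodic_average s S \<pi> n w)"
    by (rule subst[OF N(4)])
  from AE_distrD[OF N(3) this]
  show "AE x in M. convergent (\<lambda>n. ergodic_average s T f n x)" by (simp add: avg)
qed

text \<open>The squared distance is the integral of a function on path space; its pullback is the
  corresponding function on the system because both averages and conditional expectations
  match.\<close>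

lemma ergodic_sequence_transfer:
  assumes "ergodic_sequence TYPE(nat \<Rightarrow> complex) s"
  shows "ergodic_sequence TYPE('x) s"
  unfolding ergodic_sequence_def
proof (intro allI impI)
  fix M :: "'x measure" and T f
  assume "measure_preserving_system M T" and f: "f \<in> Lp_functions 2 M"
  then interpret mps M T by (simp add: mps_iff)
  obtain N :: "(nat \<Rightarrow> complex) measure" and S \<Phi> \<pi>
    where N: "mps N S" "\<pi> \<in> Lp_functions 2 N" "\<Phi> \<in> M \<rightarrow>\<^sub>M N" "N = distr M N \<Phi>"
      and avg: "\<And>s n x. ergodic_average s S \<pi> n (\<Phi> x) = ergodic_average s T f n x"
      and ce: "AE x in M. complex_cond_exp N (invariant_algebra N S) \<pi> (\<Phi> x) = complex_cond_exp M Inv f x"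
    by (rule path_space_factor[OF f]) (rule that; assumption)
  interpret N: mps N S by fact
  have [measurable]: "\<pi> \<in> borel_measurable N" using N(2) by (simp add: N.Lp_functions_2_iff)
  note [measurable] = N.measurable_complex_cond_exp N.measurable_ergodic_average N(3)
  let ?E = "complex_cond_exp N N.Inv \<pi>"
  define G where "G n w = ennreal ((norm (ergodic_average s S \<pi> n w - ?E w))\<^sup>2)" for n w
  have [measurable]: "G n \<in> borel_measurable N" for n unfolding G_def[abs_def] by measurable
  have "(\<integral>\<^sup>+w. G n w \<partial>N) =
      (\<integral>\<^sup>+x. ennreal ((norm (ergodic_average s T f n x - complex_cond_exp M Inv f x))\<^sup>2) \<partial>M)" for n
  proof -
    have "(\<integral>\<^sup>+w. G n w \<partial>N) = (\<integral>\<^sup>+w. G n w \<partial>distr M N \<Phi>)"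
      by (rule arg_cong[OF N(4), where f = "\<lambda>Q. nn_integral Q (G n)"])
    also have "\<dots> = (\<integral>\<^sup>+x. G n (\<Phi> x) \<partial>M)"
      by (rule nn_integral_distr) measurable
    also have "\<dots> = (\<integral>\<^sup>+x. ennreal ((norm (ergodic_average s T f n x - complex_cond_exp M Inv f x))\<^sup>2) \<partial>M)"
      by (rule nn_integral_cong_AE) (use ce in \<open>eventually_elim, simp add: avg G_def\<close>)
    finally show ?thesis .
  qed
  moreover have "(\<lambda>n. \<integral>\<^sup>+w. G n w \<partial>N) \<longlonglongrightarrow> 0"
    using assms N(1,2) unfolding G_def by (simp add: ergodic_sequence_def mps_iff)
  ultimately show "(\<lambda>n. \<integral>\<^sup>+x. ennreal ((norm (ergodic_average s T f n x - complex_cond_exp M Inv f x))\<^sup>2) \<partial>M)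
      \<longlonglongrightarrow> 0" by simp
qed

lemma good_weights_imp_good_sequence:
  assumes good: "good_weights (indicator S) p P" and S: "S \<subseteq> {1..}"
  shows "infinite S"
    and "pointwise_universally_good TYPE('x) 2 (increasing_sequence S)"
    and "ergodic_sequence TYPE('x) (increasing_sequence S)"
proof -
  show "infinite S" by (rule good_weights_infinite[OF good])
  show "pointwise_universally_good TYPE('x) 2 (increasing_sequence S)"
    unfolding pointwise_universally_good_def mps_iff convergent_def
    using mps.AE_ergodic_average_limit[OF _ good S] by (fastforce elim: eventually_mono)
  show "ergodic_sequence TYPE('x) (increasing_sequence S)"
    unfolding ergodic_sequence_def mps_iff
    using mps.L2_limit_of_AE_limit mps.AE_ergodic_average_limit[OF _ good S] by blast
qed

section \<open>Mixing of the Gauss map\<close>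

lemma measurable_gauss_map [measurable]: "gauss_map \<in> borel_measurable borel"
  unfolding gauss_map_def frac_def by measurable

lemma measurable_gauss_funpow [measurable]: "gauss_map ^^ n \<in> borel_measurable borel"
  by (induction n) (auto simp: id_def comp_def)

text \<open>The invariant density is extended by 0 to the real line, so that all functions involved
  can be Borel functions on \<open>real\<close>.\<close>

definition gauss_density :: "real \<Rightarrow> real" where
  "gauss_density x = indicator {0<..<1} x / (ln 2 * (1 + x))"

definition gauss_measure :: "real measure" where
  "gauss_measure = density lborel (\<lambda>x. ennreal (gauss_density x))"

lemma gauss_density_nonneg: "gauss_density x \<ge> 0"
  by (simp add: gauss_density_def indicator_def)

lemma measurable_gauss_density [measurable]: "gauss_density \<in> borel_measurable borel"
  unfolding gauss_density_def by measurable

lemma sets_gauss_measure [simp, measurable_cong]: "sets gauss_measure = sets borel"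
  and space_gauss_measure [simp]: "space gauss_measure = UNIV"
  by (simp_all add: gauss_measure_def)

lemma AE_gauss_measure_iff: "(AE x in gauss_measure. P x) \<longleftrightarrow> (AE x in lborel. x \<in> {0<..<1} \<longrightarrow> P x)"
  unfolding gauss_measure_def
  by (subst AE_density) (auto intro!: AE_cong simp: gauss_density_def indicator_def)

lemma AE_gauss_measure_range: "AE x in gauss_measure. x \<in> {0<..<1}"
  by (subst AE_gauss_measure_iff) auto

lemma nn_integral_gauss_measure:
  fixes f :: "real \<Rightarrow> ennreal"
  assumes [measurable]: "f \<in> borel_measurable borel"
  shows "(\<integral>\<^sup>+x. f x \<partial>gauss_measure) = (\<integral>\<^sup>+x. gauss_density x * f x \<partial>lborel)"
  unfolding gauss_measure_def by (subst nn_integral_density) auto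

text \<open>Half-lines replace the target intervals (0, s), because the measure ignores numbers
  below 0 and single points. The antiderivative of the density is
  \<open>log 2 (1 + x)\<close>.\<close>

lemma emeasure_gauss_measure_lessThan:
  assumes "0 \<le> s"
  shows "emeasure gauss_measure {..<s} = ennreal (log 2 (1 + min 1 s))"
proof -
  let ?t = "min 1 s"
  have t: "0 \<le> ?t" "?t \<le> 1" using assms by auto
  have "emeasure gauss_measure {..<s} = (\<integral>\<^sup>+x. ennreal (gauss_density x) * indicator {..<s} x \<partial>lborel)"
    unfolding gauss_measure_def by (subst emeasure_density) auto
  also have "\<dots> = (\<integral>\<^sup>+x. ennreal (1 / (ln 2 * (1 + x))) * indicator {0..?t} x \<partial>lborel)"
  proof (rule nn_integral_cong_AE)
    have "AE x in lborel. x \<noteq> 0 \<and> x \<noteq> ?t"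
      using AE_lborel_singleton[of 0] AE_lborel_singleton[of ?t] by eventually_elim auto
    then show "AE x in lborel. ennreal (gauss_density x) * indicator {..<s} x =
        ennreal (1 / (ln 2 * (1 + x))) * indicator {0..?t} x"
      by eventually_elim (auto simp: gauss_density_def indicator_def min_def)
  qed
  also have "\<dots> = ennreal (log 2 (1 + ?t) - log 2 (1 + 0))"
    using t by (intro nn_integral_FTC_Icc) (auto intro!: derivative_eq_intros simp: field_simps)
  finally show ?thesis by simp
qed

lemma prob_space_gauss_measure: "prob_space gauss_measure"
proof
  have "emeasure gauss_measure (space gauss_measure) = emeasure gauss_measure {..<1}"
    by (rule emeasure_eq_AE) (use AE_gauss_measure_range in auto)
  then show "emeasure gauss_measure (space gauss_measure) = 1"
    by (simp add: emeasure_gauss_measure_lessThan)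
qed

text \<open>\<open>digit_prob k x\<close> is the conditional probability, under the Gauss measure, that the inverse
  branch taken is \<open>1 / (k + 1 + x)\<close> given that the image point is \<open>x\<close>.\<close>

definition digit_prob :: "nat \<Rightarrow> real \<Rightarrow> real" where
  "digit_prob k x = (1 + x) / ((real k + 1 + x) * (real k + 2 + x))"

definition gauss_branch :: "nat \<Rightarrow> real \<Rightarrow> real" where
  "gauss_branch k x = 1 / (real k + 1 + x)"

lemma measurable_digit_prob [measurable]: "digit_prob k \<in> borel_measurable borel"
  and measurable_gauss_branch [measurable]: "gauss_branch k \<in> borel_measurable borel"
  unfolding digit_prob_def[abs_def] gauss_branch_def[abs_def] by measurable

lemma digit_prob_nonneg: "x \<ge> 0 \<Longrightarrow> digit_prob k x \<ge> 0"
  by (simp add: digit_prob_def)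

text \<open>The sum telescopes. The closed form is the distribution function of the digit, whose
  monotonicity in \<open>x\<close> is used in \<open>transfer_antimono\<close>.\<close>

lemma sum_digit_prob: "x \<ge> 0 \<Longrightarrow> (\<Sum>k<n. digit_prob k x) = real n / (real n + 1 + x)"
proof (induction n)
  case (Suc n)
  have "digit_prob n x = real (Suc n) / (real (Suc n) + 1 + x) - real n / (real n + 1 + x)"
    using Suc.prems by (simp add: digit_prob_def divide_simps) (simp add: algebra_simps)
  with Suc show ?case by simp
qed simp

lemma digit_prob_sums: "x \<ge> 0 \<Longrightarrow> (\<lambda>k. digit_prob k x) sums 1"
  unfolding sums_def by (simp add: sum_digit_prob) real_asymp

lemma nn_integral_gauss_branch:
  assumes [measurable]: "F \<in> borel_measurable borel"
  shows "(\<integral>\<^sup>+y. ennreal (F y) * indicator {1 / (real k + 2)..1 / (real k + 1)} y \<partial>lborel) =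
    (\<integral>\<^sup>+x. ennreal (F (gauss_branch k x) / (real k + 1 + x)\<^sup>2) * indicator {0..1} x \<partial>lborel)"
proof -
  \<comment> \<open>The branch is decreasing. Running through it backwards,
    \<open>g x = gauss_branch k (1 - x)\<close>, gives an increasing function for the substitution
    rule.\<close>
  define g where "g x = 1 / (real k + 2 - x)" for x :: real
  define g' where "g' x = 1 / (real k + 2 - x)\<^sup>2" for x :: real
  have "(\<integral>\<^sup>+y. ennreal (F y) * indicator {1 / (real k + 2)..1 / (real k + 1)} y \<partial>lborel) =
      (\<integral>\<^sup>+y. ennreal (F y * indicator {g 0..g 1} y) \<partial>lborel)"
    by (intro nn_integral_cong) (simp add: g_def add.commute split: split_indicator)
  also have "\<dots> =
        (\<integral>\<^sup>+x. ennreal (F (g x) * g' x * indicator {0..1} x) \<partial>lborel)"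
  proof (rule nn_integral_substitution)
    show "(g has_real_derivative g' x) (at x)" if "x \<in> {0..1}" for x
      unfolding g_def[abs_def] g'_def using that
      by (auto intro!: derivative_eq_intros simp: power2_eq_square)
    show "continuous_on {0..1} g'"
      unfolding g'_def[abs_def] by (intro continuous_intros) auto
    show "0 \<le> g' x" if "x \<in> {0..1}" for x by (simp add: g'_def)
  qed (auto simp: set_borel_measurable_def)
  also have "\<dots> = (\<integral>\<^sup>+x. ennreal (F (g (1 - x)) * g' (1 - x) * indicator {0..1} (1 - x)) \<partial>lborel)"
  proof -
    have [measurable]: "g \<in> borel_measurable borel" "g' \<in> borel_measurable borel"
      unfolding g_def[abs_def] g'_def[abs_def] by measurable
    show ?thesis
      by (subst nn_integral_real_affine[where c = "-1" and t = 1]) auto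
  qed
  also have "\<dots> = (\<integral>\<^sup>+x. ennreal (F (gauss_branch k x) / (real k + 1 + x)\<^sup>2) * indicator {0..1} x \<partial>lborel)"
    by (intro nn_integral_cong) (auto simp: g_def g'_def gauss_branch_def indicator_def algebra_simps)
  finally show ?thesis .
qed

lemma gauss_map_gauss_branch:
  assumes "x \<in> {0<..<1}"
  shows "gauss_map (gauss_branch k x) = x"
proof -
  have "frac (real k + 1 + x) = x"
    using assms by (subst frac_unique_iff) (auto intro!: Ints_add)
  then show ?thesis using assms by (simp add: gauss_map_def gauss_branch_def)
qed

text \<open>The only interval containing \<open>y\<close> is the one for which k + 1 is the integer
  part of 1 / y, the first continued fraction digit.\<close>

lemma unit_interval_split:
  fixes y :: real
  assumes "0 < y" "y < 1"
  shows "(\<Sum>k. indicator {1 / (real k + 2)<..1 / (real k + 1)} y :: ennreal) = 1"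
proof -
  define n where "n = nat (\<lfloor>1 / y\<rfloor> - 1)"
  have "\<lfloor>1 / y\<rfloor> \<ge> 1" using assms by (simp add: le_floor_iff)
  then have n: "real n = of_int \<lfloor>1 / y\<rfloor> - 1" by (simp add: n_def)
  have *: "y \<in> {1 / (real k + 2)<..1 / (real k + 1)} \<longleftrightarrow> k = n" for k
  proof -
    have "y \<in> {1 / (real k + 2)<..1 / (real k + 1)} \<longleftrightarrow> real k + 1 \<le> 1 / y \<and> 1 / y < real k + 2"
      using assms by (auto simp: field_simps)
    also have "\<dots> \<longleftrightarrow> \<lfloor>1 / y\<rfloor> = int k + 1" by (subst floor_eq_iff) auto
    also have "\<dots> \<longleftrightarrow> k = n" using n by linarith
    finally show ?thesis .
  qed
  have "(\<Sum>k. indicator {1 / (real k + 2)<..1 / (real k + 1)} y :: ennreal) =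
      (\<Sum>k. if k = n then 1 else 0)"
    by (intro suminf_cong) (use * in \<open>auto simp: indicator_def\<close>)
  also have "\<dots> = 1" using sums_unique[OF sums_single[of n "\<lambda>_. 1::ennreal"]] by simp
  finally show ?thesis .
qed

text \<open>The integral is split according to the first digit, and on each piece the variable is
  the image point. The density at the branch point times the Jacobian equals the density at
  \<open>x\<close> times \<open>digit_prob k x\<close>.\<close>

lemma nn_transfer_duality:
  fixes f g :: "real \<Rightarrow> real"
  assumes [measurable]: "f \<in> borel_measurable borel" "g \<in> borel_measurable borel"
    and nonneg: "\<And>x. f x \<ge> 0" "\<And>x. g x \<ge> 0"
  shows "(\<integral>\<^sup>+y. ennreal (f y * g (gauss_map y)) \<partial>gauss_measure) =
    (\<integral>\<^sup>+x. (\<Sum>k. ennreal (digit_prob k x * f (gauss_branch k x))) * ennreal (g x) \<partial>gauss_measure)"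
proof -
  define F where "F y = f y * g (gauss_map y) / (ln 2 * (1 + y))" for y
  have [measurable]: "F \<in> borel_measurable borel" unfolding F_def[abs_def] by measurable
  let ?I = "\<lambda>k. {1 / (real k + 2)<..1 / (real k + 1)}"
  have "(\<integral>\<^sup>+y. ennreal (f y * g (gauss_map y)) \<partial>gauss_measure) =
      (\<integral>\<^sup>+y. ennreal (F y) * indicator {0<..<1} y \<partial>lborel)"
    by (subst nn_integral_gauss_measure)
      (auto intro!: nn_integral_cong simp: F_def gauss_density_def indicator_def nonneg
        simp flip: ennreal_mult)
  also have "\<dots> = (\<integral>\<^sup>+y. (\<Sum>k. ennreal (F y) * indicator (?I k) y) \<partial>lborel)"
  proof (rule nn_integral_cong_AE)
    show "AE y in lborel. ennreal (F y) * indicator {0<..<1} y = (\<Sum>k. ennreal (F y) * indicator (?I k) y)"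
      using AE_lborel_singleton[of 1]
    proof eventually_elim
      case (elim y)
      show ?case
      proof (cases "0 < y \<and> y < 1")
        case True
        then show ?thesis by (simp add: unit_interval_split)
      next
        case False
        have "y \<notin> ?I k" for k
        proof
          assume "y \<in> ?I k"
          then have "y > 1 / (real k + 2)" "y \<le> 1 / (real k + 1)" by auto
          moreover have "1 / (real k + 2) > 0" "1 / (real k + 1) \<le> 1" by auto
          ultimately have "0 < y" "y \<le> 1" by linarith+
          with False elim show False by simp
        qed
        then have "(\<Sum>k. ennreal (F y) * indicator (?I k) y) = 0" by (simp del: greaterThanAtMost_iff)
        moreover have "ennreal (F y) * indicator {0<..<1} y = 0" using False by auto
        ultimately show ?thesis by (simp only:)
      qed
    qed
  qed
  also have "\<dots> = (\<Sum>k. \<integral>\<^sup>+y. ennreal (F y) * indicator (?I k) y \<partial>lborel)"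
    by (rule nn_integral_suminf) auto
  also have "\<dots> = (\<Sum>k. \<integral>\<^sup>+x. ennreal (gauss_density x) *
      (ennreal (digit_prob k x * f (gauss_branch k x)) * ennreal (g x)) \<partial>lborel)"
  proof (rule suminf_cong)
    fix k
    have "(\<integral>\<^sup>+y. ennreal (F y) * indicator (?I k) y \<partial>lborel) =
        (\<integral>\<^sup>+y. ennreal (F y) * indicator {1 / (real k + 2)..1 / (real k + 1)} y \<partial>lborel)"
    proof (rule nn_integral_cong_AE)
      show "AE y in lborel. ennreal (F y) * indicator (?I k) y =
          ennreal (F y) * indicator {1 / (real k + 2)..1 / (real k + 1)} y"
        using AE_lborel_singleton[of "1 / (real k + 2)"]
        by eventually_elim (auto simp: indicator_def)
    qed
    also have "\<dots> = (\<integral>\<^sup>+x. ennreal (F (gauss_branch k x) / (real k + 1 + x)\<^sup>2) * indicator {0..1} x \<partial>lborel)"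
      by (rule nn_integral_gauss_branch) measurable
    also have "\<dots> = (\<integral>\<^sup>+x. ennreal (gauss_density x) *
      (ennreal (digit_prob k x * f (gauss_branch k x)) * ennreal (g x)) \<partial>lborel)"
    proof (rule nn_integral_cong_AE)
      show "AE x in lborel. ennreal (F (gauss_branch k x) / (real k + 1 + x)\<^sup>2) * indicator {0..1} x =
          ennreal (gauss_density x) *
            (ennreal (digit_prob k x * f (gauss_branch k x)) * ennreal (g x))"
        using AE_lborel_singleton[of 0] AE_lborel_singleton[of 1]
      proof eventually_elim
        case (elim x)
        show ?case
        proof (cases "x \<in> {0..1}")
          case True
          with elim have x: "x \<in> {0<..<1}" by auto
          have "F (gauss_branch k x) / (real k + 1 + x)\<^sup>2 =
              f (gauss_branch k x) * g x / (ln 2 * (1 + gauss_branch k x) * (real k + 1 + x)\<^sup>2)"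
            by (simp add: F_def gauss_map_gauss_branch[OF x])
          also have "(1 + gauss_branch k x) * (real k + 1 + x)\<^sup>2 = (real k + 1 + x) * (real k + 2 + x)"
            using x by (simp add: gauss_branch_def field_simps power2_eq_square)
          then have "ln 2 * (1 + gauss_branch k x) * (real k + 1 + x)\<^sup>2 =
              ln 2 * ((real k + 1 + x) * (real k + 2 + x))" by (simp add: mult.assoc)
          also have "f (gauss_branch k x) * g x / (ln 2 * ((real k + 1 + x) * (real k + 2 + x))) =
              gauss_density x * (digit_prob k x * f (gauss_branch k x) * g x)"
          proof -
            have "gauss_density x * digit_prob k x = 1 / (ln 2 * ((real k + 1 + x) * (real k + 2 + x)))"
              using x by (simp add: gauss_density_def digit_prob_def)
            then show ?thesis by (simp add: mult.assoc[symmetric])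
          qed
          finally have "F (gauss_branch k x) / (real k + 1 + x)\<^sup>2 = \<dots>" .
          then show ?thesis
            using x digit_prob_nonneg[of x k] nonneg gauss_density_nonneg[of x]
            by (simp add: ennreal_mult)
        qed (auto simp: gauss_density_def)
      qed
    qed
    finally show "(\<integral>\<^sup>+y. ennreal (F y) * indicator (?I k) y \<partial>lborel) = \<dots>" .
  qed
  also have "\<dots> = (\<integral>\<^sup>+x. (\<Sum>k. ennreal (gauss_density x) *
      (ennreal (digit_prob k x * f (gauss_branch k x)) * ennreal (g x))) \<partial>lborel)"
    by (rule nn_integral_suminf[symmetric]) measurable
  also have "\<dots> = (\<integral>\<^sup>+x. ennreal (gauss_density x) *
      ((\<Sum>k. ennreal (digit_prob k x * f (gauss_branch k x))) * ennreal (g x)) \<partial>lborel)"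
    by simp
  also have "\<dots> = (\<integral>\<^sup>+x. (\<Sum>k. ennreal (digit_prob k x * f (gauss_branch k x))) * ennreal (g x) \<partial>gauss_measure)"
    by (rule nn_integral_gauss_measure[symmetric]) measurable
  finally show ?thesis .
qed

text \<open>Invariance is the duality for the constant function 1, because the digit probabilities
  add up to 1.\<close>

interpretation gauss: mps gauss_measure gauss_map
proof (intro mps.intro mps_axioms.intro prob_space_gauss_measure)
  show "gauss_map \<in> gauss_measure \<rightarrow>\<^sub>M gauss_measure" by measurable
  fix A assume "A \<in> sets gauss_measure"
  then have [measurable]: "A \<in> sets borel" by simp
  have "emeasure gauss_measure (gauss_map -` A) =
      (\<integral>\<^sup>+y. indicator (gauss_map -` A) y \<partial>gauss_measure)"
    using measurable_sets[OF measurable_gauss_map \<open>A \<in> sets borel\<close>] by simp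
  also have "\<dots> = (\<integral>\<^sup>+y. ennreal (1 * indicator A (gauss_map y)) \<partial>gauss_measure)"
    by (intro nn_integral_cong) (auto simp: indicator_def)
  also have "\<dots> = (\<integral>\<^sup>+x. (\<Sum>k. ennreal (digit_prob k x * 1)) * ennreal (indicator A x) \<partial>gauss_measure)"
    by (rule nn_transfer_duality) auto
  also have "\<dots> = (\<integral>\<^sup>+x. indicator A x \<partial>gauss_measure)"
  proof (rule nn_integral_cong_AE)
    show "AE x in gauss_measure. (\<Sum>k. ennreal (digit_prob k x * 1)) * ennreal (indicator A x) =
        indicator A x"
      using AE_gauss_measure_range
    proof eventually_elim
      case (elim x)
      then have "(\<Sum>k. ennreal (digit_prob k x)) = ennreal 1"
        using digit_prob_sums[of x] digit_prob_nonneg[of x]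
        by (subst suminf_ennreal2) (auto simp: sums_iff)
      then show ?case by (simp add: indicator_def)
    qed
  qed
  also have "\<dots> = emeasure gauss_measure A" by simp
  finally show "emeasure gauss_measure (gauss_map -` A \<inter> space gauss_measure) = emeasure gauss_measure A"
    by simp
qed

text \<open>The transfer operator with respect to the invariant measure: the conditional mean of
  \<open>f\<close> over the preimages of \<open>x\<close>. The endpoints are kept because the
  oscillation is measured by the values at 0 and 1.\<close>

definition transfer :: "(real \<Rightarrow> real) \<Rightarrow> real \<Rightarrow> real" where
  "transfer f x = indicator {0..1} x * (\<Sum>k. digit_prob k x * f (gauss_branch k x))"

lemma measurable_transfer [measurable]:
  assumes [measurable]: "f \<in> borel_measurable borel"
  shows "transfer f \<in> borel_measurable borel"
  unfolding transfer_def[abs_def] by measurable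

lemma summable_digit_prob:
  assumes "x \<ge> 0" and "\<And>k. \<bar>v k\<bar> \<le> B"
  shows "summable (\<lambda>k. digit_prob k x * v k)"
proof (rule summable_comparison_test')
  show "summable (\<lambda>k. digit_prob k x * B)"
    using digit_prob_sums[OF \<open>x \<ge> 0\<close>] by (intro summable_mult2) (rule sums_summable)
  show "norm (digit_prob k x * v k) \<le> digit_prob k x * B" for k
    using digit_prob_nonneg[OF \<open>x \<ge> 0\<close>] assms(2) by (simp add: abs_mult mult_left_mono)
qed

context
  fixes f :: "real \<Rightarrow> real" and B :: real
  assumes bdd: "\<And>x. \<bar>f x\<bar> \<le> B"
begin

lemma summable_transfer: "x \<ge> 0 \<Longrightarrow> summable (\<lambda>k. digit_prob k x * f (gauss_branch k x))"
  by (rule summable_digit_prob) (use bdd in auto)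

lemma transfer_mono:
  assumes x: "x \<in> {0..1}" and le: "\<And>k. f (gauss_branch k x) \<le> c"
  shows "transfer f x \<le> c"
proof -
  have "(\<Sum>k. digit_prob k x * f (gauss_branch k x)) \<le> (\<Sum>k. digit_prob k x * c)"
    using x digit_prob_sums[of x]
    by (intro suminf_le summable_transfer summable_mult2 mult_left_mono le digit_prob_nonneg)
      (auto simp: sums_iff)
  also have "\<dots> = c"
    using sums_mult2[OF digit_prob_sums[of x], of c] x by (auto simp: sums_iff)
  finally show ?thesis using x by (simp add: transfer_def)
qed

lemma transfer_add_const: "x \<in> {0..1} \<Longrightarrow> transfer (\<lambda>y. f y + c) x = transfer f x + c"
  using sums_mult2[OF digit_prob_sums[of x], of c] summable_transfer[of x]
  by (simp add: transfer_def distrib_left suminf_add[symmetric] sums_iff)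

lemma transfer_uminus: "x \<in> {0..1} \<Longrightarrow> transfer (\<lambda>y. - f y) x = - transfer f x"
  using summable_transfer[of x] by (simp add: transfer_def suminf_minus)

end

lemma transfer_bound:
  assumes bdd: "\<And>x. \<bar>f x\<bar> \<le> B"
  shows "\<bar>transfer f x\<bar> \<le> B"
proof (cases "x \<in> {0..1}")
  case True
  have le: "f y \<le> B" "- f y \<le> B" for y using bdd[of y] by auto
  have bdd': "\<bar>- f y\<bar> \<le> B" for y using bdd[of y] by auto
  have "transfer f x \<le> B" by (rule transfer_mono[OF bdd True le(1)])
  moreover have "transfer (\<lambda>y. - f y) x \<le> B" by (rule transfer_mono[OF bdd' True le(2)])
  ultimately show ?thesis using transfer_uminus[OF bdd True] by simp
next
  case False
  then show ?thesis using order_trans[OF abs_ge_zero bdd] by (simp add: transfer_def)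
qed

lemma gauss_integrable_bounded:
  fixes f :: "real \<Rightarrow> real"
  assumes "f \<in> borel_measurable borel" "\<And>x. \<bar>f x\<bar> \<le> B"
  shows "integrable gauss_measure f"
  using assms by (intro gauss.integrable_const_bound[of _ B]) auto

text \<open>Adding constants makes bounded functions nonnegative, first \<open>g\<close> and then
  \<open>f\<close>. The constant added to \<open>f\<close> is harmless because the operator fixes
  constants and the measure is invariant.\<close>

lemma transfer_duality:
  fixes f g :: "real \<Rightarrow> real"
  assumes [measurable]: "f \<in> borel_measurable borel" "g \<in> borel_measurable borel"
    and f: "\<And>x. \<bar>f x\<bar> \<le> B" and g: "\<And>x. \<bar>g x\<bar> \<le> C"
  shows "(\<integral>y. f y * g (gauss_map y) \<partial>gauss_measure) = (\<integral>x. transfer f x * g x \<partial>gauss_measure)"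
proof -
  have nonneg: "(\<integral>y. f y * g (gauss_map y) \<partial>gauss_measure) = (\<integral>x. transfer f x * g x \<partial>gauss_measure)"
    if [measurable]: "f \<in> borel_measurable borel" "g \<in> borel_measurable borel"
      and f: "\<And>x. \<bar>f x\<bar> \<le> B" and nn: "\<And>x. 0 \<le> f x" "\<And>x. 0 \<le> g x" for f g B
  proof -
    have "(\<integral>\<^sup>+y. ennreal (f y * g (gauss_map y)) \<partial>gauss_measure) =
        (\<integral>\<^sup>+x. ennreal (transfer f x * g x) \<partial>gauss_measure)"
      unfolding nn_transfer_duality[OF that(1,2) nn]
    proof (rule nn_integral_cong_AE)
      show "AE x in gauss_measure. (\<Sum>k. ennreal (digit_prob k x * f (gauss_branch k x))) * ennreal (g x) =
          ennreal (transfer f x * g x)"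
        using AE_gauss_measure_range
      proof eventually_elim
        case (elim x)
        then have "(\<Sum>k. ennreal (digit_prob k x * f (gauss_branch k x))) = ennreal (transfer f x)"
          using summable_transfer[of f B x, OF f] digit_prob_nonneg[of x] nn
          by (subst suminf_ennreal2) (auto simp: transfer_def)
        then show ?case using nn by (simp add: ennreal_mult'')
      qed
    qed
    moreover have "0 \<le> transfer f x" for x
      unfolding transfer_def indicator_def
      using nn digit_prob_nonneg[of x] summable_transfer[of f B x, OF f]
      by (auto intro!: suminf_nonneg)
    ultimately show ?thesis
      using nn by (subst (1 2) integral_eq_nn_integral) auto
  qed
  have nonneg_left: "(\<integral>y. f y * g (gauss_map y) \<partial>gauss_measure) = (\<integral>x. transfer f x * g x \<partial>gauss_measure)"
    if [measurable]: "f \<in> borel_measurable borel" and f: "\<And>x. \<bar>f x\<bar> \<le> B" and nn: "\<And>x. 0 \<le> f x" for f B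
  proof -
    have C: "C \<ge> 0" using order_trans[OF abs_ge_zero g] .
    have gC: "g x + C \<ge> 0" "\<bar>g x + C\<bar> \<le> 2 * C" for x using g[of x] by auto
    have B: "B \<ge> 0" using order_trans[OF abs_ge_zero f] .
    have "(\<integral>y. f y * (g (gauss_map y) + C) \<partial>gauss_measure) = (\<integral>x. transfer f x * (g x + C) \<partial>gauss_measure)"
      by (rule nonneg[where g = "\<lambda>x. g x + C", OF _ _ f nn]) (use gC in auto)
    moreover have "(\<integral>y. f y * C \<partial>gauss_measure) = (\<integral>x. transfer f x * C \<partial>gauss_measure)"
      by (rule nonneg[where g = "\<lambda>x. C", OF _ _ f nn]) (use C in auto)
    moreover have "integrable gauss_measure (\<lambda>y. f y * g (gauss_map y))"
      "integrable gauss_measure (\<lambda>x. transfer f x * g x)"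
      by (rule gauss_integrable_bounded[where B = "B * C"];
          use f g B C transfer_bound[of f B, OF f] in \<open>simp add: abs_mult mult_mono\<close>)+
    moreover have "integrable gauss_measure f" "integrable gauss_measure (transfer f)"
      by (rule gauss_integrable_bounded[where B = B]; use f transfer_bound[of f B, OF f] in simp)+
    ultimately show ?thesis by (cases "C = 0") (auto simp: distrib_left)
  qed
  have fB: "f x + B \<ge> 0" "\<bar>f x + B\<bar> \<le> 2 * B" for x using f[of x] by auto
  have B: "B \<ge> 0" using order_trans[OF abs_ge_zero f] .
  have C: "C \<ge> 0" using order_trans[OF abs_ge_zero g] .
  have "(\<integral>y. (f y + B) * g (gauss_map y) \<partial>gauss_measure) =
      (\<integral>x. transfer (\<lambda>y. f y + B) x * g x \<partial>gauss_measure)"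
    by (rule nonneg_left[where f = "\<lambda>y. f y + B", OF _ fB(2) fB(1)]) simp
  also have "\<dots> = (\<integral>x. (transfer f x + B) * g x \<partial>gauss_measure)"
  proof (rule integral_cong_AE)
    show "AE x in gauss_measure. transfer (\<lambda>y. f y + B) x * g x = (transfer f x + B) * g x"
      using AE_gauss_measure_range
      by eventually_elim (subst transfer_add_const[of f B, OF f], auto)
  qed auto
  finally have "(\<integral>y. (f y + B) * g (gauss_map y) \<partial>gauss_measure) =
      (\<integral>x. (transfer f x + B) * g x \<partial>gauss_measure)" .
  moreover have "(\<integral>y. g (gauss_map y) \<partial>gauss_measure) = (\<integral>y. g y \<partial>gauss_measure)"
    using gauss.integral_funpow[of g 1] by simp
  moreover have "integrable gauss_measure (\<lambda>y. f y * g (gauss_map y))"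
    "integrable gauss_measure (\<lambda>x. transfer f x * g x)"
    by (rule gauss_integrable_bounded[where B = "B * C"];
        use f g B C transfer_bound[of f B, OF f] in \<open>simp add: abs_mult mult_mono\<close>)+
  moreover have "integrable gauss_measure g" "integrable gauss_measure (\<lambda>y. g (gauss_map y))"
    by (rule gauss_integrable_bounded[where B = C]; use g in simp)+
  ultimately show ?thesis by (simp add: distrib_right)
qed

text \<open>As \<open>x\<close> grows, the digits grow stochastically, so that the inverse branches decrease.\<close>

lemma transfer_antimono:
  assumes bdd: "\<And>x. \<bar>f x\<bar> \<le> B" and mono: "mono_on {0..1} f"
    and x: "0 \<le> x" "x \<le> x'" "x' \<le> 1"
  shows "transfer f x' \<le> transfer f x"
proof -
  define v where "v k = f (gauss_branch k x')" for k
  define d where "d k = digit_prob k x - digit_prob k x'" for k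
  \<comment> \<open>The difference of the two digit distribution functions. Its nonnegativity says
    that the digits at \<open>x'\<close> are stochastically larger.\<close>
  define D where "D n = real n / (real n + 1 + x) - real n / (real n + 1 + x')" for n
  have D: "(\<Sum>k<n. d k) = D n" for n
    using x by (simp add: d_def D_def sum_subtractf sum_digit_prob)
  have D_nonneg: "D n \<ge> 0" for n
    unfolding D_def using x by (simp add: frac_le)
  have v_anti: "v (Suc k) \<le> v k" for k
    unfolding v_def
    by (rule mono_onD[OF mono]) (use x in \<open>auto simp: gauss_branch_def frac_le\<close>)
  \<comment> \<open>Summation by parts against the nonincreasing \<open>v\<close>; the right-hand
    side is the boundary term, which vanishes in the limit.\<close>
  have sum_ge: "(\<Sum>k<Suc n. d k * v k) \<ge> D (Suc n) * v n" for n
  proof (induction n)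
    case 0
    then show ?case using D[of 1] by simp
  next
    case (Suc n)
    have "D (Suc (Suc n)) * v (Suc n) = D (Suc n) * v (Suc n) + d (Suc n) * v (Suc n)"
      by (simp flip: D add: algebra_simps)
    also have "\<dots> \<le> D (Suc n) * v n + d (Suc n) * v (Suc n)"
      by (intro add_right_mono mult_left_mono v_anti D_nonneg)
    also have "\<dots> \<le> (\<Sum>k<Suc (Suc n). d k * v k)" using Suc by simp
    finally show ?case .
  qed
  have s: "summable (\<lambda>k. digit_prob k x * v k)" "summable (\<lambda>k. digit_prob k x' * v k)"
    using x bdd by (intro summable_digit_prob[where B = B]; simp add: v_def)+
  then have sd: "(\<lambda>n. \<Sum>k<Suc n. d k * v k) \<longlonglongrightarrow>
      (\<Sum>k. digit_prob k x * v k) - (\<Sum>k. digit_prob k x' * v k)"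
    unfolding d_def left_diff_distrib
    by (intro filterlim_compose[OF _ filterlim_Suc] sums_diff[unfolded sums_def]
        summable_sums[unfolded sums_def])
  have "(\<lambda>n. D (Suc n) * v n) \<longlonglongrightarrow> 0"
  proof (rule Lim_null_comparison)
    show "\<forall>\<^sub>F n in sequentially. norm (D (Suc n) * v n) \<le> D (Suc n) * B"
      using D_nonneg bdd by (simp add: abs_mult v_def mult_left_mono)
    show "(\<lambda>n. D (Suc n) * B) \<longlonglongrightarrow> 0"
      unfolding D_def by real_asymp
  qed
  from LIMSEQ_le[OF this sd] sum_ge
  have "(\<Sum>k. digit_prob k x' * v k) \<le> (\<Sum>k. digit_prob k x * v k)" by force
  \<comment> \<open>So far only the digit law was changed. Now the law at \<open>x\<close> is kept
    and each branch point moves up from its position for \<open>x'\<close>.\<close>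
  also have "\<dots> \<le> (\<Sum>k. digit_prob k x * f (gauss_branch k x))"
  proof (intro suminf_le s summable_transfer[OF bdd] mult_left_mono digit_prob_nonneg)
    show "v k \<le> f (gauss_branch k x)" for k
      unfolding v_def
      by (rule mono_onD[OF mono]) (use x in \<open>auto simp: gauss_branch_def frac_le\<close>)
  qed (use x in auto)
  finally show ?thesis using x by (simp add: transfer_def v_def)
qed

text \<open>At 0, digit index 0 leads to the point 1 with probability 1/2, and the remaining indices
  repeat the branches at 1 with half their probabilities. Hence \<open>transfer f 0\<close> is the
  mean of \<open>f 1\<close> and \<open>transfer f 1\<close>, and \<open>transfer f 1\<close> is at
  least \<open>f 0\<close>.\<close>

lemma transfer_oscillation:
  assumes bdd: "\<And>x. \<bar>f x\<bar> \<le> B" and mono: "mono_on {0..1} f"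
  shows "transfer f 0 - transfer f 1 \<le> (f 1 - f 0) / 2"
proof -
  have dp: "digit_prob (Suc k) 0 = digit_prob k 1 / 2" "gauss_branch (Suc k) 0 = gauss_branch k 1" for k
    by (simp_all add: digit_prob_def gauss_branch_def add_ac)
  have "transfer f 0 = (\<Sum>k. digit_prob k 0 * f (gauss_branch k 0))"
    by (simp add: transfer_def)
  also have "\<dots> = (\<Sum>k. digit_prob (Suc k) 0 * f (gauss_branch (Suc k) 0)) +
      digit_prob 0 0 * f (gauss_branch 0 0)"
    using suminf_split_head[OF summable_transfer[of f B 0, OF bdd]] by simp
  also have "(\<Sum>k. digit_prob (Suc k) 0 * f (gauss_branch (Suc k) 0)) =
      (\<Sum>k. (digit_prob k 1 * f (gauss_branch k 1)) / 2)"
    unfolding dp by simp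
  also have "\<dots> = transfer f 1 / 2"
    using suminf_divide[OF summable_transfer[of f B 1, OF bdd], of 2] by (simp add: transfer_def)
  also have "digit_prob 0 0 * f (gauss_branch 0 0) = f 1 / 2"
    by (simp add: digit_prob_def gauss_branch_def)
  finally have "transfer f 0 = transfer f 1 / 2 + f 1 / 2" .
  moreover have "f 0 \<le> transfer f 1"
  proof -
    have bdd': "\<bar>- f x\<bar> \<le> B" for x using bdd[of x] by simp
    have "f 0 \<le> f (gauss_branch k 1)" for k
      by (rule mono_onD[OF mono]) (auto simp: gauss_branch_def)
    then have "transfer (\<lambda>x. - f x) 1 \<le> - f 0"
      by (intro transfer_mono[of "\<lambda>x. - f x" B, OF bdd']) auto
    then show ?thesis using transfer_uminus[of f B 1, OF bdd] by simp
  qed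
  ultimately show ?thesis by (simp add: field_simps)
qed

text \<open>One step of time replaces \<open>f\<close> by \<open>- transfer f\<close>. The sign
  restores monotonicity, the mean stays 0 and the oscillation is at least halved. \<open>H\<close>
  carries no regularity, so it can encode all later factors at once.\<close>

lemma gauss_mixing:
  fixes f H :: "real \<Rightarrow> real"
  assumes "f \<in> borel_measurable borel" "\<And>x. \<bar>f x\<bar> \<le> B" "mono_on {0..1} f"
    and "(\<integral>x. f x \<partial>gauss_measure) = 0"
    and H [measurable]: "H \<in> borel_measurable borel" and H1: "\<And>x. \<bar>H x\<bar> \<le> 1"
  shows "\<bar>\<integral>x. f x * H ((gauss_map ^^ m) x) \<partial>gauss_measure\<bar> \<le> (f 1 - f 0) / 2 ^ m"
  using assms(1-4)
proof (induction m arbitrary: f)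
  case 0
  note [measurable] = 0(1)
  have int: "integrable gauss_measure f" by (rule gauss_integrable_bounded[OF 0(1,2)])
  \<comment> \<open>Mean 0 forces \<open>f 0 \<le> 0 \<le> f 1\<close>, so the oscillation bounds
    the absolute value of \<open>f\<close> on the unit interval.\<close>
  have range: "f 0 \<le> f x" "f x \<le> f 1" if "x \<in> {0<..<1}" for x
    using that mono_onD[OF 0(3), of 0 x] mono_onD[OF 0(3), of x 1] by auto
  have "f 0 \<le> (\<integral>x. f x \<partial>gauss_measure)"
    by (rule gauss.integral_ge_const[OF int]) (use AE_gauss_measure_range range in auto)
  moreover have "(\<integral>x. f x \<partial>gauss_measure) \<le> f 1"
    by (rule gauss.integral_le_const[OF int]) (use AE_gauss_measure_range range in auto)
  ultimately have f01: "f 0 \<le> 0" "0 \<le> f 1" using 0(4) by auto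
  have i2: "integrable gauss_measure (\<lambda>x. f x * H x)"
    using mult_mono[OF 0(2) H1 order_trans[OF abs_ge_zero 0(2)] abs_ge_zero]
    by (intro gauss_integrable_bounded[of _ "B * 1"]) (auto simp: abs_mult)
  have "\<bar>\<integral>x. f x * H x \<partial>gauss_measure\<bar> \<le> (\<integral>x. \<bar>f x * H x\<bar> \<partial>gauss_measure)"
    by (rule integral_abs_bound)
  also have "\<dots> \<le> f 1 - f 0"
  proof (rule gauss.integral_le_const)
    show "AE x in gauss_measure. \<bar>f x * H x\<bar> \<le> f 1 - f 0"
      using AE_gauss_measure_range
    proof eventually_elim
      case (elim x)
      have "\<bar>f x * H x\<bar> \<le> \<bar>f x\<bar> * 1" using H1 by (simp add: abs_mult mult_left_le)
      also have "\<dots> \<le> f 1 - f 0" using range[OF elim] f01 by auto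
      finally show ?case .
    qed
  qed (use i2 in auto)
  finally show ?case by simp
next
  case (Suc m)
  note [measurable] = Suc(2)
  let ?g = "\<lambda>x. - transfer f x"
  have bdd: "\<bar>transfer f x\<bar> \<le> B" for x by (rule transfer_bound[OF Suc(3)])
  have dual: "(\<integral>y. f y * g (gauss_map y) \<partial>gauss_measure) = - (\<integral>x. ?g x * g x \<partial>gauss_measure)"
    if "g \<in> borel_measurable borel" "\<And>x. \<bar>g x\<bar> \<le> 1" for g
    using transfer_duality[OF Suc(2) that(1) Suc(3) that(2)] by simp
  have "(\<integral>x. ?g x \<partial>gauss_measure) = 0"
    using dual[of "\<lambda>_. 1"] Suc(5) by simp
  moreover have "mono_on {0..1} ?g"
    by (rule mono_onI) (auto intro!: transfer_antimono[OF Suc(3,4)])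
  ultimately have "\<bar>\<integral>x. ?g x * H ((gauss_map ^^ m) x) \<partial>gauss_measure\<bar> \<le> (?g 1 - ?g 0) / 2 ^ m"
    using bdd by (intro Suc(1)) auto
  also have "\<dots> \<le> ((f 1 - f 0) / 2) / 2 ^ m"
    using transfer_oscillation[OF Suc(3,4)] by (intro divide_right_mono) auto
  finally show ?case
    using dual[of "\<lambda>x. H ((gauss_map ^^ m) x)"] H1
    by (simp add: funpow_Suc_right del: funpow.simps(2))
qed

text \<open>A bound, at every point, on the chance of a hit given the image point. A branch inside
  the target contributes exactly \<open>w k - w (Suc k)\<close>, the others contribute nothing while
  \<open>w\<close> does not increase, and the telescoped total is \<open>w 0\<close>.\<close>

lemma transfer_indicator_lessThan:
  assumes "0 \<le> s" "x \<in> {0..1}"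
  shows "transfer (indicator {..<s}) x \<le> 2 * min 1 s"
proof -
  have bdd: "\<bar>indicator {..<s} x :: real\<bar> \<le> 1" for x by (simp add: indicator_def)
  define w where "w k = (1 + x) * min s (1 / (real k + 1 + x))" for k
  have "transfer (indicator {..<s}) x \<le> 1"
    using transfer_bound[of "indicator {..<s}" 1 x, OF bdd] by simp
  moreover have "transfer (indicator {..<s}) x \<le> 2 * s"
  proof -
    have term_le: "digit_prob k x * indicator {..<s} (gauss_branch k x) \<le> w k - w (Suc k)" for k
    proof (cases "gauss_branch k x < s")
      case True
      have "digit_prob k x = (1 + x) / (real k + 1 + x) - (1 + x) / (real k + 2 + x)"
        using assms by (simp add: digit_prob_def divide_simps) (simp add: algebra_simps)
      moreover have "1 / (real k + 2 + x) \<le> 1 / (real k + 1 + x)"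
        using assms by (simp add: frac_le)
      ultimately show ?thesis using True by (simp add: w_def gauss_branch_def min_def add_ac)
    next
      case False
      have "1 / (real (Suc k) + 1 + x) \<le> 1 / (real k + 1 + x)"
        using assms by (simp add: frac_le)
      then have "w (Suc k) \<le> w k" using assms unfolding w_def by (intro mult_left_mono) auto
      then show ?thesis using False by simp
    qed
    have "w \<longlonglongrightarrow> (1 + x) * min s 0"
      unfolding w_def by (intro tendsto_intros) real_asymp
    moreover have "(1 + x) * min s 0 = 0" using assms by simp
    ultimately have sums: "(\<lambda>k. w k - w (Suc k)) sums (w 0 - 0)"
      using telescope_sums'[of w 0] by simp
    have "(\<Sum>k. digit_prob k x * indicator {..<s} (gauss_branch k x)) \<le> w 0 - 0"
      using assms by (intro sums_le[OF term_le summable_sums sums] summable_transfer[OF bdd]) auto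
    then have "transfer (indicator {..<s}) x \<le> w 0 - 0"
      unfolding transfer_def using assms by simp
    also have "\<dots> \<le> 2 * s"
      using assms unfolding w_def by (auto intro!: mult_mono)
    finally show ?thesis .
  qed
  ultimately show ?thesis by (simp add: min_def)
qed

section \<open>Autocorrelations of the hits\<close>

lemma gauss_prob_UNIV [simp]: "measure gauss_measure UNIV = 1"
  using gauss.prob_space by simp

context
  fixes a b :: real
  assumes a: "0 < a" "a < 1 / 2" and b: "1 < b"
begin

text \<open>The maximum keeps the level positive at \<open>n = 0\<close>, where \<open>0 powr (- a) = 0\<close>.\<close>

definition hit_level :: "nat \<Rightarrow> real" where
  "hit_level n = b powr (real (max 1 n) powr (- a)) - 1"

definition hit_prob :: "nat \<Rightarrow> real" where
  "hit_prob n = measure gauss_measure {..<hit_level n}"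

definition hit_dev :: "nat \<Rightarrow> real \<Rightarrow> real" where
  "hit_dev n x = indicator {..<hit_level n} x - hit_prob n"

definition hit_dev_at :: "real \<Rightarrow> nat \<Rightarrow> real" where
  "hit_dev_at y n = hit_dev n ((gauss_map ^^ n) y)"

lemma hit_level_pos: "hit_level n > 0"
  using b by (simp add: hit_level_def)

lemma hit_level_antimono: "hit_level (Suc n) \<le> hit_level n"
  unfolding hit_level_def using a b by (auto intro!: powr_mono powr_mono2')

lemma hit_prob_eq: "hit_prob n = log 2 (1 + min 1 (hit_level n))"
  using emeasure_gauss_measure_lessThan[of "hit_level n"] hit_level_pos[of n]
  by (simp add: hit_prob_def measure_def)

lemma hit_prob_le_1: "hit_prob n \<le> 1"
  by (simp add: hit_prob_def gauss.prob_le_1)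

lemma hit_prob_pos: "hit_prob n > 0"
  using hit_level_pos[of n] by (simp add: hit_prob_eq)

lemma hit_prob_antimono: "hit_prob (Suc n) \<le> hit_prob n"
  unfolding hit_prob_def using hit_level_antimono[of n] by (intro gauss.finite_measure_mono) auto

lemma hit_prob_antimono': "n \<le> m \<Longrightarrow> hit_prob m \<le> hit_prob n"
  by (rule lift_Suc_antimono_le[of hit_prob, OF hit_prob_antimono])

text \<open>With t the capped level, t / 2 \<le> t / (1 + t) \<le> ln (1 + t) \<le> log 2 (1 + t).
  The cap is relevant at early times, where the level exceeds 1 if b is large.\<close>

lemma hit_level_le: "min 1 (hit_level n) \<le> 2 * hit_prob n"
proof -
  define t where "t = min 1 (hit_level n)"
  have t: "0 < t" "t \<le> 1" using hit_level_pos[of n] by (auto simp: t_def)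
  have "ln (1 / (1 + t)) \<le> 1 / (1 + t) - 1" using t by (intro ln_le_minus_one) auto
  then have "t / (1 + t) \<le> ln (1 + t)" using t by (simp add: ln_div field_simps)
  moreover have "t / 2 \<le> t / (1 + t)" using t by (intro divide_left_mono) auto
  moreover have "ln (1 + t) \<le> ln (1 + t) / ln 2"
    using t ln_2_less_1 by (simp add: le_divide_eq mult_left_le)
  ultimately show ?thesis unfolding hit_prob_eq t_def[symmetric] log_def by linarith
qed

text \<open>From b^w - 1 \<ge> w ln b. The minimum with 1 keeps the lower bound below the cap at
  1.\<close>

lemma hit_prob_ge:
  assumes "n \<ge> 1"
  shows "min 1 (ln b) / 2 * real n powr (- a) \<le> hit_prob n"
proof -
  let ?w = "real n powr (- a)"
  have w: "0 < ?w" "?w \<le> 1" using assms a by (auto simp: powr_minus_divide divide_le_eq ge_one_powr_ge_zero)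
  have "hit_level n = exp (?w * ln b) - 1"
    using b assms by (simp add: hit_level_def max_def powr_def[of b])
  then have "?w * ln b \<le> hit_level n"
    using exp_ge_add_one_self[of "?w * ln b"] by linarith
  moreover have "min 1 (ln b) * ?w \<le> 1" using w b by (intro mult_le_one) auto
  moreover have "min 1 (ln b) * ?w \<le> ?w * ln b" using w by (simp add: mult.commute)
  ultimately have "min 1 (ln b) * ?w \<le> min 1 (hit_level n)" by linarith
  also have "\<dots> \<le> 2 * hit_prob n" by (rule hit_level_le)
  finally show ?thesis by simp
qed

lemma measurable_hit_dev [measurable]: "hit_dev n \<in> borel_measurable borel"
  unfolding hit_dev_def[abs_def] by measurable

lemma measurable_hit_dev_at [measurable]: "(\<lambda>y. hit_dev_at y n) \<in> borel_measurable borel"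
  unfolding hit_dev_at_def by measurable

lemma abs_hit_dev: "\<bar>hit_dev n x\<bar> \<le> 1"
  using hit_prob_pos[of n] hit_prob_le_1[of n] by (simp add: hit_dev_def indicator_def)

lemma abs_hit_dev_at: "\<bar>hit_dev_at y n\<bar> \<le> 1"
  by (simp add: hit_dev_at_def abs_hit_dev)

lemma integral_hit_indicator:
  "(\<integral>y. indicator {..<hit_level n} ((gauss_map ^^ m) y) \<partial>gauss_measure) = hit_prob n"
  using gauss.integral_funpow[of "indicator {..<hit_level n} :: real \<Rightarrow> real" m]
  by (simp add: hit_prob_def)

text \<open>A product bound that holds even at adjacent times, where the additive error of the
  mixing estimate would swamp the product. The earlier hit is bounded pointwise through its
  conditional probability, so the later one keeps its exact mean.\<close>

lemma joint_hits:
  assumes "i < k"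
  shows "(\<integral>y. indicator {..<hit_level i} ((gauss_map ^^ i) y) * indicator {..<hit_level k} ((gauss_map ^^ k) y)
    \<partial>gauss_measure) \<le> 4 * hit_prob i * hit_prob k"
proof -
  let ?f = "indicator {..<hit_level i} :: real \<Rightarrow> real"
  let ?g = "indicator {..<hit_level k} :: real \<Rightarrow> real"
  obtain d where d: "k = Suc d + i" using assms less_iff_Suc_add add.commute by (metis add_Suc_right)
  let ?h = "\<lambda>y. ?g ((gauss_map ^^ d) y)"
  have f1: "\<bar>?f x\<bar> \<le> 1" for x by (simp add: indicator_def)
  have h1: "\<bar>?h x\<bar> \<le> 1" for x by (simp add: indicator_def)
  have "(\<integral>y. ?f ((gauss_map ^^ i) y) * ?g ((gauss_map ^^ k) y) \<partial>gauss_measure) =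
      (\<integral>y. (\<lambda>z. ?f z * ?g ((gauss_map ^^ Suc d) z)) ((gauss_map ^^ i) y) \<partial>gauss_measure)"
    unfolding d funpow_add by simp
  also have "\<dots> = (\<integral>z. ?f z * ?g ((gauss_map ^^ Suc d) z) \<partial>gauss_measure)"
    by (rule gauss.integral_funpow) measurable
  also have "\<dots> = (\<integral>z. ?f z * ?h (gauss_map z) \<partial>gauss_measure)"
    by (simp add: funpow_Suc_right del: funpow.simps)
  also have "\<dots> = (\<integral>x. transfer ?f x * ?h x \<partial>gauss_measure)"
    by (rule transfer_duality[OF _ _ f1 h1]) measurable
  also have "\<dots> \<le> (\<integral>x. 4 * hit_prob i * ?h x \<partial>gauss_measure)"
  proof (rule integral_mono_AE)
    show "integrable gauss_measure (\<lambda>x. transfer ?f x * ?h x)"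
      using transfer_bound[of ?f 1, OF f1]
      by (intro gauss_integrable_bounded[where B = 1]) (auto simp: indicator_def)
    show "integrable gauss_measure (\<lambda>x. 4 * hit_prob i * ?h x)"
      by (intro integrable_mult_right gauss_integrable_bounded[where B = 1]) (use h1 in auto)
    show "AE x in gauss_measure. transfer ?f x * ?h x \<le> 4 * hit_prob i * ?h x"
      using AE_gauss_measure_range
    proof eventually_elim
      case (elim x)
      have "transfer ?f x \<le> 2 * min 1 (hit_level i)"
        using elim hit_level_pos[of i] by (intro transfer_indicator_lessThan) auto
      then have "transfer ?f x \<le> 4 * hit_prob i" using hit_level_le[of i] by linarith
      then show ?case by (intro mult_right_mono) auto
    qed
  qed
  also have "\<dots> = 4 * hit_prob i * hit_prob k"
    using integral_hit_indicator[of k d] by simp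
  finally show ?thesis .
qed

text \<open>Each deviation is at most the indicator plus its mean. Expanding the product gives 4
  from the joint hits and 1 from each of the three other terms.\<close>

lemma integral_pair_le:
  assumes "i \<noteq> k"
  shows "(\<integral>y. \<bar>hit_dev_at y i * hit_dev_at y k\<bar> \<partial>gauss_measure) \<le> 7 * hit_prob i * hit_prob k"
proof -
  let ?X = "\<lambda>i y. indicator {..<hit_level i} ((gauss_map ^^ i) y) :: real"
  have X: "integrable gauss_measure (?X i)" for i
    by (rule gauss_integrable_bounded[where B = 1]) (auto simp: indicator_def)
  have XX: "integrable gauss_measure (\<lambda>y. ?X i y * ?X k y)"
    by (rule gauss_integrable_bounded[where B = 1]) (auto simp: indicator_def)
  have joint: "(\<integral>y. ?X i y * ?X k y \<partial>gauss_measure) \<le> 4 * hit_prob i * hit_prob k"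
    using joint_hits[of i k] joint_hits[of k i] assms
    by (cases "i < k") (auto simp: mult.commute mult.left_commute)
  have le: "\<bar>hit_dev_at y i * hit_dev_at y k\<bar> \<le>
      ?X i y * ?X k y + hit_prob i * ?X k y + hit_prob k * ?X i y + hit_prob i * hit_prob k" for y
  proof -
    have "\<bar>hit_dev_at y i\<bar> \<le> ?X i y + hit_prob i" for i
      using hit_prob_pos[of i] by (auto simp: hit_dev_at_def hit_dev_def indicator_def)
    then have "\<bar>hit_dev_at y i\<bar> * \<bar>hit_dev_at y k\<bar> \<le> (?X i y + hit_prob i) * (?X k y + hit_prob k)"
      using less_imp_le[OF hit_prob_pos] by (intro mult_mono) (auto intro: add_nonneg_nonneg)
    then show ?thesis by (simp add: abs_mult algebra_simps)
  qed
  have "(\<integral>y. \<bar>hit_dev_at y i * hit_dev_at y k\<bar> \<partial>gauss_measure) \<le>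
      (\<integral>y. ?X i y * ?X k y + hit_prob i * ?X k y + hit_prob k * ?X i y + hit_prob i * hit_prob k \<partial>gauss_measure)"
  proof (rule integral_mono[OF _ _ le])
    have "\<bar>\<bar>hit_dev_at y i * hit_dev_at y k\<bar>\<bar> \<le> 1" for y
      by (simp add: abs_mult mult_le_one abs_hit_dev_at)
    then show "integrable gauss_measure (\<lambda>y. \<bar>hit_dev_at y i * hit_dev_at y k\<bar>)"
      by (intro gauss_integrable_bounded[where B = 1]) auto
  qed (intro Bochner_Integration.integrable_add integrable_mult_right X XX; simp)
  also have "\<dots> = (\<integral>y. ?X i y * ?X k y \<partial>gauss_measure) + 3 * (hit_prob i * hit_prob k)"
    using X XX integral_hit_indicator by simp
  finally show ?thesis using joint by simp
qed

text \<open>The indicator of a half-line is nonincreasing, so \<open>gauss_mixing\<close> is applied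
  to the negative of the deviation, which has oscillation at most 1.\<close>

lemma integral_separated_le:
  assumes "i < j" and [measurable]: "H \<in> borel_measurable borel" and H: "\<And>x. \<bar>H x\<bar> \<le> 1"
  shows "\<bar>\<integral>y. hit_dev_at y i * H ((gauss_map ^^ j) y) \<partial>gauss_measure\<bar> \<le> 1 / 2 ^ (j - i)"
proof -
  have j: "j = (j - i) + i" using assms by simp
  have "(\<integral>y. hit_dev_at y i * H ((gauss_map ^^ j) y) \<partial>gauss_measure) =
      (\<integral>y. (\<lambda>z. hit_dev i z * H ((gauss_map ^^ (j - i)) z)) ((gauss_map ^^ i) y) \<partial>gauss_measure)"
    unfolding hit_dev_at_def by (subst j, subst funpow_add) simp
  also have "\<dots> = (\<integral>z. hit_dev i z * H ((gauss_map ^^ (j - i)) z) \<partial>gauss_measure)"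
    by (rule gauss.integral_funpow) measurable
  finally have eq: "(\<integral>y. hit_dev_at y i * H ((gauss_map ^^ j) y) \<partial>gauss_measure) =
      - (\<integral>z. - hit_dev i z * H ((gauss_map ^^ (j - i)) z) \<partial>gauss_measure)" by simp
  have "integrable gauss_measure (indicator {..<hit_level i} :: real \<Rightarrow> real)"
    by (rule gauss_integrable_bounded[where B = 1]) (auto simp: indicator_def)
  then have mean: "(\<integral>z. - hit_dev i z \<partial>gauss_measure) = 0"
    using integral_hit_indicator[of i 0] by (simp add: hit_dev_def)
  have "\<bar>\<integral>z. - hit_dev i z * H ((gauss_map ^^ (j - i)) z) \<partial>gauss_measure\<bar> \<le>
      (- hit_dev i 1 - - hit_dev i 0) / 2 ^ (j - i)"
  proof (rule gauss_mixing[where B = 1])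
    show "mono_on {0..1} (\<lambda>z. - hit_dev i z)"
      by (rule mono_onI) (auto simp: hit_dev_def indicator_def)
  qed (use mean in \<open>simp_all add: abs_hit_dev H\<close>)
  also have "\<dots> \<le> 1 / 2 ^ (j - i)"
    by (intro divide_right_mono) (auto simp: hit_dev_def indicator_def)
  finally show ?thesis unfolding eq by simp
qed

section \<open>Fourth moments of the hit deviations\<close>

definition four_point :: "nat \<Rightarrow> nat \<Rightarrow> nat \<Rightarrow> real" where
  "four_point h n m = (\<integral>y. hit_dev_at y n * hit_dev_at y (n + h) * (hit_dev_at y m * hit_dev_at y (m + h)) \<partial>gauss_measure)"

lemma four_point_commute: "four_point h n m = four_point h m n"
  unfolding four_point_def by (simp add: mult.commute)

text \<open>\<open>Z\<close> collects the factors at the two remaining times, which are simply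
  bounded by 1.\<close>

lemma abs_integral_le_pair:
  assumes [measurable]: "Z \<in> borel_measurable borel" and Z: "\<And>y. \<bar>Z y\<bar> \<le> 1" and "i \<noteq> k"
  shows "\<bar>\<integral>y. hit_dev_at y i * hit_dev_at y k * Z y \<partial>gauss_measure\<bar> \<le> 7 * hit_prob i * hit_prob k"
proof -
  have 1: "\<bar>hit_dev_at y i * hit_dev_at y k\<bar> \<le> 1" for y
    by (simp add: abs_mult mult_le_one abs_hit_dev_at)
  have 2: "\<bar>hit_dev_at y i * hit_dev_at y k * Z y\<bar> \<le> \<bar>hit_dev_at y i * hit_dev_at y k\<bar>" for y
    using Z[of y] by (simp only: abs_mult[of _ "Z y"] mult_left_le abs_ge_zero)
  have "\<bar>\<integral>y. hit_dev_at y i * hit_dev_at y k * Z y \<partial>gauss_measure\<bar> \<le>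
      (\<integral>y. \<bar>hit_dev_at y i * hit_dev_at y k * Z y\<bar> \<partial>gauss_measure)"
    by (rule integral_abs_bound)
  also have "\<dots> \<le> (\<integral>y. \<bar>hit_dev_at y i * hit_dev_at y k\<bar> \<partial>gauss_measure)"
    by (rule integral_mono[OF _ _ 2]; rule gauss_integrable_bounded[where B = 1])
      (use 1 order_trans[OF 2 1] in simp_all)
  also have "\<dots> \<le> 7 * hit_prob i * hit_prob k" by (rule integral_pair_le[OF \<open>i \<noteq> k\<close>])
  finally show ?thesis .
qed

text \<open>Time \<open>n\<close> precedes the three others by at least \<open>K\<close>, so they
  form a bounded function of the orbit point at the next time \<open>j\<close>.\<close>

lemma four_point_separated:
  assumes "n + K \<le> m" "K \<le> h" "1 \<le> K"
  shows "\<bar>four_point h n m\<bar> \<le> 1 / 2 ^ K"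
proof -
  define j where "j = min m (n + h)"
  have j: "n < j" "K \<le> j - n" "j \<le> m" "j \<le> n + h" "j \<le> m + h" using assms by (auto simp: j_def)
  define H where "H z = hit_dev (n + h) ((gauss_map ^^ (n + h - j)) z) *
      (hit_dev m ((gauss_map ^^ (m - j)) z) * hit_dev (m + h) ((gauss_map ^^ (m + h - j)) z))" for z
  have [measurable]: "H \<in> borel_measurable borel" unfolding H_def[abs_def] by measurable
  have H1: "\<bar>H z\<bar> \<le> 1" for z
    unfolding H_def abs_mult by (intro mult_le_one mult_nonneg_nonneg abs_hit_dev abs_ge_zero)
  have shift: "(gauss_map ^^ (l - j)) ((gauss_map ^^ j) y) = (gauss_map ^^ l) y" if "j \<le> l" for l y
    using that funpow_add[of "l - j" j gauss_map] by simp
  have "four_point h n m = (\<integral>y. hit_dev_at y n * H ((gauss_map ^^ j) y) \<partial>gauss_measure)"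
    unfolding four_point_def H_def using j by (simp add: shift hit_dev_at_def mult.assoc)
  also have "\<bar>\<dots>\<bar> \<le> 1 / 2 ^ (j - n)"
    by (rule integral_separated_le[OF j(1) _ H1]) measurable
  also have "\<dots> \<le> 1 / 2 ^ K" using j by (intro divide_left_mono power_increasing) auto
  finally show ?thesis .
qed

text \<open>The earliest time is isolated by a gap \<open>K\<close> unless the lag is short or
  \<open>n\<close> and \<open>m\<close> are close. In these two cases a pair of distinct times is
  kept, \<open>n\<close> and \<open>m\<close> for a short lag and \<open>n\<close> and
  \<open>n + h\<close> for close times, and the rest is discarded.\<close>

lemma four_point_le:
  assumes "1 \<le> h" "1 \<le> K"
  shows "\<bar>four_point h n m\<bar> \<le> 1 / 2 ^ K + (if h < K then 7 * hit_prob n * hit_prob m else 0) +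
    (if n < m + K \<and> m < n + K then 7 * hit_prob n * hit_prob h else 0)"
proof -
  note p = less_imp_le[OF hit_prob_pos]
  consider "n < m + K \<and> m < n + K" | "\<not> (n < m + K \<and> m < n + K)" "h < K"
    | "n + K \<le> m" "K \<le> h" | "m + K \<le> n" "K \<le> h" by linarith
  then show ?thesis
  proof cases
    case 1
    have "\<bar>four_point h n m\<bar> \<le> 7 * hit_prob n * hit_prob (n + h)"
      unfolding four_point_def
      by (rule abs_integral_le_pair)
        (use assms in \<open>auto simp: abs_mult intro!: mult_le_one abs_hit_dev_at\<close>)
    \<comment> \<open>Replacing \<open>n + h\<close> by \<open>h\<close> separates the variables, so
      that summation over \<open>n\<close> and \<open>h\<close> gives the square of
      \<open>cum_prob N\<close>.\<close>
    also have "\<dots> \<le> 7 * hit_prob n * hit_prob h"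
      using p by (intro mult_left_mono hit_prob_antimono') auto
    finally show ?thesis using 1 p by (simp add: add_nonneg_nonneg add_increasing)
  next
    case 2
    then have "n \<noteq> m" using assms by auto
    have "four_point h n m =
        (\<integral>y. hit_dev_at y n * hit_dev_at y m * (hit_dev_at y (n + h) * hit_dev_at y (m + h)) \<partial>gauss_measure)"
      unfolding four_point_def by (simp add: mult_ac)
    also have "\<bar>\<dots>\<bar> \<le> 7 * hit_prob n * hit_prob m"
      by (rule abs_integral_le_pair)
        (use \<open>n \<noteq> m\<close> in \<open>auto simp: abs_mult intro!: mult_le_one abs_hit_dev_at\<close>)
    finally show ?thesis using 2 by (auto intro: add_increasing)
  next
    case 3
    then show ?thesis using four_point_separated[OF 3 assms(2)] p by (auto intro!: add_increasing2)
  next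
    case 4
    then show ?thesis using four_point_separated[OF 4 assms(2)] p
      by (auto intro!: add_increasing2 simp: four_point_commute[of h n m])
  qed
qed

abbreviation cum_prob :: "nat \<Rightarrow> real" where
  "cum_prob N \<equiv> (\<Sum>n=1..N. hit_prob n)"

text \<open>The N^3 triples each pay 2^-K. Fewer than K short lags contribute 7 W_N^2 each; for
  close times each \<open>n\<close> has at most 2 K partners \<open>m\<close>, which gives 14 K
  W_N^2.\<close>

lemma integral_autocorrelation_square_sum:
  assumes "1 \<le> K"
  shows "(\<Sum>h=1..N. \<integral>y. (autocorrelation (hit_dev_at y) N h)\<^sup>2 \<partial>gauss_measure) \<le>
    real N ^ 3 / 2 ^ K + 21 * real K * (cum_prob N)\<^sup>2"
proof -
  note p = less_imp_le[OF hit_prob_pos]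
  let ?b = "\<lambda>h n m. 1 / 2 ^ K + (if h < K then 7 * hit_prob n * hit_prob m else 0) +
    (if n < m + K \<and> m < n + K then 7 * hit_prob n * hit_prob h else 0)"
  have b_nonneg: "?b h n m \<ge> 0" for h n m using p by (auto intro!: add_nonneg_nonneg)
  have square: "(\<integral>y. (autocorrelation (hit_dev_at y) N h)\<^sup>2 \<partial>gauss_measure) =
      (\<Sum>n=1..N - h. \<Sum>m=1..N - h. four_point h n m)" for h
  proof -
    have int: "integrable gauss_measure
        (\<lambda>y. hit_dev_at y n * hit_dev_at y (n + h) * (hit_dev_at y m * hit_dev_at y (m + h)))" for n m
      by (rule gauss_integrable_bounded[where B = 1])
        (auto simp: abs_mult intro!: mult_le_one abs_hit_dev_at mult_nonneg_nonneg)
    show ?thesis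
      unfolding autocorrelation_def power2_eq_square sum_product four_point_def using int by simp
  qed
  have "(\<Sum>h=1..N. \<integral>y. (autocorrelation (hit_dev_at y) N h)\<^sup>2 \<partial>gauss_measure) \<le>
      (\<Sum>h=1..N. \<Sum>n=1..N. \<Sum>m=1..N. ?b h n m)"
  proof (rule sum_mono)
    fix h assume "h \<in> {1..N}"
    have "(\<Sum>n=1..N - h. \<Sum>m=1..N - h. four_point h n m) \<le> (\<Sum>n=1..N - h. \<Sum>m=1..N - h. ?b h n m)"
      using \<open>h \<in> {1..N}\<close>
      by (intro sum_mono order_trans[OF abs_ge_self four_point_le[OF _ assms]]) auto
    also have "\<dots> \<le> (\<Sum>n=1..N - h. \<Sum>m=1..N. ?b h n m)"
      by (intro sum_mono sum_mono2 b_nonneg) auto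
    also have "\<dots> \<le> (\<Sum>n=1..N. \<Sum>m=1..N. ?b h n m)"
      by (intro sum_mono2 sum_nonneg b_nonneg) auto
    finally show "(\<integral>y. (autocorrelation (hit_dev_at y) N h)\<^sup>2 \<partial>gauss_measure) \<le> (\<Sum>n=1..N. \<Sum>m=1..N. ?b h n m)"
      unfolding square .
  qed
  also have "\<dots> = (\<Sum>h=1..N. \<Sum>n=1..N. \<Sum>m=1..N. 1 / 2 ^ K) +
      (\<Sum>h=1..N. \<Sum>n=1..N. \<Sum>m=1..N. (if h < K then 7 * hit_prob n * hit_prob m else 0)) +
      (\<Sum>h=1..N. \<Sum>n=1..N. \<Sum>m=1..N. (if n < m + K \<and> m < n + K then 7 * hit_prob n * hit_prob h else 0))"
    by (simp only: sum.distrib)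
  also have "(\<Sum>h=1..N. \<Sum>n=1..N. \<Sum>m=1..N. 1 / 2 ^ K :: real) = real N ^ 3 / 2 ^ K"
    by (simp add: power3_eq_cube)
  also have "(\<Sum>h=1..N. \<Sum>n=1..N. \<Sum>m=1..N. (if h < K then 7 * hit_prob n * hit_prob m else 0)) \<le>
      7 * real K * (cum_prob N)\<^sup>2"
  proof -
    have "(\<Sum>h=1..N. \<Sum>n=1..N. \<Sum>m=1..N. (if h < K then 7 * hit_prob n * hit_prob m else 0)) =
        (\<Sum>h=1..N. if h < K then 7 * (cum_prob N)\<^sup>2 else 0)"
    proof (rule sum.cong[OF refl])
      have "(\<Sum>n=1..N. \<Sum>m=1..N. 7 * hit_prob n * hit_prob m) =
          7 * (\<Sum>n=1..N. \<Sum>m=1..N. hit_prob n * hit_prob m)"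
        by (simp only: sum_distrib_left mult.assoc)
      also have "\<dots> = 7 * (cum_prob N)\<^sup>2" by (simp only: power2_eq_square sum_product)
      finally show "(\<Sum>n=1..N. \<Sum>m=1..N. (if h < K then 7 * hit_prob n * hit_prob m else 0)) =
          (if h < K then 7 * (cum_prob N)\<^sup>2 else 0)" for h by simp
    qed
    also have "\<dots> = real (card {h \<in> {1..N}. h < K}) * (7 * (cum_prob N)\<^sup>2)"
      by (simp add: sum.inter_filter[symmetric])
    also have "card {h \<in> {1..N}. h < K} \<le> card {..<K}" by (intro card_mono) auto
    then have "real (card {h \<in> {1..N}. h < K}) * (7 * (cum_prob N)\<^sup>2) \<le> real K * (7 * (cum_prob N)\<^sup>2)"
      by (intro mult_right_mono) auto
    finally show ?thesis by (simp add: mult_ac)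
  qed
  also have "(\<Sum>h=1..N. \<Sum>n=1..N. \<Sum>m=1..N. (if n < m + K \<and> m < n + K then 7 * hit_prob n * hit_prob h else 0)) \<le>
      14 * real K * (cum_prob N)\<^sup>2"
  proof -
    have "(\<Sum>m=1..N. (if n < m + K \<and> m < n + K then 7 * hit_prob n * hit_prob h else 0)) \<le>
        2 * real K * (7 * hit_prob n * hit_prob h)" for h n
    proof -
      have "(\<Sum>m=1..N. (if n < m + K \<and> m < n + K then 7 * hit_prob n * hit_prob h else 0)) =
          real (card {m \<in> {1..N}. n < m + K \<and> m < n + K}) * (7 * hit_prob n * hit_prob h)"
        by (simp add: sum.inter_filter[symmetric])
      also have "card {m \<in> {1..N}. n < m + K \<and> m < n + K} \<le> card {n - K..<n + K}"
        by (intro card_mono) auto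
      then have "real (card {m \<in> {1..N}. n < m + K \<and> m < n + K}) * (7 * hit_prob n * hit_prob h) \<le>
          2 * real K * (7 * hit_prob n * hit_prob h)"
        using p by (intro mult_right_mono) auto
      finally show ?thesis .
    qed
    then have "(\<Sum>h=1..N. \<Sum>n=1..N. \<Sum>m=1..N. (if n < m + K \<and> m < n + K then 7 * hit_prob n * hit_prob h else 0)) \<le>
        (\<Sum>h=1..N. \<Sum>n=1..N. 2 * real K * (7 * hit_prob n * hit_prob h))"
      by (intro sum_mono)
    also have "\<dots> = (\<Sum>h=1..N. \<Sum>n=1..N. 14 * real K * (hit_prob h * hit_prob n))"
      by (intro sum.cong refl) simp
    also have "\<dots> = 14 * real K * (\<Sum>h=1..N. \<Sum>n=1..N. hit_prob h * hit_prob n)"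
      by (simp only: sum_distrib_left)
    also have "\<dots> = 14 * real K * (cum_prob N)\<^sup>2" by (simp only: power2_eq_square sum_product)
    finally show ?thesis .
  qed
  finally show ?thesis by (simp add: algebra_simps)
qed

lemma integral_hit_dev_square: "(\<integral>y. (hit_dev_at y n)\<^sup>2 \<partial>gauss_measure) \<le> 2 * hit_prob n"
proof -
  let ?X = "\<lambda>y. indicator {..<hit_level n} ((gauss_map ^^ n) y) :: real"
  have X: "integrable gauss_measure ?X"
    by (rule gauss_integrable_bounded[where B = 1]) (auto simp: indicator_def)
  have "(\<integral>y. (hit_dev_at y n)\<^sup>2 \<partial>gauss_measure) \<le> (\<integral>y. ?X y + hit_prob n \<partial>gauss_measure)"
  proof (rule integral_mono)
    show "integrable gauss_measure (\<lambda>y. (hit_dev_at y n)\<^sup>2)"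
      by (rule gauss_integrable_bounded[where B = 1])
        (auto simp: abs_square_le_1 abs_hit_dev_at)
    show "(hit_dev_at y n)\<^sup>2 \<le> ?X y + hit_prob n" for y
    proof -
      have "(hit_dev_at y n)\<^sup>2 \<le> \<bar>hit_dev_at y n\<bar>"
        using mult_left_le[OF abs_hit_dev_at[of y n] abs_ge_zero[of "hit_dev_at y n"]]
        by (simp add: power2_eq_square)
      also have "\<dots> \<le> ?X y + hit_prob n"
        using hit_prob_pos[of n] by (auto simp: hit_dev_at_def hit_dev_def indicator_def)
      finally show ?thesis .
    qed
  qed (use X in simp)
  also have "\<dots> = 2 * hit_prob n"
    using X integral_hit_indicator[of n n] by simp
  finally show ?thesis .
qed

lemma measurable_autocorrelation_norm [measurable]:
  "(\<lambda>y. autocorrelation_norm (hit_dev_at y) N) \<in> borel_measurable borel"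
  unfolding autocorrelation_norm_def autocorrelation_def by measurable

text \<open>The inequality 2 |c| \<le> t + c^2 / t trades absolute values for second moments. A free
  \<open>t\<close> does the work of Cauchy-Schwarz over the lags.\<close>

lemma integral_autocorrelation_norm_le:
  assumes K: "1 \<le> K" and t: "0 < t"
  shows "integrable gauss_measure (\<lambda>y. autocorrelation_norm (hit_dev_at y) N)"
    and "(\<integral>y. autocorrelation_norm (hit_dev_at y) N \<partial>gauss_measure) \<le>
      2 * cum_prob N + real N * t + (real N ^ 3 / 2 ^ K + 21 * real K * (cum_prob N)\<^sup>2) / t"
proof -
  have prod_int: "integrable gauss_measure (\<lambda>y. hit_dev_at y n * hit_dev_at y m)" for n m
    by (rule gauss_integrable_bounded[where B = 1])
      (auto simp: abs_mult intro!: mult_le_one abs_hit_dev_at)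
  have int1: "integrable gauss_measure (\<lambda>y. (hit_dev_at y n)\<^sup>2)" for n
    unfolding power2_eq_square by (rule prod_int)
  have int2: "integrable gauss_measure (\<lambda>y. autocorrelation (hit_dev_at y) N h)" for h
    unfolding autocorrelation_def by (intro Bochner_Integration.integrable_sum prod_int)
  have int3: "integrable gauss_measure (\<lambda>y. (autocorrelation (hit_dev_at y) N h)\<^sup>2)" for h
    unfolding autocorrelation_def power2_eq_square sum_product
    by (intro Bochner_Integration.integrable_sum gauss_integrable_bounded[where B = 1])
      (auto simp: abs_mult intro!: mult_le_one abs_hit_dev_at mult_nonneg_nonneg)
  show int: "integrable gauss_measure (\<lambda>y. autocorrelation_norm (hit_dev_at y) N)"
    unfolding autocorrelation_norm_def using int1 int2 by simp
  have am_gm: "2 * \<bar>c\<bar> \<le> t + c\<^sup>2 / t" for c :: real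
  proof -
    have "2 * t * \<bar>c\<bar> \<le> t\<^sup>2 + c\<^sup>2" using sum_squares_bound[of t "\<bar>c\<bar>"] by simp
    then show ?thesis using t by (simp add: field_simps power2_eq_square)
  qed
  let ?c = "\<lambda>h y. autocorrelation (hit_dev_at y) N h"
  have "(\<integral>y. autocorrelation_norm (hit_dev_at y) N \<partial>gauss_measure) \<le>
      (\<integral>y. (\<Sum>n=1..N. (hit_dev_at y n)\<^sup>2) + (\<Sum>h=1..N. t + (?c h y)\<^sup>2 / t) \<partial>gauss_measure)"
  proof (rule integral_mono[OF int])
    show "integrable gauss_measure (\<lambda>y. (\<Sum>n=1..N. (hit_dev_at y n)\<^sup>2) + (\<Sum>h=1..N. t + (?c h y)\<^sup>2 / t))"
      using int1 int3 by simp
    show "autocorrelation_norm (hit_dev_at y) N \<le>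
        (\<Sum>n=1..N. (hit_dev_at y n)\<^sup>2) + (\<Sum>h=1..N. t + (?c h y)\<^sup>2 / t)" for y
      unfolding autocorrelation_norm_def sum_distrib_left by (intro add_left_mono sum_mono am_gm)
  qed
  also have "\<dots> = (\<Sum>n=1..N. \<integral>y. (hit_dev_at y n)\<^sup>2 \<partial>gauss_measure) +
      (real N * t + (\<Sum>h=1..N. \<integral>y. (?c h y)\<^sup>2 \<partial>gauss_measure) / t)"
    using int1 int3
    by (simp add: sum.distrib sum_divide_distrib)
  also have "\<dots> \<le> 2 * cum_prob N + (real N * t + (real N ^ 3 / 2 ^ K + 21 * real K * (cum_prob N)\<^sup>2) / t)"
    unfolding sum_distrib_left using t
    by (intro add_mono sum_mono integral_hit_dev_square order_refl divide_right_mono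
        integral_autocorrelation_square_sum[OF K]) auto
  finally show "(\<integral>y. autocorrelation_norm (hit_dev_at y) N \<partial>gauss_measure) \<le>
      2 * cum_prob N + real N * t + (real N ^ 3 / 2 ^ K + 21 * real K * (cum_prob N)\<^sup>2) / t" by simp
qed

section \<open>Expected number of hits and choice of the subsequence\<close>

lemma cum_prob_ge:
  "N \<ge> 1 \<Longrightarrow> min 1 (ln b) / 2 * real N powr (1 - a) \<le> cum_prob N"
proof -
  assume N: "N \<ge> 1"
  have "min 1 (ln b) / 2 * real N powr (1 - a) = real N * (min 1 (ln b) / 2 * real N powr (- a))"
    using N by (simp add: powr_diff powr_minus field_simps)
  also have "\<dots> \<le> real N * hit_prob N" using hit_prob_ge[OF N] by (intro mult_left_mono) auto
  also have "\<dots> = (\<Sum>n=1..N. hit_prob N)" by simp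
  also have "\<dots> \<le> cum_prob N" by (intro sum_mono hit_prob_antimono') auto
  finally show ?thesis .
qed

lemma cum_prob_diverges: "filterlim cum_prob at_top sequentially"
proof (rule filterlim_at_top_mono)
  show "filterlim (\<lambda>N. min 1 (ln b) / 2 * real N powr (1 - a)) at_top sequentially"
  proof (rule filterlim_tendsto_pos_mult_at_top[OF tendsto_const])
    show "0 < min 1 (ln b) / 2" using b by simp
    have "0 < 1 - a" using a by simp
    then show "filterlim (\<lambda>N. real N powr (1 - a)) at_top sequentially" by real_asymp
  qed
  show "\<forall>\<^sub>F N in sequentially. min 1 (ln b) / 2 * real N powr (1 - a) \<le> cum_prob N"
    using eventually_ge_at_top[of 1] by eventually_elim (rule cum_prob_ge)
qed

text \<open>The means have to be of order 1 / k^2. The exponent 5 in the condition on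
  \<open>P\<close> is spent as follows: 2 on the factor k^2 in 1 / t, 1 on the cutoff proportional
  to k, and 2 on summability.\<close>

lemma AE_summable_autocorrelation_norm:
  fixes P :: nat
  assumes P: "real P * (1 - 2 * a) \<ge> 5"
  shows "AE y in gauss_measure. summable (\<lambda>k. autocorrelation_norm (hit_dev_at y) (k ^ P) / (cum_prob (k ^ P))\<^sup>2)"
proof -
  define c where "c = min 1 (ln b) / 2"
  have c: "c > 0" using b by (simp add: c_def)
  have P0: "P > 0" using P by (cases P) auto
  define C where "C = 2 / c\<^sup>2 + 1 + 1 / c ^ 4 + 63 * real P / c\<^sup>2"
  have C: "C \<ge> 0" using c by (simp add: C_def)
  have main: "(\<integral>\<^sup>+y. ennreal (autocorrelation_norm (hit_dev_at y) (k ^ P) / (cum_prob (k ^ P))\<^sup>2) \<partial>gauss_measure)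
      \<le> ennreal (C * (1 / real k ^ 2))" for k
  proof (cases "k = 0")
    \<comment> \<open>At \<open>k = 0\<close> both sides vanish, because division by 0 gives
      0.\<close>
    case True
    then show ?thesis using P0 by (simp add: power_0_left)
  next
    case False
    then have k: "real k \<ge> 1" by simp
    define N where "N = k ^ P"
    define W where "W = cum_prob N"
    have N1: "N \<ge> 1" using False by (simp add: N_def)
    have W0: "W > 0"
      unfolding W_def using N1 hit_prob_pos by (intro sum_pos) auto
    have WN: "W \<le> real N"
      unfolding W_def using sum_mono[of "{1..N}" hit_prob "\<lambda>_. 1"] hit_prob_le_1 by simp
    \<comment> \<open>W^2 is at least c^2 N N^(1 - 2a), and N^(1 - 2a) = k^(P (1 - 2a)) is at least
      k^5.\<close>
    have W2: "c\<^sup>2 * (real N * real k ^ 5) \<le> W\<^sup>2"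
    proof -
      have "real k ^ 5 = real k powr 5" using k by (simp add: powr_numeral)
      also have "\<dots> \<le> real k powr (real P * (1 - 2 * a))" using k P by (intro powr_mono) auto
      also have "\<dots> = real N powr (1 - 2 * a)"
        using k by (simp add: N_def powr_powr[symmetric] powr_realpow)
      finally have "real N * real k ^ 5 \<le> real N powr 1 * real N powr (1 - 2 * a)"
        using N1 by simp
      also have "\<dots> = (real N powr (1 - a))\<^sup>2"
        unfolding power2_eq_square powr_add[symmetric] by simp
      finally have "c\<^sup>2 * (real N * real k ^ 5) \<le> (c * real N powr (1 - a))\<^sup>2"
        using c by (simp add: power_mult_distrib)
      also have "\<dots> \<le> W\<^sup>2"
        unfolding W_def c_def[symmetric] using c cum_prob_ge[OF N1] by (intro power_mono) (auto simp: c_def)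
      finally show ?thesis .
    qed
    \<comment> \<open>Chosen so that the term N t, divided by W^2, is exactly 1 / k^2.\<close>
    define t where "t = W\<^sup>2 / (real N * real k ^ 2)"
    have t: "t > 0" using W0 N1 k by (simp add: t_def)
    \<comment> \<open>With the cutoff 3 P k, the inequality k \<le> 2^k gives N^3 = k^(3 P) \<le>
      2^(3 P k), so the mixing tail contributes at most 1.\<close>
    have K: "1 \<le> 3 * P * k" using P0 False by simp
    have NK: "real N ^ 3 / 2 ^ (3 * P * k) \<le> 1"
    proof -
      have "k \<le> 2 ^ k" using less_exp[of k] by simp
      then have "real k ^ (3 * P) \<le> (2 ^ k) ^ (3 * P)"
        using of_nat_mono[of k "2 ^ k", where 'a = real] by (intro power_mono) auto
      then have "real N ^ 3 \<le> 2 ^ (3 * P * k)"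
        by (simp add: N_def flip: power_mult) (simp add: mult_ac)
      then show ?thesis by simp
    qed
    have "(\<integral>y. autocorrelation_norm (hit_dev_at y) N \<partial>gauss_measure) \<le>
        2 * W + real N * t + (real N ^ 3 / 2 ^ (3 * P * k) + 21 * real (3 * P * k) * W\<^sup>2) / t"
      unfolding W_def by (rule integral_autocorrelation_norm_le(2)[OF K t])
    also have "\<dots> \<le> 2 * W + real N * t + (1 + 21 * real (3 * P * k) * W\<^sup>2) / t"
      using NK t by (intro add_left_mono divide_right_mono add_right_mono) auto
    finally have "(\<integral>y. autocorrelation_norm (hit_dev_at y) N \<partial>gauss_measure) / W\<^sup>2 \<le>
        (2 * W + real N * t + (1 + 21 * real (3 * P * k) * W\<^sup>2) / t) / W\<^sup>2"
      by (rule divide_right_mono) simp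
    also have "\<dots> = 2 / W + 1 / real k ^ 2 + real N * real k ^ 2 / W\<^sup>2 * (1 / W\<^sup>2) +
        63 * real P * real k * (real N * real k ^ 2 / W\<^sup>2)"
      using W0 N1 k unfolding t_def by (simp add: field_simps power2_eq_square)
    also have "\<dots> \<le> 2 / c\<^sup>2 * (1 / real k ^ 2) + 1 / real k ^ 2 + 1 / c ^ 4 * (1 / real k ^ 2) +
        63 * real P / c\<^sup>2 * (1 / real k ^ 2)"
    proof -
      have k25: "real k ^ 2 \<le> real k ^ 5" using k by (intro power_increasing) auto
      have NW: "real N * real k ^ 2 / W\<^sup>2 \<le> 1 / c\<^sup>2 * (1 / real k ^ 3)"
      proof -
        have "real N * real k ^ 2 * (c\<^sup>2 * real k ^ 3) = c\<^sup>2 * (real N * real k ^ 5)"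
          by (simp add: eval_nat_numeral mult_ac)
        then have "real N * real k ^ 2 * (c\<^sup>2 * real k ^ 3) \<le> W\<^sup>2" using W2 by (simp only:)
        then show ?thesis using W0 c k by (simp add: divide_le_eq le_divide_eq field_simps)
      qed
      \<comment> \<open>\<open>W \<le> N\<close> removes one factor from the bound on W^2 and leaves
        a lower bound for W itself, needed for the diagonal term 2 / W.\<close>
      have "W * (c\<^sup>2 * real k ^ 5) \<le> W * W"
      proof -
        have "W * (c\<^sup>2 * real k ^ 5) \<le> real N * (c\<^sup>2 * real k ^ 5)"
          using WN c k by (intro mult_right_mono) auto
        also have "\<dots> \<le> W * W" using W2 by (simp add: power2_eq_square mult_ac)
        finally show ?thesis .
      qed
      then have Wk: "c\<^sup>2 * real k ^ 5 \<le> W" using W0 by simp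
      have "c\<^sup>2 * real k ^ 2 \<le> c\<^sup>2 * real k ^ 5" using k25 c by (intro mult_left_mono) auto
      with Wk have Wk2: "c\<^sup>2 * real k ^ 2 \<le> W" by linarith
      then have 1: "2 / W \<le> 2 / c\<^sup>2 * (1 / real k ^ 2)"
        using W0 c k by (simp add: field_simps)
      have "real N * real k ^ 5 \<ge> 1 * 1" using N1 k by (intro mult_mono) (auto intro: one_le_power)
      then have "c\<^sup>2 \<le> c\<^sup>2 * (real N * real k ^ 5)" using c by (simp add: mult_le_cancel_left1)
      with W2 have "c\<^sup>2 \<le> W\<^sup>2" by linarith
      then have "1 / W\<^sup>2 \<le> 1 / c\<^sup>2" using c W0 by (intro divide_left_mono) auto
      have "1 / c\<^sup>2 * (1 / real k ^ 3) \<le> 1 / c\<^sup>2 * (1 / real k ^ 2)"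
        using k c by (intro mult_left_mono divide_left_mono power_increasing) auto
      with NW have "real N * real k ^ 2 / W\<^sup>2 \<le> 1 / c\<^sup>2 * (1 / real k ^ 2)" by linarith
      then have "real N * real k ^ 2 / W\<^sup>2 * (1 / W\<^sup>2) \<le> 1 / c\<^sup>2 * (1 / real k ^ 2) * (1 / c\<^sup>2)"
        using \<open>1 / W\<^sup>2 \<le> 1 / c\<^sup>2\<close> by (intro mult_mono) auto
      also have "\<dots> = 1 / c ^ 4 * (1 / real k ^ 2)" by (simp add: eval_nat_numeral)
      finally have 2: "real N * real k ^ 2 / W\<^sup>2 * (1 / W\<^sup>2) \<le> 1 / c ^ 4 * (1 / real k ^ 2)" .
      have "63 * real P * real k * (real N * real k ^ 2 / W\<^sup>2) \<le>
          63 * real P * real k * (1 / c\<^sup>2 * (1 / real k ^ 3))"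
        using NW by (intro mult_left_mono) auto
      also have "\<dots> = 63 * real P / c\<^sup>2 * (1 / real k ^ 2)"
        using k by (simp add: field_simps eval_nat_numeral)
      finally have 3: "63 * real P * real k * (real N * real k ^ 2 / W\<^sup>2) \<le>
          63 * real P / c\<^sup>2 * (1 / real k ^ 2)" .
      from 1 2 3 show ?thesis by linarith
    qed
    also have "\<dots> = C * (1 / real k ^ 2)" by (simp add: C_def algebra_simps)
    finally have le: "(\<integral>y. autocorrelation_norm (hit_dev_at y) N \<partial>gauss_measure) / W\<^sup>2 \<le> C * (1 / real k ^ 2)" .
    have "(\<integral>\<^sup>+y. ennreal (autocorrelation_norm (hit_dev_at y) N / W\<^sup>2) \<partial>gauss_measure) =
        ennreal (\<integral>y. autocorrelation_norm (hit_dev_at y) N / W\<^sup>2 \<partial>gauss_measure)"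
      by (rule nn_integral_eq_integral)
        (use integral_autocorrelation_norm_le(1)[OF K t] autocorrelation_norm_nonneg in auto)
    also have "\<dots> \<le> ennreal (C * (1 / real k ^ 2))"
      using le by (intro ennreal_leI) simp
    finally show ?thesis unfolding N_def W_def .
  qed
  show ?thesis
  proof (rule AE_summable[OF _ _ main])
    show "summable (\<lambda>k. C * (1 / real k ^ 2))"
      using inverse_power_summable[of 2, where 'a = real]
      by (intro summable_mult) (simp add: inverse_eq_divide)
  qed (use C autocorrelation_norm_nonneg in auto)
qed

text \<open>\<open>P\<close> is fixed before the null set is taken: it depends only on
  \<open>a\<close>, and the weights only on \<open>a\<close> and \<open>b\<close>.\<close>

lemma AE_good_weights:
  "\<exists>P. AE y in gauss_measure. good_weights (indicator (gauss_hits a b y)) hit_prob P"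
proof -
  obtain P :: nat where "5 / (1 - 2 * a) \<le> real P" using real_arch_simple by blast
  then have P: "real P * (1 - 2 * a) \<ge> 5" using a by (simp add: field_simps)
  have P0: "P > 0" using P by (cases P) auto
  \<comment> \<open>Along such an orbit the half-line below \<open>hit_level n\<close> and the open
    target interval are hit at the same times.\<close>
  have "AE y in gauss_measure. \<forall>n. (gauss_map ^^ n) y \<in> {0<..<1}"
    using gauss.AE_funpow[OF AE_gauss_measure_range] by (simp add: AE_all_countable)
  with AE_summable_autocorrelation_norm[OF P]
  have "AE y in gauss_measure. good_weights (indicator (gauss_hits a b y)) hit_prob P"
  proof eventually_elim
    case (elim y)
    have "indicator (gauss_hits a b y) n - hit_prob n = hit_dev_at y n" if "n \<ge> 1" for n
      using elim(2) that
      by (auto simp: hit_dev_at_def hit_dev_def gauss_hits_def hit_level_def max_def indicator_def)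
    then have "autocorrelation_norm (\<lambda>n. indicator (gauss_hits a b y) n - hit_prob n) N =
        autocorrelation_norm (hit_dev_at y) N" for N
      unfolding autocorrelation_norm_def autocorrelation_def by simp
    then show ?case
      by unfold_locales
        (use elim(1) P0 hit_prob_pos hit_prob_antimono cum_prob_diverges in auto)
  qed
  then show ?thesis by blast
qed

end

theorem corollary2:
  fixes a b :: real
  assumes "0 < a" and "a < 1 / 2" and "1 < b"
  shows "exceptional_set a b \<in> null_sets lebesgue \<and>
    (\<forall>y \<in> {0..<1} - exceptional_set a b.
       infinite (gauss_hits a b y) \<and>
       pointwise_universally_good TYPE('x) 2 (increasing_sequence (gauss_hits a b y)) \<and>
       ergodic_sequence TYPE('x) (increasing_sequence (gauss_hits a b y)))"
proof
  obtain p P where "AE y in gauss_measure. good_weights (indicator (gauss_hits a b y)) p P"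
    using AE_good_weights[OF assms] by blast
  then have "AE y in lborel. y \<in> {0<..<1} \<longrightarrow> good_weights (indicator (gauss_hits a b y)) p P"
    by (simp only: AE_gauss_measure_iff)
  then have "AE y in lborel. y \<in> {0<..<1} \<longrightarrow> y \<notin> exceptional_set a b"
  proof eventually_elim
    case (elim y)
    have "gauss_hits a b y \<subseteq> {1..}" by (auto simp: gauss_hits_def)
    with elim show ?case
      unfolding exceptional_set_def using good_weights_imp_good_sequence by blast
  qed
  \<comment> \<open>The Gauss measure lives on the open interval, so the point 0 is discarded
    separately.\<close>
  with AE_lborel_singleton[of 0]
  have "AE y in lborel. y \<notin> exceptional_set a b"
    by eventually_elim (auto simp: exceptional_set_def)
  \<comment> \<open>The exceptional set is only enclosed in a Borel null set; its own measurability
    comes from the completion.\<close>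
  then obtain N where N: "N \<in> null_sets lborel" "exceptional_set a b \<subseteq> N"
    by (auto simp: eventually_ae_filter)
  then show "exceptional_set a b \<in> null_sets lebesgue"
    by (blast intro: null_sets_completion_subset null_sets_completionI)
  show "\<forall>y \<in> {0..<1} - exceptional_set a b.
       infinite (gauss_hits a b y) \<and>
       pointwise_universally_good TYPE('x) 2 (increasing_sequence (gauss_hits a b y)) \<and>
       ergodic_sequence TYPE('x) (increasing_sequence (gauss_hits a b y))"
    \<comment> \<open>For each remaining \<open>y\<close> the property is known on path space, and
      the transfer lemmas carry it to the type \<open>'x\<close>.\<close>
    by (auto simp: exceptional_set_def intro: pointwise_universally_good_transfer ergodic_sequence_transfer)
qed

end
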